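(* Let $b_0,b_1,b_2,\dots$ be positive numbers with $\sup_k b_{k+1}/b_k<\infty$, let $H^2(\beta)$ be the Hilbert space of formal power series in $z=(z_1,\dots,z_m)$ with norm $\|f\|^2=\sum_{k\ge0}b_k^2\|f_{[k]}\|^2_{L^2(\partial\mathbb B,\sigma)}$, and let $M_z$ be the (bounded, spherical) multiplication $m$-tuple on $H^2(\beta)$. Define $$R(M_z)=\lim_{j\to\infty}\sup_{k\ge0}\Big(\frac{b_{k+j}}{b_k}\Big)^{1/j},\quad r(M_z)=\liminf_{j\to\infty}b_j^{1/j},\quad i(M_z)=\lim_{j\to\infty}\inf_{k\ge0}\Big(\frac{b_{k+j}}{b_k}\Big)^{1/j}.$$ Then $i(M_z)\le r(M_z)\le R(M_z)$ and: (1) the Taylor spectrum of $M_z$ is the closed ball $\overline{\mathbb B}_{R(M_z)}$; (2) $\mathbb B_{r(M_z)}$ is the largest open ball (centered at $0$) in which all power series in $H^2(\beta)$ converge; (3) either $\sigma_p(M_z^* )=\mathbb B_{r(M_z)}$ or $\sigma_p(M_z^* )=\overline{\mathbb B}_{r(M_z)}$; (4) $\sigma_{ap}(M_z)=\{z\in\mathbb C^m: i(M_z)\le\|z\|_2\le R(M_z)\}$; (5) if moreover $\lim_{k\to\infty}\big(\frac{b_{k+1}}{b_k}-\frac{b_k}{b_{k-1}}\big)=0$, then the essential spectrum of $M_z$ is the closed ball shell $\{z:\liminf_k\frac{b_{k+1}}{b_k}\le\|z\|_2\le\limsup_k\frac{b_{k+1}}{b_k}\}$.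
   Context: $f_{[k]}$ is the homogeneous part of degree $k$ of a formal power series $f$; $\sigma$ is the normalized surface area measure on the unit sphere $\partial\mathbb B$ of $\mathbb C^m$; $\mathbb B_\rho$, $\overline{\mathbb B}_\rho$ are the open and closed Euclidean balls of radius $\rho$ centered at $0$. $\sigma_p(M_z^* )$ is the joint point spectrum of $M_z^*=(M_{z_1}^*,\dots,M_{z_m}^* )$ (joint eigenvalues), $\sigma_{ap}$ the joint approximate point spectrum, and the essential spectrum is the Taylor essential spectrum. *)

theory Defs
  imports "HOL-Analysis.Analysis"
begin

(* C^m is modelled as complex^'n with 'n a finite (linearly ordered) index type, m = CARD('n).
   Multi-indices are functions 'n => nat; formal power series are maps (multi-index => complex). *)

type_synonym 'n mindex = "'n \<Rightarrow> nat"
type_synonym 'n fps_m = "'n mindex \<Rightarrow> complex"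

definition mdeg :: "'n::finite mindex \<Rightarrow> nat" where
  "mdeg \<alpha> = (\<Sum>i\<in>UNIV. \<alpha> i)"

definition monom :: "'n::finite mindex \<Rightarrow> complex^'n \<Rightarrow> complex" where
  "monom \<alpha> z = (\<Prod>i\<in>UNIV. (z$i) ^ (\<alpha> i))"

definition hom_part :: "'n::finite fps_m \<Rightarrow> nat \<Rightarrow> complex^'n \<Rightarrow> complex" where
  "hom_part f k z = (\<Sum>\<alpha>\<in>{\<alpha>. mdeg \<alpha> = k}. f \<alpha> * monom \<alpha> z)"

text \<open>Normalized surface measure on the unit sphere (cone construction:
  sigma(E) = Lebesgue measure of the cone {r x : 0 < r <= 1, x in E} divided by
  the Lebesgue measure of the unit ball).\<close>
definition sphere_sigma :: "'a::euclidean_space measure" where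
  "sphere_sigma = measure_of (sphere 0 1) (sets (restrict_space borel (sphere 0 1)))
     (\<lambda>E. emeasure lborel {r *\<^sub>R x | r x. 0 < r \<and> r \<le> 1 \<and> x \<in> E} / emeasure lborel (ball (0::'a) 1))"

definition hom_inner :: "'n::finite fps_m \<Rightarrow> 'n fps_m \<Rightarrow> nat \<Rightarrow> complex" where
  "hom_inner f g k = (\<integral>x. hom_part f k x * cnj (hom_part g k x) \<partial>(sphere_sigma :: (complex^'n) measure))"

definition hom_norm2 :: "'n::finite fps_m \<Rightarrow> nat \<Rightarrow> real" where
  "hom_norm2 f k = (\<integral>x. (cmod (hom_part f k x))^2 \<partial>(sphere_sigma :: (complex^'n) measure))"

definition H2 :: "(nat \<Rightarrow> real) \<Rightarrow> 'n::finite fps_m set" where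
  "H2 b = {f. summable (\<lambda>k. (b k)^2 * hom_norm2 f k)}"

definition H2_norm :: "(nat \<Rightarrow> real) \<Rightarrow> 'n::finite fps_m \<Rightarrow> real" where
  "H2_norm b f = sqrt (\<Sum>k. (b k)^2 * hom_norm2 f k)"

definition H2_inner :: "(nat \<Rightarrow> real) \<Rightarrow> 'n::finite fps_m \<Rightarrow> 'n fps_m \<Rightarrow> complex" where
  "H2_inner b f g = (\<Sum>k. complex_of_real ((b k)^2) * hom_inner f g k)"

definition Mz :: "'n \<Rightarrow> 'n fps_m \<Rightarrow> 'n fps_m" where
  "Mz i f = (\<lambda>\<alpha>. if \<alpha> i = 0 then 0 else f (\<alpha>(i := \<alpha> i - 1)))"

definition Mz_shift :: "complex^'n \<Rightarrow> 'n \<Rightarrow> 'n fps_m \<Rightarrow> 'n fps_m" where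
  "Mz_shift lam i f = (\<lambda>\<alpha>. Mz i f \<alpha> - lam$i * f \<alpha>)"

definition forms :: "(nat \<Rightarrow> real) \<Rightarrow> nat \<Rightarrow> ('n::finite set \<Rightarrow> 'n fps_m) set" where
  "forms b p = {\<omega>. \<forall>S. \<omega> S \<in> H2 b \<and> (card S \<noteq> p \<longrightarrow> \<omega> S = (\<lambda>_. 0))}"

definition koszul_d :: "complex^'n::{finite,linorder} \<Rightarrow> ('n set \<Rightarrow> 'n fps_m) \<Rightarrow> ('n set \<Rightarrow> 'n fps_m)" where
  "koszul_d lam \<omega> = (\<lambda>S \<alpha>. \<Sum>i\<in>S. (-1) ^ card {j\<in>S. j < i} * Mz_shift lam i (\<omega> (S - {i})) \<alpha>)"

definition koszul_ker :: "(nat \<Rightarrow> real) \<Rightarrow> complex^'n::{finite,linorder} \<Rightarrow> nat \<Rightarrow> ('n set \<Rightarrow> 'n fps_m) set" where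
  "koszul_ker b lam p = {\<omega>\<in>forms b p. koszul_d lam \<omega> = (\<lambda>_ _. 0)}"

definition koszul_ran :: "(nat \<Rightarrow> real) \<Rightarrow> complex^'n::{finite,linorder} \<Rightarrow> nat \<Rightarrow> ('n set \<Rightarrow> 'n fps_m) set" where
  "koszul_ran b lam p = (if p = 0 then {\<lambda>_ _. 0} else koszul_d lam ` forms b (p - 1))"

definition taylor_spectrum :: "(nat \<Rightarrow> real) \<Rightarrow> (complex^'n::{finite,linorder}) set" where
  "taylor_spectrum b = {lam. \<not> (\<forall>p. koszul_ker b lam p = koszul_ran b lam p)}"

text \<open>Taylor essential spectrum: the Koszul complex fails to be Fredholm, i.e. some
  cohomology space ker/ran is infinite dimensional.\<close>
definition taylor_ess_spectrum :: "(nat \<Rightarrow> real) \<Rightarrow> (complex^'n::{finite,linorder}) set" where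
  "taylor_ess_spectrum b = {lam. \<not> (\<forall>p. \<exists>F. finite F \<and> F \<subseteq> koszul_ker b lam p \<and>
      (\<forall>\<omega>\<in>koszul_ker b lam p. \<exists>c. (\<lambda>S \<alpha>. \<omega> S \<alpha> - (\<Sum>\<eta>\<in>F. c \<eta> * \<eta> S \<alpha>)) \<in> koszul_ran b lam p))}"

text \<open>Joint point spectrum of M_z^*: common eigenvalues lambda_i of the adjoints,
  M_{z_i}^* f = lambda_i f, expressed through the inner product.\<close>
definition point_spec_adj :: "(nat \<Rightarrow> real) \<Rightarrow> (complex^'n::finite) set" where
  "point_spec_adj b = {lam. \<exists>f\<in>H2 b. f \<noteq> (\<lambda>_. 0) \<and>
      (\<forall>i. \<forall>h\<in>H2 b. H2_inner b (Mz i h) f = H2_inner b h (\<lambda>\<alpha>. lam$i * f \<alpha>))}"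

definition approx_point_spec :: "(nat \<Rightarrow> real) \<Rightarrow> (complex^'n::finite) set" where
  "approx_point_spec b = {lam. \<exists>g::nat \<Rightarrow> 'n fps_m. (\<forall>n. g n \<in> H2 b \<and> H2_norm b (g n) = 1) \<and>
      (\<lambda>n. \<Sum>i\<in>UNIV. H2_norm b (Mz_shift lam i (g n))) \<longlonglongrightarrow> 0}"

definition converges_at :: "'n::finite fps_m \<Rightarrow> complex^'n \<Rightarrow> bool" where
  "converges_at f z \<longleftrightarrow> (\<lambda>\<alpha>. f \<alpha> * monom \<alpha> z) summable_on UNIV"

definition R_index :: "(nat \<Rightarrow> real) \<Rightarrow> real" where
  "R_index b = lim (\<lambda>j. SUP k. (b (k + j) / b k) powr (1 / real j))"

definition i_index :: "(nat \<Rightarrow> real) \<Rightarrow> real" where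
  "i_index b = lim (\<lambda>j. INF k. (b (k + j) / b k) powr (1 / real j))"

definition r_index :: "(nat \<Rightarrow> real) \<Rightarrow> real" where
  "r_index b = real_of_ereal (liminf (\<lambda>j. ereal (b j powr (1 / real j))))"

end

theory Submission
  imports Defs "HOL-Probability.Distributions" "HOL-Real_Asymp.Real_Asymp" "HOL-Library.Nat_Bijection"
begin

text \<open>
  Coordinate rotations make the monomials orthogonal on the sphere, and Gaussian integrals give
  \<open>\<parallel>z\<^sup>\<alpha>\<parallel>\<^sup>2 = \<alpha>! (m - 1)! / (m - 1 + \<bar>\<alpha>\<bar>)!\<close>. Hence \<open>\<Sum>\<^sub>i \<parallel>z\<^sub>i f\<parallel>\<^sup>2 = \<parallel>f\<parallel>\<^sup>2\<close> and
  \<open>\<Sum>\<^sub>i \<parallel>\<partial>\<^sub>i f\<parallel>\<^sup>2 = k (m + k - 1) \<parallel>f\<parallel>\<^sup>2\<close> for \<open>f\<close> homogeneous of degree \<open>k\<close>, and all estimates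
  become estimates of weighted sequences.

  If \<open>\<bar>\<lambda>\<bar> > R\<close>, then \<open>\<Sum>\<^sub>i cnj \<lambda>\<^sub>i (z\<^sub>i - \<lambda>\<^sub>i)\<close> is invertible, and contraction with the vector
  \<open>cnj \<lambda>\<close> contracts the Koszul complex. If \<open>\<bar>\<lambda>\<bar> < i\<close>, contraction with the partial derivatives gives the
  homotopy \<open>\<Sum>\<^sub>i (z\<^sub>i - \<lambda>\<^sub>i) \<partial>\<^sub>i + (m - p)\<close> in degree \<open>p\<close>, which a Neumann series in an equivalent
  norm inverts, except for the constants when \<open>p = m\<close>; so the cohomology is one-dimensional, in degree \<open>m\<close>, and
  evaluation at \<open>\<lambda>\<close> shows that it does not vanish.
  If \<open>i \<le> \<bar>\<lambda>\<bar> \<le> R\<close>, normalized sums \<open>\<Sum>\<^sub>k \<langle>z, \<lambda>\<rangle>\<^sup>k / \<bar>\<lambda>\<bar>\<^sup>2\<^sup>k\<close> over suitable intervals of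
  degrees are approximate eigenvectors: otherwise the squared norms of the summands would grow or decay
  geometrically, which forces \<open>\<bar>\<lambda>\<bar> < i\<close> or \<open>\<bar>\<lambda>\<bar> > R\<close>. An infinite sum \<open>G\<close> of such vectors with disjoint
  degrees is not in \<open>H\<^sup>2(\<beta>)\<close> although every \<open>(z\<^sub>i - \<lambda>\<^sub>i) G\<close> is, so the first cohomology is infinite-dimensional.
  The essential spectrum is thus always the shell \<open>i \<le> \<bar>\<lambda>\<bar> \<le> R\<close>; slow variation of the ratios
  \<open>b\<^sub>k\<^sub>+\<^sub>1 / b\<^sub>k\<close> is only needed to identify \<open>i\<close> and \<open>R\<close> with their lower and upper limits.

  An eigenvector of \<open>M\<^sub>z\<^sup>*\<close> is determined by its constant term, and it has finite norm iff
  \<open>\<Sum>\<^sub>k \<bar>\<lambda>\<bar>\<^sup>2\<^sup>k (m - 1 + k)! / (k! (m - 1)! b\<^sub>k\<^sup>2)\<close> converges; the radius of convergence of this series is \<open>r\<^sup>2\<close>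
  as a series in \<open>\<bar>\<lambda>\<bar>\<^sup>2\<close>.
\<close>

section \<open>Monomials on the unit sphere\<close>

text \<open>The indices \<open>i\<close> and \<open>R\<close> are limits of roots: they control
  \<open>b (k + j) / b k\<close> up to constants but no single ratio. Recursions on the degree need
  one-step bounds, which come from an equivalent weight (same space, equivalent norm) whose ratios
  stay on one side of \<open>norm lam\<close> with a uniform factor to spare. For
  \<open>norm lam > R\<close> errors are carried upwards in degree and partial sums suffice; for
  \<open>norm lam < i\<close> they are carried downwards, which presupposes square-summability. The
  derivatives are unbounded on \<open>H2 b\<close>; the homotopy is usable because inverting it
  divides by the degree. On the shell the test vectors are truncations of one series. Their error
  has an interior part of relative size about \<open>1 / k\<close> and two end terms, so the matter
  comes down to intervals of degrees whose end terms are negligible against their sum.\<close>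

lemma measurable_vec_lambda [measurable]:
  "vec_lambda \<in> borel_measurable (PiM (UNIV :: 'n::finite set) (\<lambda>_. lborel :: 'a::euclidean_space measure))"
  (is "_ \<in> borel_measurable ?M")
proof (subst borel_measurable_euclidean_space, intro ballI)
  fix b :: "'a^'n" assume "b \<in> Basis"
  then obtain i u where b: "b = axis i u" by (auto simp: Basis_vec_def)
  have "(\<lambda>x. x i) \<in> borel_measurable ?M"
    using measurable_component_singleton[of i UNIV "\<lambda>_. lborel :: 'a measure"] by simp
  then show "(\<lambda>x. vec_lambda x \<bullet> b) \<in> borel_measurable ?M"
    by (simp add: b inner_axis)
qed

lemma prod_Basis_vec:
  "(\<Prod>b\<in>(Basis :: ('a::euclidean_space^'n) set). h b) = (\<Prod>i\<in>UNIV. \<Prod>u\<in>Basis. h (axis i u))"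
proof -
  have eq: "(Basis :: ('a^'n) set) = (\<Union>i\<in>UNIV. axis i ` Basis)"
    by (auto simp: Basis_vec_def)
  show ?thesis unfolding eq
    by (subst prod.UNION_disjoint) (auto simp: axis_eq_axis nonzero_Basis prod.reindex inj_on_def)
qed

lemma mem_box_vec:
  "x \<in> box l u \<longleftrightarrow> (\<forall>i. x $ i \<in> box (l $ i) (u $ i))" for x :: "'a::euclidean_space^'n"
  by (auto simp: mem_box Basis_vec_def inner_axis)

lemma emeasure_lborel_box_vec:
  fixes l u :: "'a::euclidean_space^'n"
  assumes "\<And>b. b \<in> Basis \<Longrightarrow> l \<bullet> b \<le> u \<bullet> b"
  shows "(\<Prod>i\<in>UNIV. emeasure lborel (box (l $ i) (u $ i))) = ennreal (\<Prod>b\<in>Basis. (u - l) \<bullet> b)"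
proof -
  have le: "l $ i \<bullet> b \<le> u $ i \<bullet> b" if "b \<in> Basis" for i b
    using assms[of "axis i b"] that by (auto simp: inner_axis)
  have "(\<Prod>i\<in>UNIV. emeasure lborel (box (l $ i) (u $ i)))
      = (\<Prod>i\<in>UNIV. ennreal (\<Prod>b\<in>Basis. (u $ i - l $ i) \<bullet> b))"
    using le by (intro prod.cong refl emeasure_lborel_box) auto
  also have "\<dots> = ennreal (\<Prod>i\<in>UNIV. \<Prod>b\<in>Basis. (u $ i - l $ i) \<bullet> b)"
    using le by (intro prod_ennreal prod_nonneg) (auto simp: inner_diff_left)
  finally show ?thesis by (simp add: prod_Basis_vec inner_axis)
qed

text \<open>Boxes are products over the coordinates. This gives access to Fubini and to changing one
  coordinate at a time.\<close>

lemma lborel_vec_eq: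
  "(lborel :: ('a::euclidean_space^'n) measure) = distr (PiM UNIV (\<lambda>_. lborel)) borel vec_lambda"
proof (rule lborel_eqI)
  interpret product_sigma_finite "\<lambda>_::'n. lborel :: 'a measure" by standard
  fix l u :: "'a^'n" assume le: "\<And>b. b \<in> Basis \<Longrightarrow> l \<bullet> b \<le> u \<bullet> b"
  have "vec_lambda -` box l u = PiE UNIV (\<lambda>i. box (l $ i) (u $ i))"
    by (auto simp: mem_box_vec PiE_iff)
  then show "emeasure (distr (PiM UNIV (\<lambda>_. lborel)) borel vec_lambda) (box l u) = ennreal (\<Prod>b\<in>Basis. (u - l) \<bullet> b)"
    by (subst emeasure_distr)
      (auto simp: space_PiM emeasure_PiM emeasure_lborel_box_vec[OF le, symmetric])
qed simp

text \<open>Moves complex rotations to \<open>real^2\<close>, where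
  \<open>measurable_orthogonal_image\<close> applies.\<close>

lemma lborel_complex_eq:
  "(lborel :: complex measure) = distr (lborel :: (real^2) measure) borel (\<lambda>v. Complex (v $ 1) (v $ 2))"
proof (rule lborel_eqI)
  have [measurable]: "(\<lambda>v :: real^2. Complex (v $ 1) (v $ 2)) \<in> borel_measurable borel"
    by (intro borel_measurable_continuous_onI) (auto simp: Complex_eq intro!: continuous_intros)
  fix l u :: complex assume le: "\<And>b. b \<in> Basis \<Longrightarrow> l \<bullet> b \<le> u \<bullet> b"
  define l' u' where "l' = (\<chi> i::2. if i = 1 then Re l else Im l)" "u' = (\<chi> i::2. if i = 1 then Re u else Im u)"
  have "(\<lambda>v :: real^2. Complex (v $ 1) (v $ 2)) -` box l u = box l' u'"
    by (auto simp: mem_box_vec l'_u'_def forall_2 in_box_complex_iff)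
  moreover have "l' \<bullet> b \<le> u' \<bullet> b" if "b \<in> Basis" for b
    using le[of 1] le[of \<i>] that
    by (auto simp: Basis_vec_def inner_axis l'_u'_def complex_inner_1_right complex_inner_i_right)
  ultimately show "emeasure (distr lborel borel (\<lambda>v::real^2. Complex (v $ 1) (v $ 2))) (box l u) = ennreal (\<Prod>b\<in>Basis. (u - l) \<bullet> b)"
    by (subst emeasure_distr)
      (auto simp: prod_Basis_vec Basis_complex_def inner_axis l'_u'_def UNIV_2)
qed simp

lemma lborel_complex_rotate:
  fixes \<omega> :: complex assumes "cmod \<omega> = 1"
  shows "distr lborel borel ((*) \<omega>) = lborel"
proof (rule lborel_eqI[symmetric])
  fix l u :: complex assume le: "\<And>b. b \<in> Basis \<Longrightarrow> l \<bullet> b \<le> u \<bullet> b"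
  define \<phi> where "\<phi> = (\<lambda>v :: real^2. Complex (v $ 1) (v $ 2))"
  define \<psi> where "\<psi> = (\<lambda>z. \<chi> i::2. if i = 1 then Re z else Im z)"
  have [measurable]: "\<phi> \<in> borel_measurable borel" unfolding \<phi>_def
    by (intro borel_measurable_continuous_onI) (auto simp: Complex_eq intro!: continuous_intros)
  have \<phi>\<psi>: "\<phi> (\<psi> z) = z" for z by (simp add: \<phi>_def \<psi>_def)
  have \<psi>\<phi>: "\<psi> (\<phi> v) = v" for v by (auto simp: \<phi>_def \<psi>_def vec_eq_iff forall_2)
  have \<phi>n: "norm (\<phi> v) = norm v" for v
    by (simp add: \<phi>_def cmod_def norm_vec_def L2_set_def UNIV_2)
  \<comment> \<open>\<open>T\<close> rotates by \<open>cnj \<omega>\<close>, the inverse of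
    \<open>\<omega>\<close>, so that the preimage of a box under multiplication by
    \<open>\<omega>\<close> becomes an image under an orthogonal map.\<close>
  define T where "T = (\<lambda>v. \<psi> (cnj \<omega> * \<phi> v))"
  have lin: "linear T"
    by (rule linearI) (auto simp: T_def \<phi>_def \<psi>_def vec_eq_iff algebra_simps)
  have nT: "norm (T v) = norm v" for v
    by (metis T_def \<phi>\<psi> \<phi>n assms complex_mod_cnj mult_1 norm_mult)
  have orth: "orthogonal_transformation T"
    unfolding orthogonal_transformation using lin nT by auto
  have ww: "\<omega> * cnj \<omega> = 1" using assms by (simp add: complex_norm_square[symmetric])
  define B where "B = \<phi> -` box l u"
  have Bm: "B \<in> sets borel" unfolding B_def using measurable_sets_borel[of \<phi> borel "box l u"] by simp
  have eB: "emeasure lborel B = emeasure lborel (box l u)"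
    by (subst lborel_complex_eq, subst emeasure_distr) (auto simp: B_def \<phi>_def[symmetric])
  have fin: "emeasure lborel B < \<infinity>" unfolding eB by (simp add: emeasure_lborel_box_eq)
  have BL: "B \<in> lmeasurable"
    using fin Bm by (auto simp: fmeasurable_def)
  have TB: "T ` B = \<phi> -` ((*) \<omega> -` box l u)"
  proof safe
    fix v assume "v \<in> B" then show "T v \<in> \<phi> -` ((*) \<omega> -` box l u)"
      using ww by (simp add: T_def \<phi>\<psi> B_def mult.assoc[symmetric])
  next
    fix v assume "\<omega> * \<phi> v \<in> box l u"
    then have "\<psi> (\<omega> * \<phi> v) \<in> B" by (simp add: B_def \<phi>\<psi>)
    moreover have "T (\<psi> (\<omega> * \<phi> v)) = v"
      using ww by (simp add: T_def \<phi>\<psi> \<psi>\<phi> mult.assoc[symmetric] mult.commute[of "cnj \<omega>" \<omega>])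
    ultimately show "v \<in> T ` B" by force
  qed
  have Tm: "T ` B \<in> sets borel" unfolding TB
    by (intro measurable_sets_borel[of \<phi> borel] measurable_sets_borel[of "(*) \<omega>" borel]) auto
  have "emeasure (distr lborel borel ((*) \<omega>)) (box l u) = emeasure lborel ((*) \<omega> -` box l u)"
    by (subst emeasure_distr) auto
  also have "\<dots> = emeasure lborel (\<phi> -` ((*) \<omega> -` box l u))"
    by (subst lborel_complex_eq, subst emeasure_distr)
      (auto simp: \<phi>_def[symmetric] intro!: measurable_sets_borel[of "(*) \<omega>" borel])
  also have "\<dots> = emeasure lebesgue (T ` B)" using Tm by (simp add: TB)
  also have "\<dots> = emeasure lebesgue B"
    by (simp only: emeasure_eq_measure2[OF BL] measure_orthogonal_image[OF orth BL]
        emeasure_eq_measure2[OF measurable_orthogonal_image[OF orth BL]])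
  also have "\<dots> = emeasure lborel (box l u)" using Bm eB by simp
  also have "\<dots> = ennreal (\<Prod>b\<in>Basis. (u - l) \<bullet> b)" using le by (intro emeasure_lborel_box)
  finally show "emeasure (distr lborel borel ((*) \<omega>)) (box l u) = ennreal (\<Prod>b\<in>Basis. (u - l) \<bullet> b)" .
qed simp

section \<open>Rotation of one coordinate and radial integration\<close>

definition rot_coord :: "'n \<Rightarrow> complex \<Rightarrow> complex^'n \<Rightarrow> complex^'n" where
  "rot_coord i \<omega> z = (\<chi> j. if j = i then \<omega> * z $ j else z $ j)"

lemma rot_coord_measurable [measurable]: "(rot_coord i \<omega> :: complex^'n \<Rightarrow> _) \<in> borel_measurable borel"
proof -
  have "continuous_on UNIV (\<lambda>z::complex^'n. if j = i then \<omega> * z $ j else z $ j)" for j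
    by (cases "j = i") (auto intro!: continuous_intros)
  then show ?thesis
    unfolding rot_coord_def by (intro borel_measurable_continuous_onI continuous_on_vec_lambda)
qed

lemma lborel_vec_rotate:
  assumes "cmod \<omega> = 1"
  shows "distr lborel borel (rot_coord i \<omega>) = (lborel :: (complex^'n) measure)"
proof (rule lborel_eqI[symmetric])
  interpret product_sigma_finite "\<lambda>_::'n. lborel :: complex measure" by standard
  fix l u :: "complex^'n" assume le: "\<And>b. b \<in> Basis \<Longrightarrow> l \<bullet> b \<le> u \<bullet> b"
  define B where "B = (\<lambda>j. if j = i then (*) \<omega> -` box (l $ j) (u $ j) else box (l $ j) (u $ j))"
  have Bm: "B j \<in> sets borel" for j
    using measurable_sets_borel[of "(*) \<omega>" borel] by (simp add: B_def)
  have "emeasure lborel ((*) \<omega> -` box (l $ j) (u $ j)) = emeasure lborel (box (l $ j) (u $ j))" for j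
    by (subst (2) lborel_complex_rotate[OF assms, symmetric], subst emeasure_distr) auto
  then have eB: "emeasure lborel (B j) = emeasure lborel (box (l $ j) (u $ j))" for j
    by (simp add: B_def)
  have pre: "vec_lambda -` (rot_coord i \<omega> -` box l u) = PiE UNIV B"
    by (auto simp: mem_box_vec rot_coord_def B_def PiE_iff split: if_splits)
  have "rot_coord i \<omega> -` box l u \<in> sets borel"
    by (rule measurable_sets_borel[of _ borel]) auto
  then have "emeasure (distr lborel borel (rot_coord i \<omega>)) (box l u)
      = emeasure (PiM UNIV (\<lambda>_. lborel)) (vec_lambda -` (rot_coord i \<omega> -` box l u))"
    by (subst emeasure_distr) (auto simp: lborel_vec_eq emeasure_distr space_PiM)
  also have "\<dots> = (\<Prod>j\<in>UNIV. emeasure lborel (box (l $ j) (u $ j)))"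
    unfolding pre using Bm by (subst emeasure_PiM) (auto simp: eB)
  finally show "emeasure (distr lborel borel (rot_coord i \<omega>)) (box l u) = ennreal (\<Prod>b\<in>Basis. (u - l) \<bullet> b)"
    by (simp add: emeasure_lborel_box_vec[OF le])
qed simp

lemma nn_integral_lborel_scale:
  fixes f :: "'a::euclidean_space \<Rightarrow> ennreal"
  assumes [measurable]: "f \<in> borel_measurable borel" and "c > 0"
  shows "(\<integral>\<^sup>+x. f x \<partial>lborel) = ennreal (c ^ DIM('a)) * (\<integral>\<^sup>+x. f (c *\<^sub>R x) \<partial>lborel)"
  using assms by (subst lborel_affine[of c 0])
    (auto simp: nn_integral_density nn_integral_distr nn_integral_cmult)

text \<open>For \<open>g\<close> homogeneous of degree 0 the \<open>g\<close>-mass of the ball of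
  squared radius \<open>t\<close> is \<open>V * t ^ m\<close> by scaling. This fixes the law of the
  squared norm, and the integral becomes a Gamma integral. Squared norms and even dimension keep all
  exponents natural.\<close>

lemma nn_integral_radial:
  fixes g :: "'a::euclidean_space \<Rightarrow> ennreal"
  assumes [measurable]: "g \<in> borel_measurable borel"
    and hom: "\<And>c x. c > 0 \<Longrightarrow> g (c *\<^sub>R x) = g x"
    and dim: "DIM('a) = 2 * m"
    and V: "V = (\<integral>\<^sup>+x. g x * indicator (cball 0 1) x \<partial>lborel)" and fin: "V < \<infinity>"
  shows "(\<integral>\<^sup>+x. g x * ennreal ((norm x) ^ (2 * k) * exp (- (norm x)\<^sup>2)) \<partial>lborel) = V * ennreal (m * fact (m + k - 1))"
proof -
  have m: "m > 0" using dim DIM_positive[where 'a='a] by linarith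
  define \<nu> where "\<nu> = distr (density lborel g) borel (\<lambda>x. (norm x)\<^sup>2)"
  define \<nu>' where "\<nu>' = density lborel (\<lambda>t. V * (ennreal (m * t ^ (m - 1)) * indicator {0..} t))"
  have e1: "emeasure \<nu> {..t} = (if t < 0 then 0 else V * ennreal (t ^ m))" for t
  proof -
    have *: "emeasure \<nu> {..t} = (\<integral>\<^sup>+x. g x * indicator {x. (norm x)\<^sup>2 \<le> t} x \<partial>lborel)"
      unfolding \<nu>_def by (subst emeasure_distr)
        (auto simp: emeasure_density vimage_def)
    consider "t < 0" | "t = 0" | "t > 0" by linarith
    then show ?thesis
    proof cases
      case 1
      then have "{x::'a. (norm x)\<^sup>2 \<le> t} = {}" by (auto simp: not_le intro: less_le_trans)
      then show ?thesis using 1 * by simp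
    next
      case 2
      have "(\<integral>\<^sup>+x. g x * indicator {x. (norm x)\<^sup>2 \<le> t} x \<partial>lborel) = 0"
      proof (subst nn_integral_0_iff_AE)
        have "AE x in lborel. x \<noteq> (0::'a)" by (rule AE_lborel_singleton)
        then show "AE x in lborel. g x * indicator {x. (norm x)\<^sup>2 \<le> t} x = 0"
          using 2 by (auto elim!: eventually_mono)
      qed measurable
      then show ?thesis using 2 m * by simp
    next
      case 3
      have "(\<integral>\<^sup>+x. g x * indicator {x. (norm x)\<^sup>2 \<le> t} x \<partial>lborel)
         = ennreal (sqrt t ^ DIM('a)) * (\<integral>\<^sup>+x. g (sqrt t *\<^sub>R x) * indicator {x. (norm x)\<^sup>2 \<le> t} (sqrt t *\<^sub>R x) \<partial>lborel)"
        using 3 by (subst nn_integral_lborel_scale[of _ "sqrt t"]) auto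
      also have "(\<lambda>x::'a. g (sqrt t *\<^sub>R x) * indicator {x. (norm x)\<^sup>2 \<le> t} (sqrt t *\<^sub>R x))
          = (\<lambda>x. g x * indicator (cball 0 1) x)"
        using 3 by (auto simp: fun_eq_iff hom indicator_def power_mult_distrib power_le_one_iff abs_square_le_1 mult_le_cancel_left2)
      also have "sqrt t ^ DIM('a) = t ^ m" using 3 by (simp add: dim power_mult)
      finally show ?thesis using 3 * V by (simp add: mult.commute)
    qed
  qed
  have e2: "emeasure \<nu>' {..t} = (if t < 0 then 0 else V * ennreal (t ^ m))" for t
  proof -
    have *: "emeasure \<nu>' {..t} = V * (\<integral>\<^sup>+x. ennreal (m * x ^ (m - 1)) * indicator {0..t} x \<partial>lborel)"
      unfolding \<nu>'_def
      by (subst emeasure_density) (auto simp: nn_integral_cmult[symmetric] mult.assoc indicator_def intro!: nn_integral_cong)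
    have "(\<integral>\<^sup>+x. ennreal (m * x ^ (m - 1)) * indicator {0..t} x \<partial>lborel) = ennreal (t ^ m)" if "t \<ge> 0"
      using nn_integral_FTC_Icc[of "\<lambda>x. m * x ^ (m - 1)" 0 t "\<lambda>x. x ^ m"] that m
      by (auto intro!: derivative_eq_intros simp: zero_power)
    moreover have "{0..t} = {}" if "t < 0" using that by auto
    ultimately show ?thesis using * by auto
  qed
  have "\<nu> = \<nu>'"
  proof (rule measure_eqI_generator_eq[where E = "range (\<lambda>t::real. {..t})" and A = "\<lambda>i. {..real i}" and \<Omega> = UNIV])
    show "Int_stable (range (\<lambda>t::real. {..t}))" by (auto simp: Int_stable_def)
    show "sets \<nu> = sigma_sets UNIV (range (\<lambda>t::real. {..t}))"
      "sets \<nu>' = sigma_sets UNIV (range (\<lambda>t::real. {..t}))"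
      by (simp_all add: \<nu>_def \<nu>'_def borel_eq_atMost)
    show "(\<Union>i. {..real i}) = UNIV" using real_arch_simple by auto
    show "emeasure \<nu> {..real i} \<noteq> \<infinity>" for i
      using fin by (auto simp: e1 ennreal_mult_eq_top_iff)
  qed (auto simp: e1 e2)
  moreover have "(\<integral>\<^sup>+t. ennreal (t ^ k * exp (- t)) \<partial>\<nu>)
      = (\<integral>\<^sup>+x. g x * ennreal ((norm x) ^ (2 * k) * exp (- (norm x)\<^sup>2)) \<partial>lborel)"
    unfolding \<nu>_def by (subst nn_integral_distr) (auto simp: nn_integral_density power_mult)
  moreover have "(\<integral>\<^sup>+t. ennreal (t ^ k * exp (- t)) \<partial>\<nu>')
      = (\<integral>\<^sup>+t. V * ennreal m * (ennreal (t ^ (m + k - 1) * exp (- t)) * indicator {0..} t) \<partial>lborel)"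
    unfolding \<nu>'_def
  proof (subst nn_integral_density, goal_cases)
    case 3
    have "m + k - 1 = (m - 1) + k" using m by simp
    then show ?case
      by (intro nn_integral_cong)
        (auto simp: indicator_def ennreal_mult'[symmetric] power_add mult_ac)
  qed auto
  moreover have "\<dots> = V * ennreal (m * fact (m + k - 1))"
    by (subst nn_integral_cmult) (auto simp: nn_intergal_power_times_exp_Ici mult.assoc ennreal_mult')
  ultimately show ?thesis by simp
qed

text \<open>The squared norm of a monomial on the sphere, see \<open>monom_norm_integral\<close>.\<close>
definition cw :: "'n::finite mindex \<Rightarrow> real" where
  "cw \<alpha> = (\<Prod>i\<in>UNIV. fact (\<alpha> i)) * fact (CARD('n) - 1) / fact (CARD('n) - 1 + mdeg \<alpha>)"

lemma cw_pos: "cw \<alpha> > 0"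
  by (auto simp: cw_def intro!: divide_pos_pos mult_pos_pos prod_pos)

lemma norm_monom: "cmod (monom \<alpha> z) = (\<Prod>i\<in>UNIV. cmod (z $ i) ^ \<alpha> i)"
  by (simp add: monom_def prod_norm[symmetric] norm_power)

lemma norm_monom_le: "cmod (monom \<alpha> z) \<le> norm z ^ mdeg \<alpha>"
  unfolding norm_monom mdeg_def power_sum
  by (intro prod_mono conjI power_mono Finite_Cartesian_Product.norm_nth_le) auto

lemma monom_measurable [measurable]: "monom \<alpha> \<in> borel_measurable borel"
  unfolding monom_def by (intro borel_measurable_continuous_onI continuous_intros)

lemma monom_scaleR: "monom \<alpha> (c *\<^sub>R z) = of_real c ^ mdeg \<alpha> * monom \<alpha> z"
  by (simp add: monom_def mdeg_def scaleR_conv_of_real[where 'a=complex] power_mult_distrib prod.distrib power_sum)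

text \<open>The Gaussian weight factors over the coordinates, and each factor is
  \<open>nn_integral_radial\<close> with \<open>m = 1\<close>. The area of the disc stays symbolic
  because it cancels later.\<close>

lemma nn_integral_gauss:
  fixes \<alpha> :: "'n::finite mindex"
  shows "(\<integral>\<^sup>+z. ennreal ((cmod (monom \<alpha> z))\<^sup>2 * exp (- (norm z)\<^sup>2)) \<partial>lborel)
     = emeasure lborel (cball (0::complex) 1) ^ CARD('n) * ennreal (\<Prod>i\<in>UNIV. fact (\<alpha> i))"
proof -
  interpret product_sigma_finite "\<lambda>_::'n. lborel :: complex measure" by standard
  have 1: "(\<integral>\<^sup>+z. ennreal ((norm z) ^ (2 * k) * exp (- (norm z)\<^sup>2)) \<partial>(lborel :: complex measure)) = emeasure lborel (cball (0::complex) 1) * ennreal (fact k)" for k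
    using nn_integral_radial[of "\<lambda>_::complex. 1" 1 "emeasure lborel (cball (0::complex) 1)" k]
    using emeasure_lborel_cball_finite[of "0::complex" 1] by simp
  have "(\<integral>\<^sup>+z. ennreal ((cmod (monom \<alpha> z))\<^sup>2 * exp (- (norm z)\<^sup>2)) \<partial>(lborel :: (complex^'n) measure))
     = (\<integral>\<^sup>+x. ennreal ((cmod (monom \<alpha> (vec_lambda x)))\<^sup>2 * exp (- (norm (vec_lambda x :: complex^'n))\<^sup>2)) \<partial>PiM UNIV (\<lambda>_. lborel))"
    by (subst lborel_vec_eq, subst nn_integral_distr) auto
  also have "\<dots> = (\<integral>\<^sup>+x. (\<Prod>i\<in>UNIV. ennreal ((cmod (x i)) ^ (2 * \<alpha> i) * exp (- (cmod (x i))\<^sup>2))) \<partial>PiM UNIV (\<lambda>_. lborel))"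
  proof (intro nn_integral_cong)
    fix x :: "'n \<Rightarrow> complex"
    have "(cmod (monom \<alpha> (vec_lambda x)))\<^sup>2 = (\<Prod>i\<in>UNIV. cmod (x i) ^ (2 * \<alpha> i))"
      by (simp add: norm_monom prod_power_distrib power_mult[symmetric] mult.commute[of _ 2])
    moreover have "exp (- (norm (vec_lambda x :: complex^'n))\<^sup>2) = (\<Prod>i\<in>UNIV. exp (- (cmod (x i))\<^sup>2))"
      by (subst exp_sum[symmetric]) (simp_all add: norm_vec_def L2_set_def sum_nonneg sum_negf)
    ultimately show "ennreal ((cmod (monom \<alpha> (vec_lambda x)))\<^sup>2 * exp (- (norm (vec_lambda x :: complex^'n))\<^sup>2))
        = (\<Prod>i\<in>UNIV. ennreal ((cmod (x i)) ^ (2 * \<alpha> i) * exp (- (cmod (x i))\<^sup>2)))"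
      by (simp add: prod_ennreal prod.distrib)
  qed
  also have "\<dots> = (\<Prod>i\<in>UNIV. (emeasure lborel (cball (0::complex) 1) * ennreal (fact (\<alpha> i))))"
    by (subst product_nn_integral_prod) (auto simp: 1)
  finally show ?thesis
    by (simp add: prod.distrib prod_ennreal)
qed

text \<open>The same Gaussian integral is computed in polar form and coordinatewise. The quotient by
  \<open>norm z ^ (2 * mdeg \<alpha>)\<close> is homogeneous of degree 0, as the polar form
  requires.\<close>

lemma ball_moment:
  fixes \<alpha> :: "'n::finite mindex"
  shows "(\<integral>\<^sup>+z. ennreal ((cmod (monom \<alpha> z))\<^sup>2 / norm z ^ (2 * mdeg \<alpha>)) * indicator (cball 0 1) z \<partial>lborel)
     = ennreal (cw \<alpha>) * emeasure lborel (cball (0::complex^'n) 1)"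
proof -
  let ?m = "CARD('n)"
  define V where "V \<alpha> = (\<integral>\<^sup>+z. ennreal ((cmod (monom \<alpha> z))\<^sup>2 / norm z ^ (2 * mdeg \<alpha>)) * indicator (cball 0 1) z \<partial>(lborel :: (complex^'n) measure))" for \<alpha> :: "'n mindex"
  define V0 where "V0 = emeasure lborel (cball (0::complex^'n) 1)"
  have V0fin: "V0 < \<infinity>" unfolding V0_def by (rule emeasure_lborel_cball_finite)
  have le: "V \<alpha> \<le> V0" for \<alpha>
  proof -
    have "V \<alpha> \<le> (\<integral>\<^sup>+z. indicator (cball 0 1) z \<partial>(lborel :: (complex^'n) measure))"
      unfolding V_def
    proof (intro nn_integral_mono)
      fix z :: "complex^'n"
      have "(cmod (monom \<alpha> z))\<^sup>2 \<le> norm z ^ (2 * mdeg \<alpha>)"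
        using power_mono[OF norm_monom_le[of \<alpha> z] norm_ge_zero, of 2] by (simp add: power_mult[symmetric] mult.commute)
      then have "(cmod (monom \<alpha> z))\<^sup>2 / norm z ^ (2 * mdeg \<alpha>) \<le> 1"
        by (cases "norm z ^ (2 * mdeg \<alpha>) = 0")
          (simp_all only: div_by_0 zero_le_one, metis divide_le_eq_1_pos less_le norm_ge_zero zero_le_power)
      then show "ennreal ((cmod (monom \<alpha> z))\<^sup>2 / norm z ^ (2 * mdeg \<alpha>)) * indicator (cball 0 1) z \<le> indicator (cball 0 1) z"
        by (auto simp: indicator_def)
    qed
    then show ?thesis by (simp add: V0_def)
  qed
  then have fin: "V \<alpha> < \<infinity>" for \<alpha> using V0fin by (meson le_less_trans)
  have eq: "V \<alpha> * ennreal (?m * fact (?m + mdeg \<alpha> - 1)) = emeasure lborel (cball (0::complex) 1) ^ ?m * ennreal (\<Prod>i\<in>UNIV. fact (\<alpha> i))" for \<alpha>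
  proof -
    \<comment> \<open>At the origin the quotient is 0 by the convention for division; unless the
      degree is 0 the monomial vanishes there too, so the integrands agree everywhere.\<close>
    have z: "monom \<alpha> (0::complex^'n) = 0" if "mdeg \<alpha> \<noteq> 0"
      using that by (auto simp: monom_def mdeg_def zero_power)
    have "V \<alpha> * ennreal (?m * fact (?m + mdeg \<alpha> - 1)) = (\<integral>\<^sup>+z. ennreal ((cmod (monom \<alpha> z))\<^sup>2 / norm z ^ (2 * mdeg \<alpha>)) * ennreal (norm z ^ (2 * mdeg \<alpha>) * exp (- (norm z)\<^sup>2)) \<partial>(lborel :: (complex^'n) measure))"
      by (rule nn_integral_radial[symmetric, OF _ _ _ _ fin])
        (auto simp: V_def monom_scaleR norm_mult norm_power power_mult_distrib mult.commute simp flip: power_mult)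
    also have "\<dots> = (\<integral>\<^sup>+z. ennreal ((cmod (monom \<alpha> z))\<^sup>2 * exp (- (norm z)\<^sup>2)) \<partial>(lborel :: (complex^'n) measure))"
      using z by (intro nn_integral_cong) (auto simp: ennreal_mult'[symmetric] ennreal_mult''[symmetric])
    finally show ?thesis by (simp add: nn_integral_gauss)
  qed
  have V0: "V (\<lambda>_. 0) = V0" by (simp add: V_def V0_def mdeg_def monom_def)
  define r where "r = enn2real V0"
  have r: "V0 = ennreal r" using V0fin by (simp add: r_def)
  define s where "s = enn2real (V \<alpha>)"
  have s: "V \<alpha> = ennreal s" using fin[of \<alpha>] by (simp add: s_def)
  have pos: "r \<ge> 0" "s \<ge> 0" by (auto simp: r_def s_def)
  \<comment> \<open>The index 0 gives the volume of the ball itself; comparing with it eliminates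
    the power of the disc area.\<close>
  have "V \<alpha> * ennreal (?m * fact (?m + mdeg \<alpha> - 1)) = V0 * ennreal (?m * fact (?m - 1)) * ennreal (\<Prod>i\<in>UNIV. fact (\<alpha> i))"
    using eq[of "\<lambda>_. 0"] eq[of \<alpha>] by (simp add: V0 mdeg_def)
  then have "s * (?m * fact (?m + mdeg \<alpha> - 1)) = r * (?m * fact (?m - 1)) * (\<Prod>i\<in>UNIV. fact (\<alpha> i))"
    using pos by (simp add: r s ennreal_mult'[symmetric] ennreal_mult''[symmetric] prod_nonneg)
  moreover have "?m + mdeg \<alpha> - 1 = ?m - 1 + mdeg \<alpha>" using zero_less_card_finite[where 'a='n] by simp
  ultimately have "s = cw \<alpha> * r" by (simp add: cw_def field_simps)
  then have "V \<alpha> = ennreal (cw \<alpha>) * V0"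
    unfolding s r using pos cw_pos[of \<alpha>] by (simp add: ennreal_mult less_imp_le)
  then show ?thesis unfolding V_def V0_def .
qed

section \<open>Surface measure as the image of volume on the ball\<close>

definition sphere_proj :: "'a::euclidean_space \<Rightarrow> 'a" where
  "sphere_proj x = (if x = 0 then SOME b. b \<in> Basis else x /\<^sub>R norm x)"

text \<open>The value chosen at 0 makes this hold without an exceptional point, so
  \<open>sphere_proj\<close> is measurable into the sphere.\<close>

lemma norm_sphere_proj [simp]: "norm (sphere_proj x) = 1"
  by (auto simp: sphere_proj_def some_in_eq)

lemma sphere_proj_measurable [measurable]: "sphere_proj \<in> borel_measurable borel"
  unfolding sphere_proj_def[abs_def] by measurable

lemma sphere_proj_measurable': "sphere_proj \<in> borel \<rightarrow>\<^sub>M restrict_space borel (sphere 0 1)"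
  by (intro measurable_restrict_space2) auto

lemma sphere_proj_measurable_ball:
  "sphere_proj \<in> uniform_measure lborel (cball 0 1) \<rightarrow>\<^sub>M restrict_space borel (sphere 0 1)"
  by (subst measurable_cong_sets[of _ borel _ "restrict_space borel (sphere 0 1)"])
    (auto intro: sphere_proj_measurable')

lemma emeasure_cball_pos: "emeasure lborel (cball (0::'a::euclidean_space) 1) \<noteq> 0"
  using unit_ball_vol_pos[of "DIM('a)"] by (simp add: emeasure_cball ennreal_eq_0_iff not_le del: unit_ball_vol_pos)

text \<open>Up to the origin, a null set, the cone over \<open>E\<close> is the part of the ball
  that projects into \<open>E\<close>. Integrals over the sphere become integrals over the ball,
  where rotations act on Lebesgue measure.\<close>

lemma sphere_sigma_eq:
  "sphere_sigma = distr (uniform_measure lborel (cball 0 1)) (restrict_space borel (sphere 0 1)) (sphere_proj :: 'a::euclidean_space \<Rightarrow> 'a)"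
  (is "_ = ?D")
proof -
  let ?R = "restrict_space borel (sphere 0 1 :: 'a set)"
  have sp: "space ?R = sphere 0 1" by (simp add: space_restrict_space)
  have "emeasure lborel {r *\<^sub>R x | r x. 0 < r \<and> r \<le> 1 \<and> x \<in> E} / emeasure lborel (ball (0::'a) 1) = emeasure ?D E"
    if E: "E \<in> sets ?R" for E
  proof -
    have EB: "E \<in> sets borel" using E by (simp add: sets_restrict_space_iff)
    have Es: "norm x = 1" if "x \<in> E" for x using sets.sets_into_space[OF E] that by (auto simp: sp)
    have pm: "sphere_proj -` E \<in> sets borel" using measurable_sets_borel[OF sphere_proj_measurable EB] .
    have cone: "{r *\<^sub>R x | r x. 0 < r \<and> r \<le> 1 \<and> x \<in> E} = (cball 0 1 \<inter> sphere_proj -` E) - {0}"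
    proof safe
      fix x assume "x \<in> cball (0::'a) 1" "sphere_proj x \<in> E" "x \<noteq> 0"
      then show "\<exists>r y. x = r *\<^sub>R y \<and> 0 < r \<and> r \<le> 1 \<and> y \<in> E"
        by (intro exI[of _ "norm x"] exI[of _ "sphere_proj x"]) (auto simp: sphere_proj_def)
    qed (use Es Es[of 0] in \<open>auto simp: sphere_proj_def\<close>)
    have "emeasure lborel ((cball 0 1 \<inter> sphere_proj -` E) - {0}) = emeasure lborel (cball 0 1 \<inter> sphere_proj -` E)"
      using pm by (intro emeasure_Diff_null_set) auto
    moreover have "emeasure ?D E = emeasure (uniform_measure lborel (cball 0 1)) (sphere_proj -` E)"
      using E sphere_proj_measurable_ball by (subst emeasure_distr) (auto simp: measurable_def)
    moreover have "\<dots> = emeasure lborel (cball 0 1 \<inter> sphere_proj -` E) / emeasure lborel (cball (0::'a) 1)"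
      using pm by (intro emeasure_uniform_measure) auto
    moreover have "emeasure lborel (ball (0::'a) 1) = emeasure lborel (cball (0::'a) 1)"
      by (simp add: emeasure_ball emeasure_cball)
    ultimately show ?thesis unfolding cone by simp
  qed
  then have "sphere_sigma = measure_of (sphere 0 1) (sets ?R) (emeasure ?D)"
    unfolding sphere_sigma_def
    using sets.space_closed[of ?R] sets.sigma_sets_eq[of ?R]
    by (intro measure_of_eq) (auto simp: sp)
  also have "\<dots> = ?D"
    using measure_of_of_measure[of ?D] by (simp add: sp)
  finally show ?thesis .
qed

lemma prob_space_ball: "prob_space (uniform_measure lborel (cball (0::'a::euclidean_space) 1))"
  using emeasure_lborel_cball_finite[of "0::'a" 1] emeasure_cball_pos[where 'a='a]
  by (intro prob_space_uniform_measure) auto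

lemma integral_sphere_sigma:
  fixes F :: "'a::euclidean_space \<Rightarrow> 'b::{banach,second_countable_topology}"
  assumes "F \<in> borel_measurable borel"
  shows "(\<integral>x. F x \<partial>sphere_sigma) = (\<integral>x. F (sphere_proj x) \<partial>uniform_measure lborel (cball 0 1))"
  unfolding sphere_sigma_eq using assms sphere_proj_measurable_ball
  by (intro integral_distr) (auto intro: measurable_restrict_space1)

lemma distr_ball_rotate:
  assumes w: "cmod \<omega> = 1"
  shows "distr (uniform_measure lborel (cball (0::complex^'n) 1)) borel (rot_coord i \<omega>) = uniform_measure lborel (cball 0 1)"
proof (rule measure_eqI)
  fix A assume "A \<in> sets (distr (uniform_measure lborel (cball (0::complex^'n) 1)) borel (rot_coord i \<omega>))"
  then have A: "A \<in> sets borel" by simp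
  have n: "norm (rot_coord i \<omega> z) = norm z" for z :: "complex^'n"
    unfolding norm_vec_def rot_coord_def using w by (intro arg_cong2[where f=L2_set]) (auto simp: norm_mult)
  have pre: "rot_coord i \<omega> -` A \<in> sets borel" using measurable_sets_borel[OF rot_coord_measurable A] .
  have "emeasure lborel (cball 0 1 \<inter> rot_coord i \<omega> -` A) = emeasure (distr lborel borel (rot_coord i \<omega>)) (cball 0 1 \<inter> A)"
    using A by (subst emeasure_distr) (auto intro!: arg_cong[where f="emeasure lborel"] simp: n)
  then show "emeasure (distr (uniform_measure lborel (cball 0 1)) borel (rot_coord i \<omega>)) A = emeasure (uniform_measure lborel (cball 0 1)) A"
    using A pre by (subst emeasure_distr) (auto simp: lborel_vec_rotate[OF w])
qed simp

lemma monom_rot_coord: "monom \<alpha> (rot_coord i \<omega> z) = \<omega> ^ \<alpha> i * monom \<alpha> z"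
proof -
  have "monom \<alpha> (rot_coord i \<omega> z) = (\<Prod>j\<in>UNIV. (if j = i then \<omega> ^ \<alpha> j else 1) * (z $ j) ^ \<alpha> j)"
    unfolding monom_def rot_coord_def by (intro prod.cong) (auto simp: power_mult_distrib)
  then show ?thesis by (simp add: prod.distrib monom_def)
qed

lemma cnj_measurable [measurable]: "cnj \<in> borel_measurable borel"
  by (intro borel_measurable_continuous_onI continuous_intros)

lemma monom_orthogonal:
  assumes "\<alpha> \<noteq> \<beta>"
  shows "(\<integral>x. monom \<alpha> x * cnj (monom \<beta> x) \<partial>(sphere_sigma :: (complex^'n::finite) measure)) = 0"
proof -
  from assms obtain i where i: "\<alpha> i \<noteq> \<beta> i" by auto
  define U where "U = uniform_measure lborel (cball (0::complex^'n) 1)"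
  define F where "F = (\<lambda>x::complex^'n. monom \<alpha> x * cnj (monom \<beta> x))"
  have [measurable]: "F \<in> borel_measurable borel" by (simp add: F_def)
  define d where "d = int (\<alpha> i) - int (\<beta> i)"
  \<comment> \<open>Half a turn divided by the difference of the exponents: rotating coordinate
    \<open>i\<close> multiplies the integrand by \<open>cis pi = -1\<close>.\<close>
  define \<omega> where "\<omega> = cis (pi / d)"
  have d: "d \<noteq> 0" using i by (simp add: d_def)
  have w: "cmod \<omega> = 1" by (simp add: \<omega>_def)
  have c: "\<omega> ^ \<alpha> i * cnj (\<omega> ^ \<beta> i) = -1"
  proof -
    have "\<omega> ^ \<alpha> i * cnj (\<omega> ^ \<beta> i) = cis (\<alpha> i * (pi / d) - \<beta> i * (pi / d))"
      unfolding \<omega>_def Complex.DeMoivre cis_cnj cis_mult by simp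
    also have "\<alpha> i * (pi / d) - \<beta> i * (pi / d) = d * (pi / d)"
      unfolding left_diff_distrib[symmetric] by (simp add: d_def)
    also have "\<dots> = pi" using d by simp
    finally show ?thesis by simp
  qed
  have Fr: "F (rot_coord i \<omega> x) = - F x" for x
  proof -
    have "F (rot_coord i \<omega> x) = (\<omega> ^ \<alpha> i * cnj (\<omega> ^ \<beta> i)) * F x"
      by (simp add: F_def monom_rot_coord)
    then show ?thesis by (simp only: c mult_minus1)
  qed
  have pr: "sphere_proj (rot_coord i \<omega> x) = rot_coord i \<omega> (sphere_proj x)" if "x \<noteq> 0" for x :: "complex^'n"
  proof -
    have n: "norm (rot_coord i \<omega> x) = norm x"
      unfolding norm_vec_def rot_coord_def using w by (intro arg_cong2[where f=L2_set]) (auto simp: norm_mult)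
    then have "rot_coord i \<omega> x \<noteq> 0" using that by (metis norm_eq_zero)
    moreover have "rot_coord i \<omega> x /\<^sub>R norm x = rot_coord i \<omega> (x /\<^sub>R norm x)"
      by (simp add: rot_coord_def vec_eq_iff)
    ultimately show ?thesis using n that by (simp add: sphere_proj_def)
  qed
  have "(\<integral>x. F (sphere_proj x) \<partial>U) = (\<integral>x. F (sphere_proj x) \<partial>distr U borel (rot_coord i \<omega>))"
    by (simp add: U_def distr_ball_rotate[OF w])
  also have "\<dots> = (\<integral>x. F (sphere_proj (rot_coord i \<omega> x)) \<partial>U)"
    by (intro integral_distr) (auto simp: U_def)
  also have "\<dots> = (\<integral>x. - F (sphere_proj x) \<partial>U)"
  proof (rule integral_cong_AE)
    have "AE x in lborel. x \<noteq> (0::complex^'n)" by (rule AE_lborel_singleton)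
    then show "AE x in U. F (sphere_proj (rot_coord i \<omega> x)) = - F (sphere_proj x)"
      unfolding U_def by (intro AE_uniform_measureI) (auto elim!: eventually_mono simp: pr Fr)
  qed (auto simp: U_def)
  finally have "(\<integral>x. F (sphere_proj x) \<partial>U) = 0" by simp
  then show ?thesis by (simp add: integral_sphere_sigma U_def F_def)
qed

lemma norm_monom_proj:
  assumes "x \<noteq> 0" shows "cmod (monom \<alpha> (sphere_proj x)) = cmod (monom \<alpha> x) / norm x ^ mdeg \<alpha>"
proof -
  have "monom \<alpha> (sphere_proj x) = of_real (inverse (norm x)) ^ mdeg \<alpha> * monom \<alpha> x"
    using assms by (simp add: sphere_proj_def monom_scaleR)
  then show ?thesis by (simp add: norm_mult norm_power power_inverse divide_inverse norm_inverse)
qed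

lemma monom_norm_integral:
  "(\<integral>x. monom \<alpha> x * cnj (monom \<alpha> x) \<partial>(sphere_sigma :: (complex^'n::finite) measure)) = complex_of_real (cw \<alpha>)"
proof -
  define U where "U = uniform_measure lborel (cball (0::complex^'n) 1)"
  have "(\<integral>\<^sup>+x. ennreal ((cmod (monom \<alpha> (sphere_proj x)))\<^sup>2) \<partial>U)
     = (\<integral>\<^sup>+x. ennreal ((cmod (monom \<alpha> (sphere_proj x)))\<^sup>2) * indicator (cball 0 1) x \<partial>lborel) / emeasure lborel (cball (0::complex^'n) 1)"
    unfolding U_def by (subst nn_integral_uniform_measure) auto
  also have "(\<integral>\<^sup>+x. ennreal ((cmod (monom \<alpha> (sphere_proj x)))\<^sup>2) * indicator (cball 0 1) x \<partial>lborel)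
     = (\<integral>\<^sup>+z. ennreal ((cmod (monom \<alpha> z))\<^sup>2 / norm z ^ (2 * mdeg \<alpha>)) * indicator (cball (0::complex^'n) 1) z \<partial>lborel)"
  proof (rule nn_integral_cong_AE)
    have "AE x in lborel. x \<noteq> (0::complex^'n)" by (rule AE_lborel_singleton)
    then show "AE x in lborel. ennreal ((cmod (monom \<alpha> (sphere_proj x)))\<^sup>2) * indicator (cball 0 1) x
       = ennreal ((cmod (monom \<alpha> x))\<^sup>2 / norm x ^ (2 * mdeg \<alpha>)) * indicator (cball (0::complex^'n) 1) x"
      by eventually_elim (simp add: norm_monom_proj power_divide flip: power_mult mult.commute[of 2])
  qed
  also have "\<dots> = ennreal (cw \<alpha>) * emeasure lborel (cball (0::complex^'n) 1)" by (rule ball_moment)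
  also have "\<dots> / emeasure lborel (cball (0::complex^'n) 1) = ennreal (cw \<alpha>)"
    using emeasure_lborel_cball_finite[of "0::complex^'n" 1] emeasure_cball_pos[where 'a="complex^'n"]
    by (metis ennreal_mult_divide_eq infinity_ennreal_def less_irrefl)
  finally have "has_bochner_integral U (\<lambda>x. (cmod (monom \<alpha> (sphere_proj x)))\<^sup>2) (cw \<alpha>)"
    using cw_pos[of \<alpha>] by (intro has_bochner_integral_nn_integral) (auto simp: U_def)
  then have "(\<integral>x. (cmod (monom \<alpha> (sphere_proj x)))\<^sup>2 \<partial>U) = cw \<alpha>" by (rule has_bochner_integral_integral_eq)
  moreover have "monom \<alpha> x * cnj (monom \<alpha> x) = complex_of_real ((cmod (monom \<alpha> x))\<^sup>2)" for x
    by (rule complex_norm_square[symmetric])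
  ultimately show ?thesis by (simp add: integral_sphere_sigma U_def flip: of_real_power)
qed

lemma monom_integrable:
  "integrable (sphere_sigma :: (complex^'n::finite) measure) (\<lambda>x. monom \<alpha> x * cnj (monom \<beta> x))"
proof -
  interpret prob_space "uniform_measure lborel (cball (0::complex^'n) 1)" by (rule prob_space_ball)
  have "integrable (uniform_measure lborel (cball (0::complex^'n) 1)) (\<lambda>x. monom \<alpha> (sphere_proj x) * cnj (monom \<beta> (sphere_proj x)))"
  proof (rule integrable_const_bound[where B=1])
    have "cmod (monom \<gamma> (sphere_proj x)) \<le> 1" for \<gamma> and x :: "complex^'n"
      using norm_monom_le[of \<gamma> "sphere_proj x"] by simp
    then show "AE x in uniform_measure lborel (cball 0 1). cmod (monom \<alpha> (sphere_proj x) * cnj (monom \<beta> (sphere_proj x))) \<le> 1"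
      by (auto simp: norm_mult intro!: mult_le_one)
  qed measurable
  then show ?thesis unfolding sphere_sigma_eq
    by (subst integrable_distr_eq[OF sphere_proj_measurable_ball])
      (auto intro: measurable_restrict_space1)
qed

section \<open>Norms and inner products in terms of coefficients\<close>

lemma finite_mdeg: "finite {\<alpha> :: 'n::finite mindex. mdeg \<alpha> = k}"
proof (rule finite_subset)
  show "{\<alpha> :: 'n mindex. mdeg \<alpha> = k} \<subseteq> PiE UNIV (\<lambda>_. {..k})"
    by (auto simp: mdeg_def PiE_iff intro: member_le_sum)
qed (auto intro: finite_PiE)

lemma hom_inner_eq:
  "hom_inner f g k = (\<Sum>\<alpha>\<in>{\<alpha>. mdeg \<alpha> = k}. cw \<alpha> * (f \<alpha> * cnj (g \<alpha>)))" for f :: "'n::finite fps_m"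
proof -
  let ?A = "{\<alpha> :: 'n mindex. mdeg \<alpha> = k}"
  have "hom_inner f g k = (\<integral>x. (\<Sum>\<alpha>\<in>?A. \<Sum>\<beta>\<in>?A. (f \<alpha> * cnj (g \<beta>)) * (monom \<alpha> x * cnj (monom \<beta> x))) \<partial>sphere_sigma)"
    unfolding hom_inner_def hom_part_def by (intro Bochner_Integration.integral_cong) (auto simp: sum_product mult_ac)
  also have "\<dots> = (\<Sum>\<alpha>\<in>?A. \<Sum>\<beta>\<in>?A. (f \<alpha> * cnj (g \<beta>)) * (\<integral>x. monom \<alpha> x * cnj (monom \<beta> x) \<partial>(sphere_sigma :: (complex^'n) measure)))"
    by (simp add: Bochner_Integration.integral_sum monom_integrable)
  also have "\<dots> = (\<Sum>\<alpha>\<in>?A. \<Sum>\<beta>\<in>?A. if \<beta> = \<alpha> then (f \<alpha> * cnj (g \<alpha>)) * cw \<alpha> else 0)"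
    by (intro sum.cong refl) (auto simp: monom_norm_integral monom_orthogonal)
  finally show ?thesis using finite_mdeg[of k, where 'n='n] by (simp add: mult_ac)
qed

lemma hom_norm2_eq:
  "hom_norm2 f k = (\<Sum>\<alpha>\<in>{\<alpha>. mdeg \<alpha> = k}. cw \<alpha> * (cmod (f \<alpha>))\<^sup>2)" for f :: "'n::finite fps_m"
proof -
  have "complex_of_real (hom_norm2 f k) = hom_inner f f k"
    unfolding hom_norm2_def hom_inner_def integral_complex_of_real[symmetric]
    unfolding complex_norm_square ..
  also have "\<dots> = complex_of_real (\<Sum>\<alpha>\<in>{\<alpha>. mdeg \<alpha> = k}. cw \<alpha> * (cmod (f \<alpha>))\<^sup>2)"
    by (simp add: hom_inner_eq flip: complex_norm_square)
  finally show ?thesis by (simp only: of_real_eq_iff)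
qed

section \<open>Degreewise norms\<close>

lemma cw_simps [simp]: "0 < cw \<alpha>" "0 \<le> cw \<alpha>" "cw \<alpha> \<noteq> 0" "\<bar>cw \<alpha>\<bar> = cw \<alpha>"
  using cw_pos[of \<alpha>] by auto

definition inc :: "'n \<Rightarrow> 'n mindex \<Rightarrow> 'n mindex" where
  "inc i \<alpha> = \<alpha>(i := Suc (\<alpha> i))"

lemma inc_apply: "inc i \<alpha> j = (if j = i then Suc (\<alpha> i) else \<alpha> j)"
  by (simp add: inc_def)

lemma inc_commute: "inc i (inc j \<alpha>) = inc j (inc i \<alpha>)"
  by (auto simp: inc_def)

lemma inj_inc: "inj (inc i)"
  by (rule injI, rule ext) (metis inc_apply nat.inject)

lemma mdeg_inc [simp]: "mdeg (inc i \<alpha>) = Suc (mdeg \<alpha>)"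
proof -
  have "mdeg (inc i \<alpha>) = (\<Sum>j\<in>UNIV. \<alpha> j + (if j = i then 1 else 0))"
    unfolding mdeg_def by (intro sum.cong) (auto simp: inc_apply)
  then show ?thesis by (simp add: sum.distrib mdeg_def)
qed

lemma Mz_inc [simp]: "Mz i f (inc i \<alpha>) = f \<alpha>"
  by (simp add: Mz_def inc_def)

lemma Mz_0 [simp]: "\<alpha> i = 0 \<Longrightarrow> Mz i f \<alpha> = 0"
  by (simp add: Mz_def)

lemma inc_cases:
  obtains "\<alpha> i = 0" | \<beta> where "\<alpha> = inc i \<beta>"
proof (cases "\<alpha> i = 0")
  case False
  then have "\<alpha> = inc i (\<alpha>(i := \<alpha> i - 1))" by (auto simp: inc_def)
  then show ?thesis using that(2) by blast
qed (use that(1) in auto)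

lemma mdeg_0_iff: "mdeg \<alpha> = 0 \<longleftrightarrow> \<alpha> = (\<lambda>_. 0)"
  by (auto simp: mdeg_def)

text \<open>Multi-indices of degree \<open>Suc k\<close> with positive entry \<open>i\<close> are
  the shifts of those of degree \<open>k\<close>. The conditional matches the zero case of
  \<open>Mz\<close>.\<close>

lemma sum_inc:
  fixes F :: "'n::finite mindex \<Rightarrow> 'a::comm_monoid_add"
  shows "(\<Sum>\<alpha>\<in>{\<alpha>. mdeg \<alpha> = Suc k}. if \<alpha> i = 0 then 0 else F \<alpha>) = (\<Sum>\<beta>\<in>{\<beta>. mdeg \<beta> = k}. F (inc i \<beta>))"
proof -
  have eq: "{\<alpha> :: 'n mindex. mdeg \<alpha> = Suc k \<and> \<alpha> i \<noteq> 0} = inc i ` {\<beta>. mdeg \<beta> = k}"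
  proof safe
    fix \<alpha> :: "'n mindex" assume "mdeg \<alpha> = Suc k" "\<alpha> i > 0"
    then show "\<alpha> \<in> inc i ` {\<beta>. mdeg \<beta> = k}"
      by (cases \<alpha> i rule: inc_cases) auto
  qed (auto simp: inc_apply)
  have "(\<Sum>\<alpha>\<in>{\<alpha>. mdeg \<alpha> = Suc k}. if \<alpha> i = 0 then 0 else F \<alpha>) = (\<Sum>\<alpha>\<in>{\<alpha>. mdeg \<alpha> = Suc k \<and> \<alpha> i \<noteq> 0}. F \<alpha>)"
    using finite_mdeg by (intro sum.mono_neutral_cong_right) auto
  then show ?thesis unfolding eq
    using inj_inc[of i] by (subst (asm) sum.reindex) (auto simp: inj_on_def)
qed

lemma monom_inc: "monom (inc i \<alpha>) z = z $ i * monom \<alpha> z"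
proof -
  have "monom (inc i \<alpha>) z = (\<Prod>j\<in>UNIV. (if j = i then z $ j else 1) * (z $ j) ^ \<alpha> j)"
    unfolding monom_def by (intro prod.cong) (auto simp: inc_apply)
  then show ?thesis by (simp add: prod.distrib monom_def)
qed

lemma prod_fact_inc:
  "(\<Prod>j\<in>UNIV. fact (inc i \<alpha> j) :: real) = (real (\<alpha> i) + 1) * (\<Prod>j\<in>(UNIV :: 'n::finite set). fact (\<alpha> j))"
proof -
  have "(\<Prod>j\<in>UNIV. fact (inc i \<alpha> j) :: real) = (\<Prod>j\<in>UNIV. (if j = i then real (\<alpha> j) + 1 else 1) * fact (\<alpha> j))"
    by (intro prod.cong) (auto simp: inc_apply)
  then show ?thesis by (simp add: prod.distrib)
qed

text \<open>Kept free of division; it is the source of both \<open>sum_cw_inc\<close> and the norm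
  of the gradient.\<close>

lemma cw_inc: "cw (inc i \<alpha>) * (CARD('n) + mdeg \<alpha>) = cw \<alpha> * (\<alpha> i + 1)" for \<alpha> :: "'n::finite mindex"
proof -
  obtain q where q: "CARD('n) = Suc q" using zero_less_card_finite[where 'a='n] gr0_implies_Suc by blast
  have "(fact (CARD('n) - 1 + Suc (mdeg \<alpha>)) :: real) = (CARD('n) + mdeg \<alpha>) * fact (CARD('n) - 1 + mdeg \<alpha>)"
    by (simp add: q algebra_simps)
  then have *: "cw (inc i \<alpha>) = (real (\<alpha> i) + 1) * (\<Prod>j\<in>UNIV. fact (\<alpha> j)) * fact (CARD('n) - 1)
      / (real (CARD('n) + mdeg \<alpha>) * fact (CARD('n) - 1 + mdeg \<alpha>))"
    by (simp only: cw_def mdeg_inc prod_fact_inc of_nat_mult of_nat_fact)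
  have "real (CARD('n) + mdeg \<alpha>) \<noteq> 0" by (simp add: q)
  then show ?thesis unfolding * by (simp add: cw_def)
qed

text \<open>Coefficient form of the fact that the \<open>cmod (z $ i)\<close> have square sum 1 on
  the sphere.\<close>

lemma sum_cw_inc: "(\<Sum>i\<in>UNIV. cw (inc i \<alpha>)) = cw \<alpha>" for \<alpha> :: "'n::finite mindex"
proof -
  have "(\<Sum>i\<in>UNIV. cw (inc i \<alpha>)) * (CARD('n) + mdeg \<alpha>) = (\<Sum>i\<in>UNIV. cw \<alpha> * (\<alpha> i + 1))"
    unfolding sum_distrib_right by (simp only: cw_inc)
  also have "\<dots> = cw \<alpha> * (CARD('n) + mdeg \<alpha>)"
    unfolding sum_distrib_left[symmetric] by (simp add: sum.distrib mdeg_def)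
  finally show ?thesis using zero_less_card_finite[where 'a='n] by simp
qed

text \<open>Induction on the degree by Euler's relation: multiplication by \<open>Suc k\<close>, the
  sum of the entries of \<open>\<alpha>\<close>, lets one exponent be lowered at a time.\<close>

lemma multinomial:
  fixes x :: "'n::finite \<Rightarrow> real"
  shows "(\<Sum>\<alpha>\<in>{\<alpha>. mdeg \<alpha> = k}. (\<Prod>i\<in>UNIV. x i ^ \<alpha> i) / (\<Prod>i\<in>UNIV. fact (\<alpha> i))) = (\<Sum>i\<in>UNIV. x i) ^ k / fact k"
proof (induction k)
  case 0
  then show ?case by (simp add: mdeg_0_iff)
next
  case (Suc k)
  define T where "T \<alpha> = (\<Prod>i\<in>UNIV. x i ^ \<alpha> i) / (\<Prod>i\<in>UNIV. fact (\<alpha> i))" for \<alpha> :: "'n mindex"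
  have T_inc: "(\<alpha> i + 1) * T (inc i \<alpha>) = x i * T \<alpha>" for i \<alpha>
  proof -
    have "(\<Prod>j\<in>UNIV. x j ^ inc i \<alpha> j) = (\<Prod>j\<in>UNIV. (if j = i then x j else 1) * x j ^ \<alpha> j)"
      by (intro prod.cong) (auto simp: inc_apply)
    then show ?thesis by (simp add: T_def prod_fact_inc prod.distrib)
  qed
  have "Suc k * (\<Sum>\<alpha>\<in>{\<alpha>. mdeg \<alpha> = Suc k}. T \<alpha>) = (\<Sum>\<alpha>\<in>{\<alpha>. mdeg \<alpha> = Suc k}. \<Sum>i\<in>UNIV. if \<alpha> i = 0 then 0 else \<alpha> i * T \<alpha>)"
    unfolding sum_distrib_left
  proof (intro sum.cong refl)
    fix \<alpha> :: "'n mindex" assume "\<alpha> \<in> {\<alpha>. mdeg \<alpha> = Suc k}"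
    then have "real (Suc k) = (\<Sum>i\<in>UNIV. real (\<alpha> i))" unfolding of_nat_sum[symmetric] by (simp add: mdeg_def)
    then have "Suc k * T \<alpha> = (\<Sum>i\<in>UNIV. \<alpha> i * T \<alpha>)" by (simp add: sum_distrib_right)
    then show "Suc k * T \<alpha> = (\<Sum>i\<in>UNIV. if \<alpha> i = 0 then 0 else \<alpha> i * T \<alpha>)"
      by (simp only:) (intro sum.cong, auto)
  qed
  also have "\<dots> = (\<Sum>i\<in>UNIV. \<Sum>\<beta>\<in>{\<beta>. mdeg \<beta> = k}. real (inc i \<beta> i) * T (inc i \<beta>))"
    by (subst sum.swap) (simp only: sum_inc)
  also have "\<dots> = (\<Sum>i\<in>UNIV. x i) * (\<Sum>\<beta>\<in>{\<beta>. mdeg \<beta> = k}. T \<beta>)"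
    using T_inc by (simp add: inc_apply sum_distrib_left sum_distrib_right add.commute)
      (simp add: sum_distrib_left[symmetric] sum_distrib_right[symmetric])
  also have "\<dots> = (\<Sum>i\<in>UNIV. x i) ^ Suc k / fact k" using Suc by (simp add: T_def)
  finally show ?case unfolding T_def[symmetric] by (simp add: field_simps del: of_nat_Suc)
qed

text \<open>The squared norm of \<open>\<langle>z, u\<rangle> ^ k\<close> on the sphere of \<open>\<complex>\<^sup>m\<close>, where \<open>u\<close> is a unit vector.\<close>
definition pw :: "nat \<Rightarrow> nat \<Rightarrow> real" where
  "pw m k = fact k * fact (m - 1) / fact (m - 1 + k)"

lemma pw_pos: "pw m k > 0" by (simp add: pw_def)

lemma pw_0 [simp]: "pw m 0 = 1" by (simp add: pw_def)

lemma pw_Suc: "m > 0 \<Longrightarrow> pw m (Suc k) * (m + k) = pw m k * (k + 1)"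
proof -
  assume m: "m > 0"
  then obtain q where "m = Suc q" using gr0_implies_Suc by blast
  then have "(fact (m - 1 + Suc k) :: real) = (m + k) * fact (m - 1 + k)" by (simp add: algebra_simps)
  then have *: "pw m (Suc k) = (k + 1) * fact k * fact (m - 1) / (real (m + k) * fact (m - 1 + k))"
    by (simp add: pw_def algebra_simps)
  have "real (m + k) \<noteq> 0" using m by simp
  then show ?thesis unfolding * by (simp add: pw_def) (simp add: algebra_simps)
qed

lemma norm_vec_sq: "(norm z)\<^sup>2 = (\<Sum>i\<in>UNIV. (cmod (z $ i))\<^sup>2)" for z :: "complex^'n"
  by (simp add: norm_vec_def L2_set_def sum_nonneg)

text \<open>The squared norm of evaluation at \<open>z\<close> on homogeneous polynomials of degree
  \<open>k\<close>, that is, the reproducing kernel on the diagonal.\<close>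

lemma sum_monom_cw:
  "(\<Sum>\<alpha>\<in>{\<alpha>. mdeg \<alpha> = k}. (cmod (monom \<alpha> z))\<^sup>2 / cw \<alpha>) = norm z ^ (2 * k) / pw CARD('n) k" for z :: "complex^'n"
proof -
  have "(\<Sum>\<alpha>\<in>{\<alpha>. mdeg \<alpha> = k}. (cmod (monom \<alpha> z))\<^sup>2 / cw \<alpha>)
     = (\<Sum>\<alpha>\<in>{\<alpha>. mdeg \<alpha> = k}. (fact (CARD('n) - 1 + k) / fact (CARD('n) - 1)) *
        ((\<Prod>i\<in>UNIV. ((cmod (z $ i))\<^sup>2) ^ \<alpha> i) / (\<Prod>i\<in>UNIV. fact (\<alpha> i))))"
    by (intro sum.cong refl)
      (auto simp: norm_monom cw_def prod_power_distrib mult.commute simp flip: power_mult)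
  also have "\<dots> = norm z ^ (2 * k) / pw CARD('n) k"
    unfolding sum_distrib_left[symmetric] multinomial
    by (simp add: norm_vec_sq[symmetric] pw_def mult_ac flip: power_mult)
  finally show ?thesis .
qed

section \<open>The norm of a homogeneous part under multiplication and differentiation\<close>

definition hnorm :: "'n::finite fps_m \<Rightarrow> nat \<Rightarrow> real" where
  "hnorm f k = sqrt (hom_norm2 f k)"

lemma hom_norm2_nonneg: "hom_norm2 f k \<ge> 0"
  unfolding hom_norm2_eq by (auto intro!: sum_nonneg)

lemma hnorm_sq: "(hnorm f k)\<^sup>2 = hom_norm2 f k"
  by (simp add: hnorm_def hom_norm2_nonneg)

lemma hnorm_L2: "hnorm f k = L2_set (\<lambda>\<alpha>. sqrt (cw \<alpha>) * cmod (f \<alpha>)) {\<alpha>. mdeg \<alpha> = k}"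
  by (simp add: hnorm_def hom_norm2_eq L2_set_def power_mult_distrib)

lemma hnorm_nonneg [simp]: "hnorm f k \<ge> 0" by (simp add: hnorm_def hom_norm2_nonneg)

lemma hnorm_cong: "(\<And>\<alpha>. mdeg \<alpha> = k \<Longrightarrow> f \<alpha> = g \<alpha>) \<Longrightarrow> hnorm f k = hnorm g k"
  by (simp add: hnorm_L2 L2_set_def)

lemma hnorm_cmult: "hnorm (\<lambda>\<alpha>. c * f \<alpha>) k = cmod c * hnorm f k"
  unfolding hnorm_L2 by (subst L2_set_right_distrib) (auto simp: norm_mult mult_ac intro!: L2_set_cong)

lemma hnorm_0 [simp]: "hnorm (\<lambda>_. 0) k = 0" by (simp add: hnorm_L2 L2_set_def)

lemma hnorm_add: "hnorm (\<lambda>\<alpha>. f \<alpha> + g \<alpha>) k \<le> hnorm f k + hnorm g k"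
proof -
  have "hnorm (\<lambda>\<alpha>. f \<alpha> + g \<alpha>) k \<le> L2_set (\<lambda>\<alpha>. sqrt (cw \<alpha>) * cmod (f \<alpha>) + sqrt (cw \<alpha>) * cmod (g \<alpha>)) {\<alpha>. mdeg \<alpha> = k}"
    unfolding hnorm_L2
    by (intro L2_set_mono) (auto simp: distrib_left[symmetric] intro!: mult_left_mono norm_triangle_ineq)
  also have "\<dots> \<le> hnorm f k + hnorm g k" unfolding hnorm_L2 by (rule L2_set_triangle_ineq)
  finally show ?thesis .
qed

lemma hnorm_uminus: "hnorm (\<lambda>\<alpha>. - f \<alpha>) k = hnorm f k" using hnorm_cmult[of "-1" f k] by simp

lemma hnorm_diff: "hnorm (\<lambda>\<alpha>. f \<alpha> - g \<alpha>) k \<le> hnorm f k + hnorm g k"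
  using hnorm_add[of f "\<lambda>\<alpha>. - g \<alpha>" k] by (simp add: hnorm_uminus)

lemma hnorm_sum: "hnorm (\<lambda>\<alpha>. \<Sum>i\<in>A. f i \<alpha>) k \<le> (\<Sum>i\<in>A. hnorm (f i) k)"
proof (induction A rule: infinite_finite_induct)
  case (insert i A)
  then show ?case using hnorm_add[of "f i" "\<lambda>\<alpha>. \<Sum>i\<in>A. f i \<alpha>" k] by simp
qed auto

lemma hnorm_coeff: "sqrt (cw \<alpha>) * cmod (f \<alpha>) \<le> hnorm f (mdeg \<alpha>)"
  unfolding hnorm_L2 by (rule member_le_L2_set) (auto intro: finite_mdeg)

lemma hnorm_eq_0: "hnorm f k = 0 \<longleftrightarrow> (\<forall>\<alpha>. mdeg \<alpha> = k \<longrightarrow> f \<alpha> = 0)"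
  using cw_pos by (auto simp: hnorm_L2 L2_set_eq_0_iff finite_mdeg less_le)

lemma sum_hom_norm2_Mz: "(\<Sum>i\<in>UNIV. hom_norm2 (Mz i f) (Suc k)) = hom_norm2 f k"
proof -
  have "hom_norm2 (Mz i f) (Suc k) = (\<Sum>\<beta>\<in>{\<beta>. mdeg \<beta> = k}. cw (inc i \<beta>) * (cmod (f \<beta>))\<^sup>2)" for i
  proof -
    have "hom_norm2 (Mz i f) (Suc k) = (\<Sum>\<alpha>\<in>{\<alpha>. mdeg \<alpha> = Suc k}. if \<alpha> i = 0 then 0 else cw \<alpha> * (cmod (Mz i f \<alpha>))\<^sup>2)"
      unfolding hom_norm2_eq by (intro sum.cong) auto
    then show ?thesis by (simp only: sum_inc Mz_inc)
  qed
  then have "(\<Sum>i\<in>UNIV. hom_norm2 (Mz i f) (Suc k)) = (\<Sum>\<beta>\<in>{\<beta>. mdeg \<beta> = k}. (\<Sum>i\<in>UNIV. cw (inc i \<beta>)) * (cmod (f \<beta>))\<^sup>2)"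
    by (simp add: sum_distrib_right) (rule sum.swap)
  then show ?thesis by (simp add: sum_cw_inc hom_norm2_eq)
qed

lemma hnorm_Mz_0 [simp]: "hnorm (Mz i f) 0 = 0"
  by (simp add: hnorm_eq_0 mdeg_0_iff)

lemma L2_hnorm_Mz: "L2_set (\<lambda>i. hnorm (Mz i f) (Suc k)) UNIV = hnorm f k"
  by (simp add: L2_set_def hnorm_sq sum_hom_norm2_Mz) (simp add: hnorm_def)

lemma hnorm_Mz_le: "hnorm (Mz i f) (Suc k) \<le> hnorm f k"
  using member_le_L2_set[of UNIV i "\<lambda>i. hnorm (Mz i f) (Suc k)"] by (simp add: L2_hnorm_Mz)

lemma L2_cmod_vec: "L2_set (\<lambda>i. cmod (lam $ i)) UNIV = norm lam"
  by (simp add: norm_vec_def)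

lemma hnorm_lincomb:
  "hnorm (\<lambda>\<alpha>. \<Sum>i\<in>UNIV. c i * F i \<alpha>) k \<le> L2_set (\<lambda>i. cmod (c i)) UNIV * L2_set (\<lambda>i. hnorm (F i) k) UNIV"
proof -
  have "hnorm (\<lambda>\<alpha>. \<Sum>i\<in>UNIV. c i * F i \<alpha>) k \<le> (\<Sum>i\<in>UNIV. cmod (c i) * hnorm (F i) k)"
    using hnorm_sum[of "\<lambda>i \<alpha>. c i * F i \<alpha>" UNIV k] by (simp add: hnorm_cmult)
  also have "\<dots> \<le> L2_set (\<lambda>i. cmod (c i)) UNIV * L2_set (\<lambda>i. hnorm (F i) k) UNIV"
    using L2_set_mult_ineq[of "\<lambda>i. cmod (c i)" "\<lambda>i. hnorm (F i) k" UNIV] by simp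
  finally show ?thesis .
qed

text \<open>Formal partial derivative; \<open>inc i \<alpha>\<close> is \<open>\<alpha> + e\<^sub>i\<close>.\<close>
definition Dz :: "'n \<Rightarrow> 'n fps_m \<Rightarrow> 'n fps_m" where
  "Dz i f = (\<lambda>\<alpha>. of_nat (Suc (\<alpha> i)) * f (inc i \<alpha>))"

lemma sum_hom_norm2_Dz: "(\<Sum>i\<in>UNIV. hom_norm2 (Dz i f) k) = (CARD('n) + k) * (k + 1) * hom_norm2 f (Suc k)"
  for f :: "'n::finite fps_m"
proof -
  have "hom_norm2 (Dz i f) k = (\<Sum>\<beta>\<in>{\<beta>. mdeg \<beta> = k}. (CARD('n) + k) * (cw (inc i \<beta>) * (real (inc i \<beta> i) * (cmod (f (inc i \<beta>)))\<^sup>2)))" for i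
    unfolding hom_norm2_eq
  proof (intro sum.cong refl)
    fix \<beta> :: "'n mindex" assume "\<beta> \<in> {\<beta>. mdeg \<beta> = k}"
    then have "cw \<beta> * (\<beta> i + 1) = cw (inc i \<beta>) * (CARD('n) + k)" using cw_inc[of i \<beta>] by simp
    then show "cw \<beta> * (cmod (Dz i f \<beta>))\<^sup>2 = (CARD('n) + k) * (cw (inc i \<beta>) * (real (inc i \<beta> i) * (cmod (f (inc i \<beta>)))\<^sup>2))"
      by (simp add: Dz_def norm_mult power_mult_distrib inc_apply power2_eq_square mult_ac add_ac del: of_nat_Suc)
  qed
  then have "(\<Sum>i\<in>UNIV. hom_norm2 (Dz i f) k) = (\<Sum>i\<in>UNIV. \<Sum>\<alpha>\<in>{\<alpha>. mdeg \<alpha> = Suc k}. if \<alpha> i = 0 then 0 else (CARD('n) + k) * (cw \<alpha> * (real (\<alpha> i) * (cmod (f \<alpha>))\<^sup>2)))"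
    by (simp only: sum_inc)
  also have "\<dots> = (\<Sum>\<alpha>\<in>{\<alpha>. mdeg \<alpha> = Suc k}. \<Sum>i\<in>UNIV. (CARD('n) + k) * (cw \<alpha> * (real (\<alpha> i) * (cmod (f \<alpha>))\<^sup>2)))"
    by (subst sum.swap) (intro sum.cong refl, auto)
  also have "\<dots> = (\<Sum>\<alpha>\<in>{\<alpha>. mdeg \<alpha> = Suc k}. (CARD('n) + k) * (k + 1) * (cw \<alpha> * (cmod (f \<alpha>))\<^sup>2))"
  proof (intro sum.cong refl)
    fix \<alpha> :: "'n mindex" assume "\<alpha> \<in> {\<alpha>. mdeg \<alpha> = Suc k}"
    then have s: "(\<Sum>i\<in>UNIV. real (\<alpha> i)) = real (k + 1)" unfolding of_nat_sum[symmetric] by (simp add: mdeg_def)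
    show "(\<Sum>i\<in>UNIV. (CARD('n) + k) * (cw \<alpha> * (real (\<alpha> i) * (cmod (f \<alpha>))\<^sup>2))) = (CARD('n) + k) * (k + 1) * (cw \<alpha> * (cmod (f \<alpha>))\<^sup>2)"
      unfolding sum_distrib_left[symmetric] sum_distrib_right[symmetric] s by (simp add: algebra_simps)
  qed
  finally show ?thesis by (simp add: sum_distrib_left hom_norm2_eq)
qed

lemma L2_hnorm_Dz: "L2_set (\<lambda>i. hnorm (Dz i f) k) UNIV = sqrt ((CARD('n) + k) * (k + 1)) * hnorm f (Suc k)"
  for f :: "'n::finite fps_m"
  unfolding L2_set_def hnorm_sq sum_hom_norm2_Dz by (simp add: hnorm_def real_sqrt_mult)

text \<open>Cauchy-Schwarz against the kernel bounds even the sum of absolute values, which is what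
  absolute convergence asks for.\<close>

lemma hom_part_abs_le:
  "(\<Sum>\<alpha>\<in>{\<alpha>. mdeg \<alpha> = k}. cmod (f \<alpha> * monom \<alpha> z)) \<le> hnorm f k * (norm z ^ k / sqrt (pw CARD('n) k))" for z :: "complex^'n"
proof -
  have "(\<Sum>\<alpha>\<in>{\<alpha>. mdeg \<alpha> = k}. cmod (f \<alpha> * monom \<alpha> z))
     = (\<Sum>\<alpha>\<in>{\<alpha>. mdeg \<alpha> = k}. \<bar>sqrt (cw \<alpha>) * cmod (f \<alpha>)\<bar> * \<bar>cmod (monom \<alpha> z) / sqrt (cw \<alpha>)\<bar>)"
    by (intro sum.cong refl) (auto simp: norm_mult abs_mult)
  also have "\<dots> \<le> hnorm f k * L2_set (\<lambda>\<alpha>. cmod (monom \<alpha> z) / sqrt (cw \<alpha>)) {\<alpha>. mdeg \<alpha> = k}"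
    unfolding hnorm_L2 by (rule L2_set_mult_ineq)
  also have "L2_set (\<lambda>\<alpha>. cmod (monom \<alpha> z) / sqrt (cw \<alpha>)) {\<alpha>. mdeg \<alpha> = k} = norm z ^ k / sqrt (pw CARD('n) k)"
    by (simp add: L2_set_def power_divide sum_monom_cw real_sqrt_divide power_even_eq)
  finally show ?thesis .
qed

section \<open>Square-summable sequences and the space H2\<close>

definition sqsum :: "(nat \<Rightarrow> real) \<Rightarrow> bool" where "sqsum x \<longleftrightarrow> summable (\<lambda>k. (x k)\<^sup>2)"
definition l2norm :: "(nat \<Rightarrow> real) \<Rightarrow> real" where "l2norm x = sqrt (\<Sum>k. (x k)\<^sup>2)"

lemma l2norm_nonneg [simp]: "sqsum x \<Longrightarrow> 0 \<le> l2norm x"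
  by (simp add: l2norm_def sqsum_def suminf_nonneg)

lemma L2_set_le_l2norm: "sqsum x \<Longrightarrow> L2_set x {..<n} \<le> l2norm x"
  unfolding L2_set_def l2norm_def sqsum_def by (intro real_sqrt_le_mono sum_le_suminf) auto

text \<open>Bounds on finite sections let \<open>L2_set\<close> inequalities pass to sequences and
  yield summability together with the norm bound.\<close>

lemma sqsumI:
  assumes "\<And>n. L2_set x {..<n} \<le> B"
  shows "sqsum x" "l2norm x \<le> B"
proof -
  have B: "0 \<le> B" using assms[of 0] by simp
  have *: "(\<Sum>k<n. (x k)\<^sup>2) \<le> B\<^sup>2" for n
    using assms[of n] B unfolding L2_set_def by (metis real_sqrt_le_iff real_sqrt_abs abs_of_nonneg)
  show s: "sqsum x" unfolding sqsum_def
    by (rule summableI_nonneg_bounded[OF _ *]) auto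
  show "l2norm x \<le> B" unfolding l2norm_def
    using suminf_le_const[OF s[unfolded sqsum_def] *] B by (simp add: real_le_lsqrt)
qed

lemma sqsum_triangle:
  assumes "sqsum x" "sqsum y" "\<And>k. \<bar>z k\<bar> \<le> \<bar>x k\<bar> + \<bar>y k\<bar>"
  shows "sqsum z" "l2norm z \<le> l2norm x + l2norm y"
proof -
  have "L2_set z {..<n} \<le> l2norm x + l2norm y" for n
  proof -
    have "L2_set z {..<n} = L2_set (\<lambda>k. \<bar>z k\<bar>) {..<n}" by (simp add: L2_set_def)
    also have "\<dots> \<le> L2_set (\<lambda>k. \<bar>x k\<bar> + \<bar>y k\<bar>) {..<n}" using assms(3) by (intro L2_set_mono) auto
    also have "\<dots> \<le> L2_set (\<lambda>k. \<bar>x k\<bar>) {..<n} + L2_set (\<lambda>k. \<bar>y k\<bar>) {..<n}" by (rule L2_set_triangle_ineq)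
    also have "\<dots> \<le> l2norm x + l2norm y"
      using L2_set_le_l2norm[OF assms(1), of n] L2_set_le_l2norm[OF assms(2), of n] by (simp add: L2_set_def)
    finally show ?thesis .
  qed
  from sqsumI[of z, OF this] show "sqsum z" "l2norm z \<le> l2norm x + l2norm y" by auto
qed

lemma sqsum_le:
  assumes "sqsum x" "\<And>k. \<bar>z k\<bar> \<le> C * \<bar>x k\<bar>" "C \<ge> 0"
  shows "sqsum z" "l2norm z \<le> C * l2norm x"
proof -
  have "L2_set z {..<n} \<le> C * l2norm x" for n
  proof -
    have "L2_set z {..<n} = L2_set (\<lambda>k. \<bar>z k\<bar>) {..<n}" by (simp add: L2_set_def)
    also have "\<dots> \<le> L2_set (\<lambda>k. C * \<bar>x k\<bar>) {..<n}" using assms(2) by (intro L2_set_mono) auto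
    also have "\<dots> = C * L2_set x {..<n}"
      using assms(3) by (subst L2_set_right_distrib[symmetric]) (auto simp: L2_set_def)
    also have "\<dots> \<le> C * l2norm x"
      using L2_set_le_l2norm[OF assms(1), of n] assms(3) by (rule mult_left_mono)
    finally show ?thesis .
  qed
  from sqsumI[of z, OF this] show "sqsum z" "l2norm z \<le> C * l2norm x" by auto
qed

lemma sqsum_Suc:
  assumes "sqsum x" shows "sqsum (\<lambda>k. x (Suc k))" "l2norm (\<lambda>k. x (Suc k)) \<le> l2norm x"
proof -
  show s: "sqsum (\<lambda>k. x (Suc k))" using assms by (simp add: sqsum_def summable_Suc_iff[of "\<lambda>k. (x k)\<^sup>2"])
  show "l2norm (\<lambda>k. x (Suc k)) \<le> l2norm x"
    using suminf_split_head[of "\<lambda>k. (x k)\<^sup>2"] assms by (simp add: sqsum_def l2norm_def)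
qed

lemma sqsum_shift:
  assumes "sqsum (\<lambda>k. x (Suc k))" "x 0 = 0"
  shows "sqsum x" "l2norm x = l2norm (\<lambda>k. x (Suc k))"
proof -
  show s: "sqsum x" using assms(1) by (simp add: sqsum_def summable_Suc_iff[of "\<lambda>k. (x k)\<^sup>2"])
  show "l2norm x = l2norm (\<lambda>k. x (Suc k))"
    using suminf_split_head[of "\<lambda>k. (x k)\<^sup>2"] s assms(2) by (simp add: sqsum_def l2norm_def)
qed

lemma sqsum_term_le: "sqsum x \<Longrightarrow> \<bar>x k\<bar> \<le> l2norm x"
  using member_le_L2_set[of "{..<Suc k}" k "\<lambda>k. \<bar>x k\<bar>"] L2_set_le_l2norm[of x "Suc k"]
  by (simp add: L2_set_def)

lemma l2norm_eq_0: "sqsum x \<Longrightarrow> l2norm x \<le> 0 \<Longrightarrow> x k = 0"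
  using sqsum_term_le[of x k] by auto

section \<open>The Hilbert space \<open>H2 b\<close>\<close>

context
  fixes b :: "nat \<Rightarrow> real"
  assumes bpos: "\<And>k. b k > 0"
begin

lemma H2_iff: "f \<in> H2 b \<longleftrightarrow> sqsum (\<lambda>k. b k * hnorm f k)"
  by (simp add: H2_def sqsum_def power_mult_distrib hnorm_sq)

lemma H2_norm_eq: "H2_norm b f = l2norm (\<lambda>k. b k * hnorm f k)"
  by (simp add: H2_norm_def l2norm_def power_mult_distrib hnorm_sq)

lemma H2_norm_nonneg [simp]: "f \<in> H2 b \<Longrightarrow> 0 \<le> H2_norm b f"
  by (simp add: H2_norm_eq H2_iff)

lemma H2_0 [simp]: "(\<lambda>_. 0) \<in> H2 b" by (simp add: H2_iff sqsum_def)

lemma H2_triangle: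
  assumes "f \<in> H2 b" "g \<in> H2 b" "\<And>k. hnorm h k \<le> hnorm f k + hnorm g k"
  shows "h \<in> H2 b" "H2_norm b h \<le> H2_norm b f + H2_norm b g"
proof -
  have "\<bar>b k * hnorm h k\<bar> \<le> \<bar>b k * hnorm f k\<bar> + \<bar>b k * hnorm g k\<bar>" for k
    using bpos[of k] assms(3)[of k] by (simp add: distrib_left[symmetric] abs_mult)
  from sqsum_triangle[OF _ _ this] assms(1,2) show "h \<in> H2 b" "H2_norm b h \<le> H2_norm b f + H2_norm b g"
    by (auto simp: H2_iff H2_norm_eq)
qed

lemmas H2_add = H2_triangle[OF _ _ hnorm_add]
lemmas H2_diff = H2_triangle[OF _ _ hnorm_diff]

lemma H2_mono:
  assumes "f \<in> H2 b" "\<And>k. hnorm h k \<le> C * hnorm f k" "C \<ge> 0"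
  shows "h \<in> H2 b" "H2_norm b h \<le> C * H2_norm b f"
proof -
  have "\<bar>b k * hnorm h k\<bar> \<le> C * \<bar>b k * hnorm f k\<bar>" for k
    using mult_left_mono[OF assms(2)[of k], of "b k"] bpos[of k] by (simp add: abs_mult mult_ac)
  from sqsum_le[OF _ this] assms show "h \<in> H2 b" "H2_norm b h \<le> C * H2_norm b f"
    by (auto simp: H2_iff H2_norm_eq)
qed

lemma H2_cmult: "f \<in> H2 b \<Longrightarrow> (\<lambda>\<alpha>. c * f \<alpha>) \<in> H2 b"
  by (rule H2_mono[of f _ "cmod c"]) (auto simp: hnorm_cmult)

lemma H2_norm_cmult: "H2_norm b (\<lambda>\<alpha>. c * f \<alpha>) = cmod c * H2_norm b f" if "f \<in> H2 b"
proof -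
  have "summable (\<lambda>k. (b k * hnorm f k)\<^sup>2)" using that by (simp add: H2_iff sqsum_def)
  then show ?thesis
    by (simp add: H2_norm_eq l2norm_def hnorm_cmult power_mult_distrib mult.left_commute[of _ "(cmod c)\<^sup>2"]
        suminf_mult real_sqrt_mult)
qed

lemma H2_sum: "(\<And>i. i \<in> A \<Longrightarrow> f i \<in> H2 b) \<Longrightarrow> (\<lambda>\<alpha>. \<Sum>i\<in>A. f i \<alpha>) \<in> H2 b"
  by (induction A rule: infinite_finite_induct) (auto intro: H2_add)

lemma H2_norm_sum: "(\<And>i. i \<in> A \<Longrightarrow> f i \<in> H2 b) \<Longrightarrow> H2_norm b (\<lambda>\<alpha>. \<Sum>i\<in>A. f i \<alpha>) \<le> (\<Sum>i\<in>A. H2_norm b (f i))"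
proof (induction A rule: infinite_finite_induct)
  case (insert i A)
  have "H2_norm b (\<lambda>\<alpha>. \<Sum>i\<in>insert i A. f i \<alpha>) \<le> H2_norm b (f i) + H2_norm b (\<lambda>\<alpha>. \<Sum>i\<in>A. f i \<alpha>)"
    using insert by (simp, intro H2_add H2_sum) auto
  then show ?case using insert by fastforce
qed (auto simp: H2_norm_eq l2norm_def)

lemma H2_Mz:
  assumes "f \<in> H2 b" and C: "\<And>k. b (Suc k) \<le> C * b k"
  shows "Mz i f \<in> H2 b" "H2_norm b (Mz i f) \<le> C * H2_norm b f"
proof -
  have C0: "C \<ge> 0" using C[of 0] bpos[of 0] bpos[of 1] mult_neg_pos[of C "b 0"] by (cases "C < 0") auto
  have *: "\<bar>b (Suc k) * hnorm (Mz i f) (Suc k)\<bar> \<le> C * \<bar>b k * hnorm f k\<bar>" for k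
    using mult_mono[OF C[of k] hnorm_Mz_le[of i f k]] bpos[of k] bpos[of "Suc k"] C0
    by (simp add: abs_mult mult.assoc)
  have s: "sqsum (\<lambda>k. b (Suc k) * hnorm (Mz i f) (Suc k))" "l2norm (\<lambda>k. b (Suc k) * hnorm (Mz i f) (Suc k)) \<le> C * H2_norm b f"
    using sqsum_le[OF _ * C0] assms(1) by (auto simp: H2_iff H2_norm_eq)
  from sqsum_shift[of "\<lambda>k. b k * hnorm (Mz i f) k"] s
  show "Mz i f \<in> H2 b" "H2_norm b (Mz i f) \<le> C * H2_norm b f" by (auto simp: H2_iff H2_norm_eq)
qed

lemma H2_Mz_shift:
  assumes "f \<in> H2 b" and C: "\<And>k. b (Suc k) \<le> C * b k"
  shows "Mz_shift lam i f \<in> H2 b"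
  unfolding Mz_shift_def by (intro H2_diff(1) H2_Mz(1)[OF _ C] H2_cmult assms(1))

text \<open>Takes the place of completeness: geometric norm bounds give convergence of each
  coefficient, and the norm bound survives because it is first proved for finitely many degrees and
  summands.\<close>

lemma H2_suminf:
  assumes u: "\<And>n. u n \<in> H2 b" "\<And>n. H2_norm b (u n) \<le> C * \<theta> ^ n" and th: "0 \<le> \<theta>" "\<theta> < 1"
  shows "summable (\<lambda>n. u n \<alpha>)" "(\<lambda>\<alpha>. \<Sum>n. u n \<alpha>) \<in> H2 b"
proof -
  have C: "C \<ge> 0" using u(2)[of 0] H2_norm_nonneg[OF u(1), of 0] by simp
  have bd: "cmod (u n \<alpha>) \<le> C / (b (mdeg \<alpha>) * sqrt (cw \<alpha>)) * \<theta> ^ n" for n \<alpha>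
  proof -
    have "b (mdeg \<alpha>) * (sqrt (cw \<alpha>) * cmod (u n \<alpha>)) \<le> b (mdeg \<alpha>) * hnorm (u n) (mdeg \<alpha>)"
      using bpos[of "mdeg \<alpha>"] by (intro mult_left_mono hnorm_coeff) auto
    also have "\<dots> \<le> C * \<theta> ^ n"
      using sqsum_term_le[of "\<lambda>k. b k * hnorm (u n) k" "mdeg \<alpha>"] u[of n]  by (auto simp: H2_iff H2_norm_eq)
    finally show ?thesis using bpos[of "mdeg \<alpha>"] by (simp add: field_simps)
  qed
  have sm: "summable (\<lambda>n. u n \<alpha>)" for \<alpha>
    by (rule summable_comparison_test'[OF summable_mult[OF summable_geometric] bd]) (use th in auto)
  then show "summable (\<lambda>n. u n \<alpha>)" .
  have part: "L2_set (\<lambda>k. b k * hnorm (\<lambda>\<alpha>. \<Sum>n<M. u n \<alpha>) k) {..<K} \<le> C / (1 - \<theta>)" for M K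
  proof -
    have "(\<lambda>\<alpha>. \<Sum>n<M. u n \<alpha>) \<in> H2 b" using u by (intro H2_sum)
    then have "L2_set (\<lambda>k. b k * hnorm (\<lambda>\<alpha>. \<Sum>n<M. u n \<alpha>) k) {..<K} \<le> H2_norm b (\<lambda>\<alpha>. \<Sum>n<M. u n \<alpha>)"
      unfolding H2_norm_eq by (intro L2_set_le_l2norm) (simp add: H2_iff)
    also have "\<dots> \<le> (\<Sum>n<M. C * \<theta> ^ n)" using u by (intro order_trans[OF H2_norm_sum] sum_mono) auto
    also have "\<dots> \<le> (\<Sum>n. C * \<theta> ^ n)" using th C by (intro sum_le_suminf summable_mult summable_geometric) auto
    also have "\<dots> = C / (1 - \<theta>)" using th by (simp add: suminf_mult suminf_geometric summable_geometric)
    finally show ?thesis .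
  qed
  \<comment> \<open>For fixed \<open>K\<close> only finitely many coefficients occur, so the bound
    passes to the limit in \<open>M\<close>.\<close>
  have "L2_set (\<lambda>k. b k * hnorm (\<lambda>\<alpha>. \<Sum>n. u n \<alpha>) k) {..<K} \<le> C / (1 - \<theta>)" for K
  proof (rule tendsto_upperbound)
    have "(\<lambda>M. \<Sum>n<M. u n \<alpha>) \<longlonglongrightarrow> (\<Sum>n. u n \<alpha>)" for \<alpha> by (rule summable_LIMSEQ[OF sm])
    then show "(\<lambda>M. L2_set (\<lambda>k. b k * hnorm (\<lambda>\<alpha>. \<Sum>n<M. u n \<alpha>) k) {..<K}) \<longlonglongrightarrow> L2_set (\<lambda>k. b k * hnorm (\<lambda>\<alpha>. \<Sum>n. u n \<alpha>) k) {..<K}"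
      unfolding L2_set_def hnorm_def hom_norm2_eq by (intro tendsto_intros)
  qed (use part in auto)
  from sqsumI[OF this] show "(\<lambda>\<alpha>. \<Sum>n. u n \<alpha>) \<in> H2 b" by (simp add: H2_iff)
qed

end

lemma H2_equiv:
  assumes b: "\<And>k. b k > 0" and b': "\<And>k. b' k > 0" and c: "c > 0" "d > 0" "\<And>k. c * b k \<le> b' k" "\<And>k. b' k \<le> d * b k"
  shows "f \<in> H2 b \<longleftrightarrow> f \<in> H2 b'" "f \<in> H2 b \<Longrightarrow> c * H2_norm b f \<le> H2_norm b' f" "f \<in> H2 b \<Longrightarrow> H2_norm b' f \<le> d * H2_norm b f"
proof -
  have 1: "\<bar>b' k * hnorm f k\<bar> \<le> d * \<bar>b k * hnorm f k\<bar>" for k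
    using mult_right_mono[OF c(4)[of k], of "hnorm f k"] b[of k] b'[of k] by (simp add: abs_mult mult.assoc)
  have 2: "\<bar>b k * hnorm f k\<bar> \<le> (1 / c) * \<bar>b' k * hnorm f k\<bar>" for k
    using mult_right_mono[OF c(3)[of k], of "hnorm f k"] b[of k] b'[of k] c(1) by (simp add: abs_mult field_simps)
  show *: "f \<in> H2 b \<longleftrightarrow> f \<in> H2 b'"
    using sqsum_le(1)[OF _ 1] sqsum_le(1)[OF _ 2] c by (auto simp: H2_iff[OF b] H2_iff[OF b'])
  assume f: "f \<in> H2 b"
  then show "H2_norm b' f \<le> d * H2_norm b f" using sqsum_le(2)[OF _ 1] c by (simp add: H2_iff[OF b] H2_norm_eq[OF b] H2_norm_eq[OF b'])
  have "H2_norm b f \<le> (1 / c) * H2_norm b' f" using * f sqsum_le(2)[OF _ 2] c by (simp add: H2_iff[OF b'] H2_norm_eq[OF b] H2_norm_eq[OF b'])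
  then show "c * H2_norm b f \<le> H2_norm b' f" using c(1) by (simp add: field_simps)
qed

section \<open>The indices\<close>

text \<open>Almost decreasing and almost increasing sequences: \<open>R_index b < s\<close> makes
  \<open>b k / s ^ k\<close> almost decreasing, and \<open>s < i_index b\<close> makes it almost increasing.\<close>
definition adecr :: "(nat \<Rightarrow> real) \<Rightarrow> bool" where
  "adecr y \<longleftrightarrow> (\<exists>D>0. \<forall>k n. k \<le> n \<longrightarrow> y n \<le> D * y k)"
definition aincr :: "(nat \<Rightarrow> real) \<Rightarrow> bool" where
  "aincr y \<longleftrightarrow> (\<exists>D>0. \<forall>k n. k \<le> n \<longrightarrow> y k \<le> D * y n)"

text \<open>Finitely many positive terms change only the constant; \<open>E\<close> has to serve
  pairs beyond \<open>K\<close>, pairs before \<open>K\<close> and pairs straddling it.\<close>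

lemma adecr_tail:
  assumes y: "\<And>k. y k > 0" and D: "\<And>k n. K \<le> k \<Longrightarrow> k \<le> n \<Longrightarrow> y n \<le> D * y k"
  shows "adecr y"
proof -
  define M where "M = Max (y ` {..K})"
  define m where "m = Min (y ` {..K})"
  have M: "y k \<le> M" and m: "m \<le> y k" if "k \<le> K" for k using that by (auto simp: M_def m_def)
  have mp: "m > 0" using y by (simp add: m_def)
  have Mp: "M > 0" using M[of 0] y[of 0] by simp
  have D0: "D > 0" using D[of K K] y[of K] zero_less_mult_pos2[of D "y K"] by fastforce
  define E where "E = max D 1 * max (M / m) 1"
  have E: "E \<ge> D" "E \<ge> D * (M / m)" "E \<ge> M / m" "E > 0"
  proof -
    have "D * 1 \<le> E" unfolding E_def by (intro mult_mono) (use D0 in auto)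
    then show "E \<ge> D" by simp
    show "E \<ge> D * (M / m)" unfolding E_def by (intro mult_mono) (use D0 Mp mp in auto)
    have "1 * (M / m) \<le> E" unfolding E_def by (intro mult_mono) (use D0 Mp mp in auto)
    then show "E \<ge> M / m" by simp
    show "E > 0" using \<open>E \<ge> D\<close> D0 by simp
  qed
  have "y n \<le> E * y k" if "k \<le> n" for k n
  proof -
    consider "K \<le> k" | "k < K" "K \<le> n" | "n < K" by linarith
    then show ?thesis
    proof cases
      case 1 then show ?thesis using D[OF 1 that] E(1) y[of k] by (meson less_imp_le mult_right_mono order_trans)
    next
      case 2
      have "y n \<le> D * M" using D[OF order_refl 2(2)] M[of K] D0 by (meson less_imp_le mult_left_mono order_refl order_trans)
      also have "\<dots> \<le> D * (M / m) * y k" using m[of k] 2 D0 Mp mp by (simp add: field_simps)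
      also have "\<dots> \<le> E * y k" using y[of k] by (intro mult_right_mono E(2)) simp
      finally show ?thesis .
    next
      case 3
      have "y n \<le> M" using M 3 by simp
      also have "\<dots> \<le> M / m * y k" using m[of k] 3 that Mp mp by (simp add: field_simps)
      also have "\<dots> \<le> E * y k" using y[of k] by (intro mult_right_mono E(3)) simp
      finally show ?thesis .
    qed
  qed
  then show ?thesis unfolding adecr_def using E(4) by blast
qed

lemma aincr_iff_adecr_inverse:
  assumes "\<And>k. y k > 0" shows "aincr y \<longleftrightarrow> adecr (\<lambda>k. inverse (y k))"
proof -
  have "y k \<le> D * y n \<longleftrightarrow> inverse (y n) \<le> D * inverse (y k)" for D k n
    using assms[of k] assms[of n] by (simp add: field_simps)
  then show ?thesis by (simp add: aincr_def adecr_def)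
qed

lemma aincr_tail:
  assumes y: "\<And>k. y k > 0" and D: "\<And>k n. K \<le> k \<Longrightarrow> k \<le> n \<Longrightarrow> y k \<le> D * y n"
  shows "aincr y"
  unfolding aincr_iff_adecr_inverse[OF y]
proof (rule adecr_tail)
  show "inverse (y n) \<le> D * inverse (y k)" if "K \<le> k" "k \<le> n" for k n
    using D[OF that] y[of k] y[of n] by (simp add: field_simps)
qed (use y in auto)

lemma const_powr_inverse_tendsto: "D > 0 \<Longrightarrow> (\<lambda>j. c * D powr (1 / real j)) \<longlonglongrightarrow> c"
proof -
  assume D: "D > 0"
  have "(\<lambda>j. c * exp (ln D * (1 / real j))) \<longlonglongrightarrow> c * exp (ln D * 0)"
    by (intro tendsto_intros lim_1_over_n)
  then show ?thesis using D by (simp add: powr_def)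
qed

lemma powr_inverse_power: "x > 0 \<Longrightarrow> j \<ge> 1 \<Longrightarrow> (x powr (1 / real j)) ^ j = x"
  by (simp add: powr_realpow[symmetric] powr_powr)

lemma powr_inverse_le_iff: "x > 0 \<Longrightarrow> t > 0 \<Longrightarrow> j \<ge> 1 \<Longrightarrow> x powr (1 / real j) \<le> t \<longleftrightarrow> x \<le> t ^ j"
  using power_mono_iff[of "x powr (1 / real j)" t j] powr_inverse_power[of x j] by simp

lemma powr_inverse_ge_iff: "x > 0 \<Longrightarrow> t > 0 \<Longrightarrow> j \<ge> 1 \<Longrightarrow> t \<le> x powr (1 / real j) \<longleftrightarrow> t ^ j \<le> x"
  using power_mono_iff[of t "x powr (1 / real j)" j] powr_inverse_power[of x j] by simp

text \<open>Split \<open>n - k\<close> into blocks of length \<open>j\<close> and a remainder below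
  \<open>j\<close>, which costs at most \<open>E ^ j\<close>.\<close>

lemma block_decr:
  fixes y :: "nat \<Rightarrow> real"
  assumes y: "\<And>k. y k > 0" and step: "\<And>k. y (Suc k) \<le> C * y k" and j: "j \<ge> 1" and block: "\<And>k. y (k + j) \<le> y k"
  shows "adecr y"
proof -
  define E where "E = max C 1"
  have E: "E \<ge> 1" "\<And>k. y (Suc k) \<le> E * y k"
    using step y by (auto simp: E_def intro: order_trans[OF step] mult_right_mono less_imp_le)
  have r: "y (k + r) \<le> E ^ r * y k" for k r
  proof (induction r)
    case (Suc r)
    have "y (k + Suc r) \<le> E * y (k + r)" using E by simp
    also have "\<dots> \<le> E * (E ^ r * y k)" using Suc E(1) by (intro mult_left_mono) auto
    finally show ?case by simp
  qed simp
  have q: "y (k + q * j) \<le> y k" for k q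
  proof (induction q)
    case (Suc q)
    have "y (k + Suc q * j) = y ((k + q * j) + j)" by (simp add: ac_simps)
    also have "\<dots> \<le> y (k + q * j)" by (rule block)
    finally show ?case using Suc by simp
  qed simp
  have "y n \<le> E ^ j * y k" if "k \<le> n" for k n
  proof -
    define d where "d = n - k"
    have n: "n = (k + (d div j) * j) + d mod j" using that by (simp add: d_def)
    have "y n \<le> E ^ (d mod j) * y (k + (d div j) * j)" by (subst n) (rule r)
    also have "\<dots> \<le> E ^ j * y k"
      using q[of k "d div j"] E(1) j y by (intro mult_mono power_increasing) (auto simp: less_imp_le)
    finally show ?thesis .
  qed
  then show ?thesis unfolding adecr_def using E(1) by (intro exI[of _ "E ^ j"]) auto
qed

lemma block_incr:
  fixes y :: "nat \<Rightarrow> real"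
  assumes y: "\<And>k. y k > 0" and step: "\<And>k. y (Suc k) \<le> C * y k" and j: "j \<ge> 1" and block: "\<And>k. y k \<le> y (k + j)"
  shows "aincr y"
proof -
  define E where "E = max C 1"
  have E: "E \<ge> 1" "\<And>k. y (Suc k) \<le> E * y k"
    using step y by (auto simp: E_def intro: order_trans[OF step] mult_right_mono less_imp_le)
  have r: "y (k + r) \<le> E ^ r * y k" for k r
  proof (induction r)
    case (Suc r)
    have "y (k + Suc r) \<le> E * y (k + r)" using E by simp
    also have "\<dots> \<le> E * (E ^ r * y k)" using Suc E(1) by (intro mult_left_mono) auto
    finally show ?case by simp
  qed simp
  have q: "y k \<le> y (k + q * j)" for k q
  proof (induction q)
    case (Suc q)
    have "y (k + q * j) \<le> y ((k + q * j) + j)" by (rule block)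
    also have "\<dots> = y (k + Suc q * j)" by (simp add: ac_simps)
    finally show ?case using Suc by simp
  qed simp
  have "y k \<le> E ^ j * y n" if "k \<le> n" for k n
  proof -
    define d where "d = n - k"
    have lt: "d mod j < j" using j by simp
    \<comment> \<open>Single steps are bounded only from above, so the path overshoots
      \<open>n\<close> to the next multiple of \<open>j\<close>, and the excess is paid by powers of
      \<open>E\<close>.\<close>
    have n: "k + Suc (d div j) * j = n + (j - d mod j)"
    proof -
      define X Y where "X = d div j * j" "Y = d mod j"
      have "X + Y = d" by (simp add: X_Y_def)
      moreover have "n = k + d" using that by (simp add: d_def)
      moreover have "Y < j" using lt by (simp add: X_Y_def)
      ultimately have "k + (j + X) = n + (j - Y)" by arith
      then show ?thesis by (simp add: X_Y_def)
    qed
    have "y k \<le> y (k + Suc (d div j) * j)" by (rule q)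
    also have "\<dots> \<le> E ^ (j - d mod j) * y n" unfolding n by (rule r)
    also have "\<dots> \<le> E ^ j * y n"
      using E(1) y[of n] by (intro mult_right_mono power_increasing) (auto simp: less_imp_le)
    finally show ?thesis .
  qed
  then show ?thesis unfolding aincr_def using E(1) by (intro exI[of _ "E ^ j"]) auto
qed

section \<open>Limit formulas for the indices R and i\<close>

context
  fixes b :: "nat \<Rightarrow> real" and C :: real
  assumes bpos: "\<And>k. b k > 0" and C: "C > 0" "\<And>k. b (Suc k) \<le> C * b k"
begin

lemma ratio_pos: "b (k + j) / b k > 0" using bpos by simp

lemma ratio_le: "b (k + j) / b k \<le> C ^ j"
proof (induction j)
  case (Suc j)
  have "b (k + Suc j) / b k \<le> C * (b (k + j) / b k)"
    using C(2)[of "k + j"] bpos[of k] by (simp add: divide_right_mono)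
  also have "\<dots> \<le> C * C ^ j" using Suc C(1) by (intro mult_left_mono) auto
  finally show ?case by simp
qed (use bpos[of k] in simp)

lemma step_scaled: "s > 0 \<Longrightarrow> b (Suc k) / s ^ Suc k \<le> (C / s) * (b k / s ^ k)"
  using C(2)[of k] by (simp add: field_simps)

text \<open>A Fekete argument by way of almost monotonicity. A number above the infimum
  \<open>L\<close> of the roots yields a block inequality and hence \<open>adecr\<close>
  (\<open>A\<close>); conversely \<open>adecr\<close> bounds every root by
  \<open>s * D powr (1 / real j)\<close> (\<open>B\<close>), which tends to
  \<open>s\<close>.\<close>

lemma R_index_characterization:
  shows "(\<lambda>j. SUP k. (b (k + j) / b k) powr (1 / real j)) \<longlonglongrightarrow> R_index b" (is ?t1)
    and "R_index b \<ge> 0" (is ?t2)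
    and "s > R_index b \<Longrightarrow> adecr (\<lambda>k. b k / s ^ k)"
    and "s > 0 \<Longrightarrow> adecr (\<lambda>k. b k / s ^ k) \<Longrightarrow> R_index b \<le> s"
proof -
  define u where "u j = (SUP k. (b (k + j) / b k) powr (1 / real j))" for j
  have bdd: "bdd_above (range (\<lambda>k. (b (k + j) / b k) powr (1 / real j)))" if "j \<ge> 1" for j
    using that ratio_le[of _ j] ratio_pos C by (intro bdd_aboveI[of _ C]) (auto simp: powr_inverse_le_iff)
  have u_le: "u j \<le> t \<longleftrightarrow> (\<forall>k. b (k + j) / b k \<le> t ^ j)" if "j \<ge> 1" "t > 0" for j t
    unfolding u_def using that bdd[of j] ratio_pos by (subst cSUP_le_iff) (auto simp: powr_inverse_le_iff)
  have u0: "u j \<ge> 0" if "j \<ge> 1" for j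
    unfolding u_def by (rule order_trans[OF powr_ge_zero cSUP_upper[OF UNIV_I bdd[OF that], of 0]])
  \<comment> \<open>Index 0 is excluded: its exponent \<open>1 / real 0\<close> is 0, so
    \<open>u 0\<close> is 1 whatever the weight.\<close>
  define L where "L = (INF j\<in>{1..}. u j)"
  have bu: "bdd_below (u ` {1..})" using u0 by (intro bdd_belowI[of _ 0]) auto
  have L0: "L \<ge> 0" unfolding L_def using u0 by (intro cINF_greatest) auto
  have Lu: "L \<le> u j" if "j \<ge> 1" for j unfolding L_def using that by (intro cINF_lower[OF bu]) auto
  have A: "adecr (\<lambda>k. b k / s ^ k)" if s: "s > L" for s
  proof -
    have sp: "s > 0" using s L0 by simp
    from s obtain j where j: "j \<ge> 1" "u j < s" unfolding L_def by (subst (asm) cINF_less_iff[OF _ bu]) auto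
    then have *: "b (k + j) / b k \<le> s ^ j" for k using u_le[of j s] sp by auto
    have "b (k + j) \<le> s ^ j * b k" for k using *[of k] bpos[of k] by (simp add: pos_divide_le_eq)
    then show ?thesis using step_scaled[OF sp] j(1) bpos sp
      by (intro block_decr[of _ "C / s" j]) (auto simp: field_simps power_add)
  qed
  have B: "\<exists>D>0. \<forall>j\<ge>1. u j \<le> s * D powr (1 / real j)" if s: "s > 0" and a: "adecr (\<lambda>k. b k / s ^ k)" for s
  proof -
    from a obtain D where D: "D > 0" "\<And>k n. k \<le> n \<Longrightarrow> b n / s ^ n \<le> D * (b k / s ^ k)" by (auto simp: adecr_def)
    have "u j \<le> s * D powr (1 / real j)" if j: "j \<ge> 1" for j
    proof (subst u_le[OF j])
      have "(s * D powr (1 / real j)) ^ j = s ^ j * D"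
        using D(1) j by (simp add: power_mult_distrib powr_realpow[symmetric] powr_powr)
      moreover have "b (k + j) / b k \<le> s ^ j * D" for k
        using D(2)[of k "k + j"] s bpos[of k] by (simp add: field_simps power_add)
      ultimately show "\<forall>k. b (k + j) / b k \<le> (s * D powr (1 / real j)) ^ j" by simp
    qed (use s D in auto)
    then show ?thesis using D(1) by blast
  qed
  have lim: "u \<longlonglongrightarrow> L"
  proof (rule order_tendstoI)
    fix a assume "a < L" then show "\<forall>\<^sub>F j in sequentially. a < u j"
      using Lu by (intro eventually_sequentiallyI[of 1]) (auto intro: less_le_trans)
  next
    fix a assume a: "L < a"
    define s where "s = (L + a) / 2"
    have s: "L < s" "s < a" "s > 0" using a L0 by (auto simp: s_def field_simps)
    from B[OF s(3) A[OF s(1)]] obtain D where D: "D > 0" "\<And>j. j \<ge> 1 \<Longrightarrow> u j \<le> s * D powr (1 / real j)" by blast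
    have "\<forall>\<^sub>F j in sequentially. s * D powr (1 / real j) < a"
      using order_tendstoD(2)[OF const_powr_inverse_tendsto[OF D(1), of s] s(2)] .
    then show "\<forall>\<^sub>F j in sequentially. u j < a"
      using eventually_ge_at_top[of 1] by eventually_elim (use D(2) in force)
  qed
  then have RL: "R_index b = L" unfolding R_index_def u_def[abs_def] by (rule limI)
  show ?t1 using lim RL by (simp add: u_def[abs_def])
  show ?t2 using RL L0 by simp
  show "adecr (\<lambda>k. b k / s ^ k)" if "s > R_index b" using A that RL by simp
  show "R_index b \<le> s" if s: "s > 0" "adecr (\<lambda>k. b k / s ^ k)"
  proof -
    from B[OF s] obtain D where D: "D > 0" "\<And>j. j \<ge> 1 \<Longrightarrow> u j \<le> s * D powr (1 / real j)" by blast
    have "L \<le> s"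
      by (rule tendsto_lowerbound[OF const_powr_inverse_tendsto[OF D(1), of s]])
        (auto intro!: eventually_sequentiallyI[of 1] order_trans[OF Lu D(2)])
    then show ?thesis by (simp add: RL)
  qed
qed

text \<open>The dual argument, with the supremum of the roots; its finiteness comes from the
  one-step bound \<open>C\<close>.\<close>

lemma i_index_characterization:
  shows "(\<lambda>j. INF k. (b (k + j) / b k) powr (1 / real j)) \<longlonglongrightarrow> i_index b" (is ?t1)
    and "i_index b \<ge> 0" (is ?t2)
    and "s > 0 \<Longrightarrow> s < i_index b \<Longrightarrow> aincr (\<lambda>k. b k / s ^ k)"
    and "s > 0 \<Longrightarrow> aincr (\<lambda>k. b k / s ^ k) \<Longrightarrow> s \<le> i_index b"
proof -
  define u where "u j = (INF k. (b (k + j) / b k) powr (1 / real j))" for j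
  have bdd: "bdd_below (range (\<lambda>k. (b (k + j) / b k) powr (1 / real j)))" for j
    by (intro bdd_belowI[of _ 0]) auto
  have u_ge: "t \<le> u j \<longleftrightarrow> (\<forall>k. t ^ j \<le> b (k + j) / b k)" if "j \<ge> 1" "t > 0" for j t
    unfolding u_def using that bdd[of j] ratio_pos by (subst le_cINF_iff) (auto simp: powr_inverse_ge_iff)
  have u0: "u j \<ge> 0" for j unfolding u_def by (intro cINF_greatest) auto
  have uC: "u j \<le> C" if "j \<ge> 1" for j
  proof -
    have "u j \<le> (b (0 + j) / b 0) powr (1 / real j)" unfolding u_def by (rule cINF_lower[OF bdd]) auto
    also have "\<dots> \<le> C" using ratio_le[of 0 j] ratio_pos[of 0 j] C that by (subst powr_inverse_le_iff) auto
    finally show ?thesis .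
  qed
  define L where "L = (SUP j\<in>{1..}. u j)"
  have bu: "bdd_above (u ` {1..})" using uC by (intro bdd_aboveI[of _ C]) auto
  have Lu: "u j \<le> L" if "j \<ge> 1" for j unfolding L_def using that by (intro cSUP_upper[OF _ bu]) auto
  have L0: "L \<ge> 0" using Lu[of 1] u0[of 1] by simp
  have A: "aincr (\<lambda>k. b k / s ^ k)" if s: "s < L" "s > 0" for s
  proof -
    from s obtain j where j: "j \<ge> 1" "s < u j" unfolding L_def by (subst (asm) less_cSUP_iff[OF _ bu]) auto
    then have *: "s ^ j \<le> b (k + j) / b k" for k using u_ge[of j s] s by auto
    have "s ^ j * b k \<le> b (k + j)" for k using *[of k] bpos[of k] by (simp add: pos_le_divide_eq)
    then show ?thesis using step_scaled[OF s(2)] j(1) bpos s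
      by (intro block_incr[of _ "C / s" j]) (auto simp: field_simps power_add)
  qed
  have B: "\<exists>D>0. \<forall>j\<ge>1. s * D powr (1 / real j) \<le> u j" if s: "s > 0" and a: "aincr (\<lambda>k. b k / s ^ k)" for s
  proof -
    from a obtain D where D: "D > 0" "\<And>k n. k \<le> n \<Longrightarrow> b k / s ^ k \<le> D * (b n / s ^ n)" by (auto simp: aincr_def)
    have "s * (1 / D) powr (1 / real j) \<le> u j" if j: "j \<ge> 1" for j
    proof (subst u_ge[OF j])
      have "(s * (1 / D) powr (1 / real j)) ^ j = s ^ j * (1 / D)"
        using D(1) j by (simp add: power_mult_distrib powr_realpow[symmetric] powr_powr del: powr_one_eq_one)
      moreover have "s ^ j * (1 / D) \<le> b (k + j) / b k" for k
        using D(2)[of k "k + j"] s bpos[of k] D(1) by (simp add: field_simps power_add)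
      ultimately show "\<forall>k. (s * (1 / D) powr (1 / real j)) ^ j \<le> b (k + j) / b k" by simp
    qed (use s D in auto)
    then show ?thesis using D(1) by (intro exI[of _ "1 / D"]) auto
  qed
  have lim: "u \<longlonglongrightarrow> L"
  proof (rule order_tendstoI)
    fix a assume "L < a" then show "\<forall>\<^sub>F j in sequentially. u j < a"
      using Lu by (intro eventually_sequentiallyI[of 1]) (auto intro: le_less_trans)
  next
    fix a assume a: "a < L"
    show "\<forall>\<^sub>F j in sequentially. a < u j"
    proof (cases "a < 0")
      case True then show ?thesis using u0 by (auto intro!: always_eventually intro: less_le_trans)
    next
      case False
      define s where "s = (L + a) / 2"
      have s: "s < L" "a < s" "s > 0" using a False by (auto simp: s_def field_simps)
      from B[OF s(3) A[OF s(1,3)]] obtain D where D: "D > 0" "\<And>j. j \<ge> 1 \<Longrightarrow> s * D powr (1 / real j) \<le> u j" by blast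
      have "\<forall>\<^sub>F j in sequentially. a < s * D powr (1 / real j)"
        using order_tendstoD(1)[OF const_powr_inverse_tendsto[OF D(1), of s] s(2)] .
      then show "\<forall>\<^sub>F j in sequentially. a < u j"
        using eventually_ge_at_top[of 1] by eventually_elim (use D(2) in force)
    qed
  qed
  then have RL: "i_index b = L" unfolding i_index_def u_def[abs_def] by (rule limI)
  show ?t1 using lim RL by (simp add: u_def[abs_def])
  show ?t2 using RL L0 by simp
  show "aincr (\<lambda>k. b k / s ^ k)" if "s > 0" "s < i_index b" using A that RL by simp
  show "s \<le> i_index b" if s: "s > 0" "aincr (\<lambda>k. b k / s ^ k)"
  proof -
    from B[OF s] obtain D where D: "D > 0" "\<And>j. j \<ge> 1 \<Longrightarrow> s * D powr (1 / real j) \<le> u j" by blast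
    have "s \<le> L"
      by (rule tendsto_upperbound[OF const_powr_inverse_tendsto[OF D(1), of s]])
        (auto intro!: eventually_sequentiallyI[of 1] order_trans[OF D(2) Lu])
    then show ?thesis by (simp add: RL)
  qed
qed

end

section \<open>Equivalent weights with one-step bounds\<close>

lemma eventually_geometric_comparable:
  fixes Q :: "nat \<Rightarrow> real"
  assumes Q: "\<And>k. Q k > 0" and s: "s > 0" and ev: "\<And>k. k \<ge> K \<Longrightarrow> Q (Suc k) = Q k / s"
  obtains c d where "c > 0" "d > 0" "\<And>k. c / s ^ k \<le> Q k" "\<And>k. Q k \<le> d / s ^ k"
proof -
  \<comment> \<open>Constant from \<open>K\<close> on, so \<open>w\<close> takes finitely many
    values and its extrema are positive.\<close>
  define w where "w k = Q k * s ^ k" for k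
  have wpos: "w k > 0" for k using Q s by (simp add: w_def)
  have const: "w (K + j) = w K" for j
    by (induction j) (use s in \<open>simp_all add: w_def ev\<close>)
  have ran: "w k \<in> w ` {..K}" for k
  proof (cases "k \<le> K")
    case False
    then have "w k = w K" using const[of "k - K"] by simp
    then show ?thesis by auto
  qed auto
  define c d where "c = Min (w ` {..K})" "d = Max (w ` {..K})"
  have cd: "c \<le> w k" "w k \<le> d" for k using ran[of k] by (auto simp: c_d_def)
  have "c > 0" using wpos by (simp add: c_d_def)
  moreover have "d > 0" using cd(2)[of 0] wpos[of 0] by simp
  ultimately show ?thesis using that[of c d] cd s unfolding w_def by (simp add: field_simps)
qed

text \<open>\<open>S\<close> is the least decreasing majorant of \<open>b k / s ^ k\<close>; almost
  monotonicity keeps it within the factor \<open>D\<close>. Multiplying back by \<open>s ^ k\<close>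
  makes every single ratio at most \<open>s\<close>.\<close>

lemma decay_renorm:
  assumes b: "\<And>k. b k > 0" and s: "s > 0" and a: "adecr (\<lambda>k. b k / s ^ k)"
  obtains b' D where "D > 0" "\<And>k. b k \<le> b' k" "\<And>k. b' k \<le> D * b k" "\<And>k. b' k > 0" "\<And>k. b' (Suc k) \<le> s * b' k"
proof -
  from a obtain D where D: "D > 0" "\<And>k n. k \<le> n \<Longrightarrow> b n / s ^ n \<le> D * (b k / s ^ k)" by (auto simp: adecr_def)
  define S where "S k = (SUP n\<in>{k..}. b n / s ^ n)" for k
  have bd: "bdd_above ((\<lambda>n. b n / s ^ n) ` {k..})" for k
    using D(2) by (intro bdd_aboveI[of _ "D * (b k / s ^ k)"]) auto
  have S1: "b k / s ^ k \<le> S k" for k unfolding S_def by (intro cSUP_upper[OF _ bd]) auto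
  have S2: "S k \<le> D * (b k / s ^ k)" for k unfolding S_def using D(2) by (intro cSUP_least) auto
  have S3: "S (Suc k) \<le> S k" for k unfolding S_def by (intro cSUP_subset_mono bd) auto
  define b' where "b' k = s ^ k * S k" for k
  have 1: "b k \<le> b' k" for k using S1[of k] s by (simp add: b'_def field_simps)
  show ?thesis
  proof (rule that[OF D(1) 1])
    show "b' k \<le> D * b k" for k using S2[of k] s by (simp add: b'_def field_simps)
    show "b' k > 0" for k using 1[of k] b[of k] by simp
    show "b' (Suc k) \<le> s * b' k" for k using S3[of k] s by (simp add: b'_def)
  qed
qed

text \<open>Only finitely many \<open>q k\<close> exceed a given number above \<open>s\<close>; an equivalent weight absorbs these too, so
  that the contraction factor \<open>\<theta>\<close> holds in every degree.\<close>
lemma growth_renorm: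
  assumes b: "\<And>k. b k > 0" and s: "0 \<le> s" "s < \<sigma>" and a: "aincr (\<lambda>k. b k / \<sigma> ^ k)"
    and q: "\<And>k. q k \<ge> 0" "q \<longlonglongrightarrow> s"
  obtains b' c \<theta> where "c > 0" "\<And>k. c * b k \<le> b' k" "\<And>k. b' k \<le> b k" "\<And>k. b' k > 0"
    "0 < \<theta>" "\<theta> < 1" "\<And>k. q k * b' k \<le> \<theta> * b' (Suc k)"
proof -
  define t where "t = (s + \<sigma>) / 2"
  have t: "s < t" "t < \<sigma>" "t > 0" "\<sigma> > 0" using s by (auto simp: t_def)
  define \<theta> where "\<theta> = t / \<sigma>"
  have \<theta>: "0 < \<theta>" "\<theta> < 1" using t by (auto simp: \<theta>_def)
  \<comment> \<open>The cutoff at \<open>t\<close> keeps the divisor below positive, also where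
    \<open>q\<close> vanishes, and makes \<open>q'\<close> eventually constant.\<close>
  define q' where "q' k = max (q k) t" for k
  have q': "q' k > 0" "q k \<le> q' k" for k using t by (auto simp: q'_def)
  \<comment> \<open>With \<open>Q (Suc k) = Q k * (\<theta> / q' k)\<close> the inequality wanted
    for \<open>b'\<close> says that \<open>b' * Q\<close> increases. Beyond \<open>K\<close> the
    quotient is \<open>1 / \<sigma>\<close>, so \<open>Q\<close> is comparable to
    \<open>1 / \<sigma> ^ k\<close> and \<open>b * Q\<close> is almost increasing.\<close>
  define Q where "Q k = (\<Prod>l<k. \<theta> / q' l)" for k
  have Qpos: "Q k > 0" for k using q' \<theta> by (auto simp: Q_def intro!: prod_pos)
  have Q_Suc: "Q (Suc k) = Q k * (\<theta> / q' k)" for k by (simp add: Q_def)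
  from order_tendstoD(2)[OF q(2) t(1)] obtain K where K: "\<And>k. k \<ge> K \<Longrightarrow> q k < t" by (auto simp: eventually_sequentially)
  have "Q (Suc k) = Q k / \<sigma>" if "k \<ge> K" for k
    using K[OF that] t by (simp add: Q_Suc q'_def \<theta>_def)
  from eventually_geometric_comparable[of Q \<sigma> K, OF Qpos t(4) this] obtain c d where
    cd: "c > 0" "d > 0" "\<And>k. c / \<sigma> ^ k \<le> Q k" "\<And>k. Q k \<le> d / \<sigma> ^ k" by blast
  from a obtain D where D: "D > 0" "\<And>k n. k \<le> n \<Longrightarrow> b k / \<sigma> ^ k \<le> D * (b n / \<sigma> ^ n)" by (auto simp: aincr_def)
  define z where "z k = b k * Q k" for k
  define e where "e = c / (d * D)"
  have e: "e > 0" using cd D by (simp add: e_def)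
  have z: "e * z k \<le> z n" if "k \<le> n" for k n
  proof -
    have "z k \<le> d * (b k / \<sigma> ^ k)" using mult_left_mono[OF cd(4)[of k], of "b k"] b[of k] by (simp add: z_def mult.commute)
    also have "\<dots> \<le> d * (D * (b n / \<sigma> ^ n))" using D(2)[OF that] cd by (intro mult_left_mono) auto
    finally have "e * z k \<le> e * (d * (D * (b n / \<sigma> ^ n)))" using e by (intro mult_left_mono) auto
    also have "\<dots> = c * (b n / \<sigma> ^ n)" using cd D by (simp add: e_def)
    finally have "e * z k \<le> c * (b n / \<sigma> ^ n)" .
    also have "\<dots> = b n * (c / \<sigma> ^ n)" by simp
    also have "\<dots> \<le> z n" unfolding z_def using cd(3)[of n] b[of n] by (intro mult_left_mono) auto
    finally show ?thesis .
  qed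
  have zpos: "z k > 0" for k using b Qpos by (simp add: z_def)
  \<comment> \<open>The greatest increasing minorant of \<open>z\<close>; it stays above
    \<open>e * z\<close>.\<close>
  define S where "S k = (INF n\<in>{k..}. z n)" for k
  have bd: "bdd_below (z ` {k..})" for k using zpos by (intro bdd_belowI[of _ 0]) (auto simp: less_imp_le)
  have S1: "S k \<le> z k" for k unfolding S_def by (intro cINF_lower[OF bd]) auto
  have S2: "e * z k \<le> S k" for k unfolding S_def using z by (intro cINF_greatest) auto
  have S3: "S k \<le> S (Suc k)" for k unfolding S_def by (intro cINF_superset_mono bd) auto
  have Spos: "S k > 0" for k using S2[of k] zpos[of k] e by (meson less_le_trans mult_pos_pos)
  define b' where "b' k = S k / Q k" for k
  show ?thesis
  proof (rule that[OF e, of b' \<theta>])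
    show "e * b k \<le> b' k" for k using S2[of k] Qpos[of k] by (simp add: b'_def z_def field_simps)
    show "b' k \<le> b k" for k using S1[of k] Qpos[of k] by (simp add: b'_def z_def field_simps)
    show "b' k > 0" for k using Spos Qpos by (simp add: b'_def)
    show "q k * b' k \<le> \<theta> * b' (Suc k)" for k
    proof -
      have "q k * b' k \<le> q' k * b' k" using q'[of k] Spos[of k] Qpos[of k] by (intro mult_right_mono) (auto simp: b'_def)
      also have "\<dots> \<le> q' k * (S (Suc k) / Q k)" unfolding b'_def using S3[of k] q'(1)[of k] Qpos[of k]
        by (intro mult_left_mono divide_right_mono) auto
      also have "\<dots> = \<theta> * b' (Suc k)" using \<theta> q'(1)[of k] Qpos[of k] by (simp add: b'_def Q_Suc)
      finally show ?thesis .
    qed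
  qed (use \<theta> in auto)
qed

section \<open>The index r and slowly varying ratios\<close>

context
  fixes b :: "nat \<Rightarrow> real" and C :: real
  assumes bpos: "\<And>k. b k > 0" and C: "C > 0" "\<And>k. b (Suc k) \<le> C * b k"
begin

text \<open>The lower limit is finite because \<open>b\<close> grows at most geometrically, so
  \<open>real_of_ereal\<close> loses nothing.\<close>

lemma r_index_ereal: "ereal (r_index b) = liminf (\<lambda>j. ereal (b j powr (1 / real j)))"
proof -
  have "liminf (\<lambda>j. ereal (b j powr (1 / real j))) \<ge> ereal 0"
    by (intro Liminf_bounded always_eventually) auto
  moreover have "liminf (\<lambda>j. ereal (b j powr (1 / real j))) \<le> ereal (C * b 0 + C)"
  proof -
    have "b j powr (1 / real j) \<le> C * b 0 + C" if "j \<ge> 1" for j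
    proof -
      have "b j \<le> C ^ j * b 0" using ratio_le[of b C 0 j] bpos C by (simp add: field_simps)
      \<comment> \<open>Adding 1 makes the base at least 1, so its positive powers dominate
        \<open>b 0\<close>.\<close>
      also have "\<dots> \<le> C ^ j * (b 0 + 1) ^ j"
      proof -
        have "b 0 + 1 \<le> (b 0 + 1) ^ j" using bpos[of 0] that by (intro self_le_power) auto
        then show ?thesis using C(1) by (intro mult_left_mono) auto
      qed
      finally show ?thesis using that bpos[of j] bpos[of 0] C
        by (subst powr_inverse_le_iff) (auto simp: power_mult_distrib[symmetric] distrib_left add_pos_pos)
    qed
    then have "limsup (\<lambda>j. ereal (b j powr (1 / real j))) \<le> ereal (C * b 0 + C)"
      by (intro Limsup_bounded eventually_sequentiallyI[of 1]) auto
    then show ?thesis using Liminf_le_Limsup[OF sequentially_bot] by (rule order_trans[rotated])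
  qed
  ultimately show ?thesis unfolding r_index_def
    by (cases "liminf (\<lambda>j. ereal (b j powr (1 / real j)))") auto
qed

lemma r_index_nonneg: "r_index b \<ge> 0"
proof -
  have "ereal 0 \<le> ereal (r_index b)" unfolding r_index_ereal
    by (intro Liminf_bounded always_eventually) auto
  then show ?thesis by simp
qed

lemma less_r_index: assumes "0 < s" "s < r_index b" shows "\<forall>\<^sub>F j in sequentially. s ^ j < b j"
proof -
  have "ereal s < liminf (\<lambda>j. ereal (b j powr (1 / real j)))" using assms unfolding r_index_ereal[symmetric] by simp
  then have "\<forall>\<^sub>F j in sequentially. ereal s < ereal (b j powr (1 / real j))"
    by (rule less_LiminfD)
  then show ?thesis using eventually_ge_at_top[of 1]
  proof eventually_elim
    case (elim j)
    then show ?case using powr_inverse_le_iff[of "b j" s j] bpos[of j] assms by (simp add: not_le[symmetric])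
  qed
qed

lemma greater_r_index: assumes "r_index b < s" shows "\<exists>\<^sub>F j in sequentially. b j < s ^ j"
proof (rule ccontr)
  have s0: "s > 0" using r_index_nonneg assms by simp
  assume "\<not> ?thesis"
  then have "\<forall>\<^sub>F j in sequentially. s ^ j \<le> b j" by (simp add: frequently_def not_less)
  then have "\<forall>\<^sub>F j in sequentially. ereal s \<le> ereal (b j powr (1 / real j))"
    using eventually_ge_at_top[of 1]
    by eventually_elim (use powr_inverse_ge_iff bpos s0 in auto)
  then have "ereal s \<le> ereal (r_index b)" unfolding r_index_ereal by (rule Liminf_bounded)
  then show False using assms by simp
qed

lemma geometric_gap:
  assumes "0 < s" "s < t" "D > 0" shows "\<forall>\<^sub>F j in sequentially. D * s ^ j < (t::real) ^ j"
proof -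
  have "(\<lambda>j. D * (s / t) ^ j) \<longlonglongrightarrow> D * 0" using assms by (intro tendsto_mult tendsto_const LIMSEQ_realpow_zero) auto
  then have "\<forall>\<^sub>F j in sequentially. D * (s / t) ^ j < 1" by (intro order_tendstoD(2)) auto
  then show ?thesis by eventually_elim (use assms in \<open>simp add: power_divide field_simps\<close>)
qed

text \<open>Below \<open>i\<close> the weight dominates a geometric sequence up to a constant. Two
  numbers are placed between the indices so that their geometric gap absorbs this constant.\<close>

lemma i_index_le_r_index: "i_index b \<le> r_index b"
proof (rule ccontr)
  assume "\<not> ?thesis"
  then have "r_index b < i_index b" by simp
  then obtain t where t: "r_index b < t" "t < i_index b" using dense by blast
  from dense[OF t(1)] obtain s where s: "r_index b < s" "s < t" by blast
  note st = s t(2)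
  then have p: "s > 0" using r_index_nonneg by simp
  from i_index_characterization(3)[of b C, OF bpos C, of t] st p obtain D where
    D: "D > 0" "\<And>k n. k \<le> n \<Longrightarrow> b k / t ^ k \<le> D * (b n / t ^ n)" by (auto simp: aincr_def)
  have "\<forall>\<^sub>F j in sequentially. (D / b 0) * s ^ j < t ^ j" using geometric_gap[of s t "D / b 0"] st p D bpos[of 0] by simp
  then have "\<forall>\<^sub>F j in sequentially. \<not> b j < s ^ j"
  proof eventually_elim
    case (elim j)
    have "b 0 * t ^ j \<le> D * b j" using D(2)[of 0 j] p st by (simp add: field_simps)
    moreover have "D * s ^ j < b 0 * t ^ j" using elim bpos[of 0] by (simp add: field_simps)
    ultimately have "D * s ^ j < D * b j" by simp
    then show ?case using D(1) by simp
  qed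
  then show False using greater_r_index[OF st(1)] by (simp add: frequently_def)
qed

lemma r_index_le_R_index: "r_index b \<le> R_index b"
proof (rule ccontr)
  assume "\<not> ?thesis"
  then have "R_index b < r_index b" by simp
  then obtain t where t: "R_index b < t" "t < r_index b" using dense by blast
  from dense[OF t(1)] obtain s where s: "R_index b < s" "s < t" by blast
  note st = s t(2)
  then have p: "s > 0" using R_index_characterization(2)[of b C, OF bpos C] by simp
  from R_index_characterization(3)[of b C, OF bpos C st(1)] obtain D where
    D: "D > 0" "\<And>k n. k \<le> n \<Longrightarrow> b n / s ^ n \<le> D * (b k / s ^ k)" by (auto simp: adecr_def)
  have "\<forall>\<^sub>F j in sequentially. (D * b 0) * s ^ j < t ^ j" using geometric_gap[of s t] st p D bpos[of 0] by simp
  moreover have "\<forall>\<^sub>F j in sequentially. t ^ j < b j" using less_r_index[of t] st p by simp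
  ultimately have "\<forall>\<^sub>F j in sequentially. False"
  proof eventually_elim
    case (elim j)
    have "b j \<le> D * b 0 * s ^ j" using D(2)[of 0 j] p by (simp add: field_simps)
    then show ?case using elim by simp
  qed
  then show False by simp
qed

lemma liminf_ratio_ereal:
  "ereal (real_of_ereal (liminf (\<lambda>k. ereal (b (Suc k) / b k)))) = liminf (\<lambda>k. ereal (b (Suc k) / b k))"
  "ereal (real_of_ereal (limsup (\<lambda>k. ereal (b (Suc k) / b k)))) = limsup (\<lambda>k. ereal (b (Suc k) / b k))"
proof -
  have r: "0 \<le> b (Suc k) / b k" "b (Suc k) / b k \<le> C" for k
    using bpos[of k] bpos[of "Suc k"] C(2)[of k] by (auto simp: field_simps)
  have "ereal 0 \<le> liminf (\<lambda>k. ereal (b (Suc k) / b k))"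
    using r by (intro Liminf_bounded always_eventually) auto
  moreover have "limsup (\<lambda>k. ereal (b (Suc k) / b k)) \<le> ereal C"
    using r by (intro Limsup_bounded always_eventually) auto
  moreover have "liminf (\<lambda>k. ereal (b (Suc k) / b k)) \<le> limsup (\<lambda>k. ereal (b (Suc k) / b k))"
    by (rule Liminf_le_Limsup) simp
  ultimately show "ereal (real_of_ereal (liminf (\<lambda>k. ereal (b (Suc k) / b k)))) = liminf (\<lambda>k. ereal (b (Suc k) / b k))"
    "ereal (real_of_ereal (limsup (\<lambda>k. ereal (b (Suc k) / b k)))) = limsup (\<lambda>k. ereal (b (Suc k) / b k))"
    by (cases "liminf (\<lambda>k. ereal (b (Suc k) / b k))"; cases "limsup (\<lambda>k. ereal (b (Suc k) / b k))"; auto)+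
qed

text \<open>Far out, a value taken by the ratios persists up to \<open>e\<close> over
  \<open>j\<close> consecutive degrees; thus limit points of single ratios control ratios over long
  blocks.\<close>

lemma slow_block:
  fixes a :: "nat \<Rightarrow> real"
  assumes slow: "(\<lambda>k. a (Suc k) - a k) \<longlonglongrightarrow> 0" and e: "e > 0"
  shows "\<forall>\<^sub>F k in sequentially. \<forall>l\<le>j. \<bar>a (k + l) - a k\<bar> < e"
proof -
  define d where "d = e / (real j + 1)"
  have d: "d > 0" using e by (simp add: d_def)
  from LIMSEQ_D[OF slow d] obtain N where N: "\<And>k. k \<ge> N \<Longrightarrow> \<bar>a (Suc k) - a k\<bar> < d" by auto
  have "\<bar>a (k + l) - a k\<bar> \<le> real l * d" if "k \<ge> N" for k l
  proof (induction l)
    case (Suc l)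
    have "\<bar>a (k + Suc l) - a (k + l)\<bar> < d" using N[of "k + l"] that by simp
    with Suc show ?case by (simp add: algebra_simps)
  qed simp
  moreover have "real l * d < e" if "l \<le> j" for l
  proof -
    have "real l * d < (real j + 1) * d" using that d by (intro mult_strict_right_mono) auto
    then show ?thesis by (simp add: d_def)
  qed
  ultimately have "\<forall>l\<le>j. \<bar>a (k + l) - a k\<bar> < e" if "k \<ge> N" for k using that by (meson le_less_trans)
  then show ?thesis by (auto simp: eventually_sequentially)
qed

lemma prod_ratio_le: "(\<And>l. l < j \<Longrightarrow> b (Suc (k + l)) / b (k + l) \<le> s) \<Longrightarrow> s \<ge> 0 \<Longrightarrow> b (k + j) / b k \<le> s ^ j"
proof (induction j)
  case (Suc j)
  have "b (k + Suc j) / b k = (b (Suc (k + j)) / b (k + j)) * (b (k + j) / b k)" using bpos[of "k + j"] by simp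
  also have "\<dots> \<le> s * s ^ j" using Suc bpos[of k] bpos[of "k + j"] by (intro mult_mono) auto
  finally show ?case by simp
qed (use bpos[of k] in simp)

lemma prod_ratio_ge: "(\<And>l. l < j \<Longrightarrow> s \<le> b (Suc (k + l)) / b (k + l)) \<Longrightarrow> s \<ge> 0 \<Longrightarrow> s ^ j \<le> b (k + j) / b k"
proof (induction j)
  case (Suc j)
  have "s * s ^ j \<le> (b (Suc (k + j)) / b (k + j)) * (b (k + j) / b k)"
    using Suc bpos[of k] bpos[of "k + j"] bpos[of "Suc (k + j)"] by (intro mult_mono) auto
  also have "\<dots> = b (k + Suc j) / b k" using bpos[of "k + j"] by simp
  finally show ?case by simp
qed (use bpos[of k] in simp)

text \<open>If \<open>i\<close> exceeded the lower limit, a block of \<open>j\<close> ratios would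
  stay below \<open>s\<close>, against almost geometric growth at a rate \<open>t > s\<close> once
  \<open>D * s ^ j < t ^ j\<close>. The other inequality holds because ratios that eventually exceed
  \<open>s\<close> make \<open>b k / s ^ k\<close> increase.\<close>

lemma i_index_eq_liminf:
  assumes slow: "(\<lambda>k. b (Suc (Suc k)) / b (Suc k) - b (Suc k) / b k) \<longlonglongrightarrow> 0"
  shows "real_of_ereal (liminf (\<lambda>k. ereal (b (Suc k) / b k))) = i_index b"
proof (rule antisym; rule ccontr)
  define a where "a k = b (Suc k) / b k" for k
  define L where "L = real_of_ereal (liminf (\<lambda>k. ereal (a k)))"
  have L: "ereal L = liminf (\<lambda>k. ereal (a k))" unfolding L_def a_def by (rule liminf_ratio_ereal(1))
  have L0: "L \<ge> 0"
  proof -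
    have "ereal 0 \<le> ereal L" unfolding L using bpos
      by (intro Liminf_bounded always_eventually) (auto simp: a_def less_imp_le)
    then show ?thesis by simp
  qed
  {
    assume "\<not> real_of_ereal (liminf (\<lambda>k. ereal (b (Suc k) / b k))) \<le> i_index b"
    then have "i_index b < L" unfolding L_def a_def by simp
    then obtain s where s: "i_index b < s" "s < L" using dense by blast
    then have s0: "s > 0" using i_index_characterization(2)[of b C, OF bpos C] by simp
    have "\<forall>\<^sub>F k in sequentially. ereal s < ereal (a k)" using s(2) by (intro less_LiminfD) (simp add: L[symmetric])
    then obtain K where K: "\<And>k. k \<ge> K \<Longrightarrow> s < a k" by (auto simp: eventually_sequentially)
    have "aincr (\<lambda>k. b k / s ^ k)"
    proof (rule aincr_tail[of _ K 1])
      fix k n assume kn: "K \<le> k" "k \<le> n"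
      have "s ^ (n - k) \<le> b (k + (n - k)) / b k"
        using K kn s0 by (intro prod_ratio_ge) (auto simp: a_def less_imp_le)
      moreover have "s ^ n = s ^ k * s ^ (n - k)" using kn by (simp flip: power_add)
      ultimately show "b k / s ^ k \<le> 1 * (b n / s ^ n)" using kn s0 bpos[of k] by (simp add: field_simps)
    qed (use bpos s0 in auto)
    then have "s \<le> i_index b" by (rule i_index_characterization(4)[of b C, OF bpos C s0])
    then show False using s by simp
  }
  {
    assume "\<not> i_index b \<le> real_of_ereal (liminf (\<lambda>k. ereal (b (Suc k) / b k)))"
    then have "L < i_index b" unfolding L_def a_def by simp
    then obtain t where t: "L < t" "t < i_index b" using dense by blast
    from dense[OF t(1)] obtain s where s': "L < s" "s < t" by blast
    from dense[OF s'(1)] obtain s1 where s1: "L < s1" "s1 < s" by blast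
    note s = s1 s'(2) t(2)
    have s0: "s > 0" using s L0 by simp
    from i_index_characterization(3)[of b C, OF bpos C, of t] s s0 obtain D where
      D: "D > 0" "\<And>k n. k \<le> n \<Longrightarrow> b k / t ^ k \<le> D * (b n / t ^ n)" by (auto simp: aincr_def)
    have "\<forall>\<^sub>F j in sequentially. D * s ^ j < t ^ j" using geometric_gap[of s t] s s0 D by simp
    then obtain j where j: "D * s ^ j < t ^ j" by (auto simp: eventually_sequentially)
    \<comment> \<open>\<open>j\<close> is fixed before \<open>k\<close>, since slow variation
      controls only blocks of prescribed length.\<close>
    have sb: "\<forall>\<^sub>F k in sequentially. \<forall>l\<le>j. \<bar>a (k + l) - a k\<bar> < s - s1"
      using s slow by (intro slow_block) (auto simp: a_def)
    have "\<exists>\<^sub>F k in sequentially. a k < s1"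
    proof (rule ccontr)
      assume "\<not> ?thesis"
      then have "\<forall>\<^sub>F k in sequentially. ereal s1 \<le> ereal (a k)" by (simp add: frequently_def not_less)
      then have "ereal s1 \<le> ereal L" unfolding L by (rule Liminf_bounded)
      then show False using s by simp
    qed
    from frequently_eventually_frequently[OF this sb] obtain k where k: "a k < s1" "\<forall>l\<le>j. \<bar>a (k + l) - a k\<bar> < s - s1"
      by (auto dest: frequently_ex)
    have "b (k + j) / b k \<le> s ^ j"
    proof (rule prod_ratio_le)
      fix l assume "l < j" then show "b (Suc (k + l)) / b (k + l) \<le> s" using k(1) k(2)[rule_format, of l] by (simp add: a_def)
    qed (use s0 in simp)
    moreover have "t ^ j \<le> D * (b (k + j) / b k)" using D(2)[of k "k + j"] bpos[of k] s s0 by (simp add: field_simps power_add)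
    moreover have "D * (b (k + j) / b k) \<le> D * s ^ j" using calculation(1) D(1) by (intro mult_left_mono) auto
    ultimately show False using j by linarith
  }
qed

lemma R_index_eq_limsup:
  assumes slow: "(\<lambda>k. b (Suc (Suc k)) / b (Suc k) - b (Suc k) / b k) \<longlonglongrightarrow> 0"
  shows "real_of_ereal (limsup (\<lambda>k. ereal (b (Suc k) / b k))) = R_index b"
proof (rule antisym; rule ccontr)
  define a where "a k = b (Suc k) / b k" for k
  define L where "L = real_of_ereal (limsup (\<lambda>k. ereal (a k)))"
  have L: "ereal L = limsup (\<lambda>k. ereal (a k))" unfolding L_def a_def by (rule liminf_ratio_ereal(2))
  have L0: "L \<ge> 0"
  proof -
    have "ereal 0 \<le> liminf (\<lambda>k. ereal (a k))" using bpos
      by (intro Liminf_bounded always_eventually) (auto simp: a_def less_imp_le)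
    also have "\<dots> \<le> ereal L" unfolding L by (rule Liminf_le_Limsup) simp
    finally show ?thesis by simp
  qed
  {
    assume "\<not> R_index b \<le> real_of_ereal (limsup (\<lambda>k. ereal (b (Suc k) / b k)))"
    then have "L < R_index b" unfolding L_def a_def by simp
    then obtain s where s: "L < s" "s < R_index b" using dense by blast
    then have s0: "s > 0" using L0 by simp
    have "\<forall>\<^sub>F k in sequentially. ereal (a k) < ereal s" using s(1) by (intro Limsup_lessD) (simp add: L[symmetric])
    then obtain K where K: "\<And>k. k \<ge> K \<Longrightarrow> a k < s" by (auto simp: eventually_sequentially)
    have "adecr (\<lambda>k. b k / s ^ k)"
    proof (rule adecr_tail[of _ K 1])
      fix k n assume kn: "K \<le> k" "k \<le> n"
      have "b (k + (n - k)) / b k \<le> s ^ (n - k)"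
        using K kn s0 by (intro prod_ratio_le) (auto simp: a_def less_imp_le)
      moreover have "s ^ n = s ^ k * s ^ (n - k)" using kn by (simp flip: power_add)
      ultimately show "b n / s ^ n \<le> 1 * (b k / s ^ k)" using kn s0 bpos[of k] by (simp add: field_simps)
    qed (use bpos s0 in auto)
    then have "R_index b \<le> s" by (rule R_index_characterization(4)[of b C, OF bpos C s0])
    then show False using s by simp
  }
  {
    assume "\<not> real_of_ereal (limsup (\<lambda>k. ereal (b (Suc k) / b k))) \<le> R_index b"
    then have "R_index b < L" unfolding L_def a_def by simp
    then obtain t where t: "R_index b < t" "t < L" using dense by blast
    from dense[OF t(2)] obtain s where s': "t < s" "s < L" by blast
    from dense[OF s'(2)] obtain s1 where s1: "s < s1" "s1 < L" by blast
    note s = t(1) s'(1) s1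
    have t0: "t > 0" using s R_index_characterization(2)[of b C, OF bpos C] by simp
    from R_index_characterization(3)[of b C, OF bpos C s(1)] obtain D where
      D: "D > 0" "\<And>k n. k \<le> n \<Longrightarrow> b n / t ^ n \<le> D * (b k / t ^ k)" by (auto simp: adecr_def)
    have "\<forall>\<^sub>F j in sequentially. D * t ^ j < s ^ j" using geometric_gap[of t s] s t0 D by simp
    then obtain j where j: "D * t ^ j < s ^ j" by (auto simp: eventually_sequentially)
    have sb: "\<forall>\<^sub>F k in sequentially. \<forall>l\<le>j. \<bar>a (k + l) - a k\<bar> < s1 - s"
      using s slow by (intro slow_block) (auto simp: a_def)
    have "\<exists>\<^sub>F k in sequentially. s1 < a k"
    proof (rule ccontr)
      assume "\<not> ?thesis"
      then have "\<forall>\<^sub>F k in sequentially. ereal (a k) \<le> ereal s1" by (simp add: frequently_def not_less)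
      then have "ereal L \<le> ereal s1" unfolding L by (rule Limsup_bounded)
      then show False using s by simp
    qed
    from frequently_eventually_frequently[OF this sb] obtain k where k: "s1 < a k" "\<forall>l\<le>j. \<bar>a (k + l) - a k\<bar> < s1 - s"
      by (auto dest: frequently_ex)
    have "s ^ j \<le> b (k + j) / b k"
    proof (rule prod_ratio_ge)
      fix l assume "l < j" then show "s \<le> b (Suc (k + l)) / b (k + l)" using k(1) k(2)[rule_format, of l] by (simp add: a_def)
    qed (use s t0 in simp)
    moreover have "b (k + j) / b k \<le> D * t ^ j" using D(2)[of k "k + j"] bpos[of k] t0 by (simp add: field_simps power_add)
    ultimately show False using j by linarith
  }
qed

end

section \<open>The Koszul complex\<close>

definition ksign :: "'n::linorder set \<Rightarrow> 'n \<Rightarrow> complex" where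
  "ksign S i = (-1) ^ card {j\<in>S. j < i}"

lemma ksign_sq [simp]: "ksign S i * ksign S i = 1"
  by (simp add: ksign_def flip: power_mult_distrib)

lemma ksign_insert:
  assumes "finite S" "x \<notin> S"
  shows "ksign (insert x S) i = (if x < i then -1 else 1) * ksign S i"
proof -
  have "{j\<in>insert x S. j < i} = (if x < i then insert x {j\<in>S. j < i} else {j\<in>S. j < i})" by auto
  then show ?thesis using assms by (simp add: ksign_def)
qed

lemma ksign_remove:
  assumes "finite S" "x \<in> S"
  shows "ksign S i = (if x < i then -1 else 1) * ksign (S - {x}) i"
  using ksign_insert[of "S - {x}" x i] assms by (simp add: insert_absorb)

text \<open>The interior product. For \<open>j\<close> outside \<open>S\<close> the sign
  \<open>ksign S j\<close> equals \<open>ksign (insert j S) j\<close>, so removing an index undoes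
  the sign with which \<open>koszul_d\<close> inserts it.\<close>

definition contr :: "('n \<Rightarrow> 'n fps_m \<Rightarrow> 'n fps_m) \<Rightarrow> ('n::{finite,linorder} set \<Rightarrow> 'n fps_m) \<Rightarrow> ('n set \<Rightarrow> 'n fps_m)" where
  "contr Y \<omega> S = (\<lambda>\<alpha>. \<Sum>j\<in>-S. ksign S j * Y j (\<omega> (insert j S)) \<alpha>)"

lemma koszul_d_eq: "koszul_d lam \<omega> S = (\<lambda>\<alpha>. \<Sum>i\<in>S. ksign S i * Mz_shift lam i (\<omega> (S - {i})) \<alpha>)"
  by (simp add: koszul_d_def ksign_def)

lemma Mz_linear: "Mz i (\<lambda>\<alpha>. \<Sum>k\<in>A. c k * F k \<alpha>) = (\<lambda>\<alpha>. \<Sum>k\<in>A. c k * Mz i (F k) \<alpha>)"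
  by (auto simp: Mz_def)

lemma Mz_cmult: "Mz i (\<lambda>\<alpha>. c * f \<alpha>) = (\<lambda>\<alpha>. c * Mz i f \<alpha>)"
  by (auto simp: Mz_def)

lemma Mz_zero [simp]: "Mz i (\<lambda>_. 0) = (\<lambda>_. 0)"
  by (auto simp: Mz_def)

lemma Mz_shift_linear: "Mz_shift lam i (\<lambda>\<alpha>. \<Sum>k\<in>A. c k * F k \<alpha>) = (\<lambda>\<alpha>. \<Sum>k\<in>A. c k * Mz_shift lam i (F k) \<alpha>)"
  by (auto simp: Mz_shift_def Mz_linear sum_distrib_left right_diff_distrib mult.left_commute simp flip: sum_subtractf)

lemma Mz_shift_cmult: "Mz_shift lam i (\<lambda>\<alpha>. c * f \<alpha>) = (\<lambda>\<alpha>. c * Mz_shift lam i f \<alpha>)"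
  by (auto simp: Mz_shift_def Mz_cmult algebra_simps)

lemma Mz_shift_zero [simp]: "Mz_shift lam i (\<lambda>_. 0) = (\<lambda>_. 0)"
  by (auto simp: Mz_shift_def)

lemma Mz_commute: "Mz i (Mz j f) = Mz j (Mz i f)"
  by (cases "i = j") (auto simp: Mz_def fun_upd_twist)

lemma Mz_shift_commute: "Mz_shift lam i (Mz_shift lam j f) = Mz_shift lam j (Mz_shift lam i f)"
proof -
  have D: "Mz i (\<lambda>\<alpha>. f \<alpha> - g \<alpha>) = (\<lambda>\<alpha>. Mz i f \<alpha> - Mz i g \<alpha>)" for i and f g :: "'a fps_m" by (auto simp: Mz_def)
  show ?thesis
    by (simp only: Mz_shift_def D Mz_cmult Mz_commute[of i j]) (simp add: algebra_simps)
qed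

lemma koszul_d_koszul_d: "koszul_d lam (koszul_d lam \<omega>) = (\<lambda>_ _. 0)"
proof (intro ext)
  fix S :: "'a set" and \<alpha> :: "'a mindex"
  \<comment> \<open>With the diagonal set to 0 both indices run over \<open>S\<close>; commuting
    operators and opposite signs make \<open>g\<close> antisymmetric, so the double sum equals its
    negative.\<close>
  define g where "g i j = (if i = j then 0 else ksign S i * ksign (S - {i}) j * Mz_shift lam i (Mz_shift lam j (\<omega> (S - {i} - {j}))) \<alpha>)" for i j
  have anti: "g j i = - g i j" if "i \<in> S" "j \<in> S" for i j
  proof (cases "i = j")
    case False
    define T where "T = S - {j} - {i}"
    define Z where "Z = Mz_shift lam j (Mz_shift lam i (\<omega> T)) \<alpha>"
    have T: "S - {i} - {j} = T" "S - {j} - {i} = T" by (auto simp: T_def)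
    have 1: "g i j = ksign S i * ksign (S - {i}) j * Z"
      using False unfolding g_def T Mz_shift_commute[of lam i j] Z_def by (simp only: if_False)
    have 2: "g j i = ksign S j * ksign (S - {j}) i * Z"
      using False unfolding g_def T Z_def by (simp only: if_False eq_commute[of j i])
    have s1: "ksign S i = (if j < i then -1 else 1) * ksign (S - {j}) i" by (rule ksign_remove) (use that in auto)
    have s2: "ksign S j = (if i < j then -1 else 1) * ksign (S - {i}) j" by (rule ksign_remove) (use that in auto)
    from False consider "i < j" "\<not> j < i" | "j < i" "\<not> i < j" by fastforce
    then show ?thesis unfolding 1 2 s1 s2 by cases simp_all
  qed (simp add: g_def)
  have "koszul_d lam (koszul_d lam \<omega>) S \<alpha> = (\<Sum>i\<in>S. \<Sum>j\<in>S - {i}. g i j)"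
    unfolding koszul_d_eq Mz_shift_linear sum_distrib_left g_def by (intro sum.cong refl) (simp, blast)
  also have "\<dots> = (\<Sum>i\<in>S. \<Sum>j\<in>S. g i j)"
    by (intro sum.cong refl sum.mono_neutral_left) (auto simp: g_def)
  finally have 1: "koszul_d lam (koszul_d lam \<omega>) S \<alpha> = (\<Sum>i\<in>S. \<Sum>j\<in>S. g i j)" .
  have "(\<Sum>i\<in>S. \<Sum>j\<in>S. g i j) = (\<Sum>j\<in>S. \<Sum>i\<in>S. g i j)" by (rule sum.swap)
  also have "\<dots> = (\<Sum>j\<in>S. \<Sum>i\<in>S. - g j i)" by (intro sum.cong refl anti)
  also have "\<dots> = - (\<Sum>i\<in>S. \<Sum>j\<in>S. g i j)" by (simp add: sum_negf)
  finally show "koszul_d lam (koszul_d lam \<omega>) S \<alpha> = 0" using 1 by simp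
qed

text \<open>The Koszul differential acts by \<open>\<partial> = \<Sum>\<^sub>i e\<^sub>i \<and> (z\<^sub>i - \<lambda>\<^sub>i)\<close>. Contraction with
  constants \<open>cnj \<lambda>\<^sub>j\<close> is the case \<open>\<kappa> = 0\<close>, contraction with the partial derivatives the case \<open>\<kappa> = 1\<close>.\<close>
lemma koszul_homotopy:
  fixes \<omega> :: "'n::{finite,linorder} set \<Rightarrow> 'n fps_m" and \<kappa> :: complex
  assumes lin: "\<And>j (A :: 'n set) c F. Y j (\<lambda>\<alpha>. \<Sum>k\<in>A. c k * F k \<alpha>) = (\<lambda>\<alpha>. \<Sum>k\<in>A. c k * Y j (F k) \<alpha>)"
    and comm: "\<And>i j f \<alpha>. Y j (Mz_shift lam i f) \<alpha> = Mz_shift lam i (Y j f) \<alpha> + (if i = j then \<kappa> * f \<alpha> else 0)"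
  shows "koszul_d lam (contr Y \<omega>) S \<alpha> + contr Y (koszul_d lam \<omega>) S \<alpha>
     = (\<Sum>i\<in>UNIV. Mz_shift lam i (Y i (\<omega> S)) \<alpha>) + \<kappa> * of_nat (CARD('n) - card S) * \<omega> S \<alpha>"
proof -
  \<comment> \<open>The terms \<open>m\<close> and \<open>n\<close> with \<open>i\<close> in
    \<open>S\<close> and \<open>j\<close> outside cancel in pairs. The diagonal remains: indices in
    \<open>S\<close> from the first composition, indices outside from the second, the latter leaving
    one commutator \<open>\<kappa>\<close> each.\<close>
  define m where "m i j = ksign S i * ksign (S - {i}) j * Mz_shift lam i (Y j (\<omega> (insert j (S - {i})))) \<alpha>" for i j
  define n where "n i j = ksign S j * ksign (insert j S) i * Y j (Mz_shift lam i (\<omega> (insert j S - {i}))) \<alpha>" for i j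
  have 1: "koszul_d lam (contr Y \<omega>) S \<alpha> = (\<Sum>i\<in>S. Mz_shift lam i (Y i (\<omega> S)) \<alpha>) + (\<Sum>i\<in>S. \<Sum>j\<in>-S. m i j)"
  proof -
    have "koszul_d lam (contr Y \<omega>) S \<alpha> = (\<Sum>i\<in>S. \<Sum>j\<in>-(S-{i}). m i j)"
      by (simp only: koszul_d_eq contr_def Mz_shift_linear sum_distrib_left m_def mult.assoc)
    also have "\<dots> = (\<Sum>i\<in>S. m i i + (\<Sum>j\<in>-S. m i j))"
    proof (intro sum.cong refl)
      fix i assume "i \<in> S"
      then have "-(S - {i}) = insert i (-S)" by auto
      then show "(\<Sum>j\<in>-(S-{i}). m i j) = m i i + (\<Sum>j\<in>-S. m i j)" using \<open>i \<in> S\<close> by simp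
    qed
    also have "\<dots> = (\<Sum>i\<in>S. m i i) + (\<Sum>i\<in>S. \<Sum>j\<in>-S. m i j)" by (simp add: sum.distrib)
    also have "(\<Sum>i\<in>S. m i i) = (\<Sum>i\<in>S. Mz_shift lam i (Y i (\<omega> S)) \<alpha>)"
    proof (intro sum.cong refl)
      fix i assume i: "i \<in> S"
      have "ksign S i = ksign (S - {i}) i" using ksign_remove[of S i i] i by simp
      then show "m i i = Mz_shift lam i (Y i (\<omega> S)) \<alpha>" using i by (simp add: m_def insert_absorb)
    qed
    finally show ?thesis .
  qed
  have 2: "contr Y (koszul_d lam \<omega>) S \<alpha> = (\<Sum>j\<in>-S. Y j (Mz_shift lam j (\<omega> S)) \<alpha>) + (\<Sum>j\<in>-S. \<Sum>i\<in>S. n i j)"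
  proof -
    have "contr Y (koszul_d lam \<omega>) S \<alpha> = (\<Sum>j\<in>-S. \<Sum>i\<in>insert j S. n i j)"
      by (simp only: koszul_d_eq contr_def lin sum_distrib_left n_def mult.assoc)
    also have "\<dots> = (\<Sum>j\<in>-S. n j j) + (\<Sum>j\<in>-S. \<Sum>i\<in>S. n i j)" by (simp add: sum.distrib)
    also have "(\<Sum>j\<in>-S. n j j) = (\<Sum>j\<in>-S. Y j (Mz_shift lam j (\<omega> S)) \<alpha>)"
      by (intro sum.cong refl) (simp add: n_def ksign_insert)
    finally show ?thesis .
  qed
  have "(\<Sum>j\<in>-S. \<Sum>i\<in>S. n i j) = (\<Sum>j\<in>-S. \<Sum>i\<in>S. - m i j)"
  proof (intro sum.cong refl)
    fix i j assume ij: "j \<in> -S" "i \<in> S"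
    then have "i \<noteq> j" by auto
    have a: "ksign S j = (if i < j then -1 else 1) * ksign (S - {i}) j" using ij by (intro ksign_remove) auto
    have b: "ksign (insert j S) i = (if j < i then -1 else 1) * ksign S i" using ij by (intro ksign_insert) auto
    have c: "insert j S - {i} = insert j (S - {i})" using \<open>i \<noteq> j\<close> by auto
    have "i < j \<and> \<not> j < i \<or> j < i \<and> \<not> i < j" using \<open>i \<noteq> j\<close> by auto
    then show "n i j = - m i j" using \<open>i \<noteq> j\<close> unfolding n_def m_def a b c comm by auto
  qed
  also have "\<dots> = - (\<Sum>i\<in>S. \<Sum>j\<in>-S. m i j)" by (subst sum.swap) (simp add: sum_negf)
  finally have 3: "koszul_d lam (contr Y \<omega>) S \<alpha> + contr Y (koszul_d lam \<omega>) S \<alpha>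
     = (\<Sum>i\<in>S. Mz_shift lam i (Y i (\<omega> S)) \<alpha>) + (\<Sum>j\<in>-S. Y j (Mz_shift lam j (\<omega> S)) \<alpha>)"
    unfolding 1 2 by simp
  have 4: "(\<Sum>j\<in>-S. Y j (Mz_shift lam j (\<omega> S)) \<alpha>) = (\<Sum>j\<in>-S. Mz_shift lam j (Y j (\<omega> S)) \<alpha>) + \<kappa> * of_nat (CARD('n) - card S) * \<omega> S \<alpha>"
    unfolding comm by (simp add: sum.distrib Compl_eq_Diff_UNIV card_Diff_subset)
  have 5: "(\<Sum>i\<in>S. Mz_shift lam i (Y i (\<omega> S)) \<alpha>) + (\<Sum>j\<in>-S. Mz_shift lam j (Y j (\<omega> S)) \<alpha>) = (\<Sum>i\<in>UNIV. Mz_shift lam i (Y i (\<omega> S)) \<alpha>)"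
    by (subst sum.union_disjoint[symmetric]) auto
  show ?thesis unfolding 3 4 5[symmetric] by (simp only: add.assoc)
qed

text \<open>Each term is bounded by its predecessor. The shifted part of a partial sum has norm at
  most \<open>\<sigma>\<close> times the same partial sum and is absorbed on the left; working with
  finite sums makes summability of \<open>x\<close> a conclusion.\<close>

lemma sqsum_decay_estimate:
  fixes x e b :: "nat \<Rightarrow> real"
  assumes x: "\<And>k. x k \<ge> 0" and e: "\<And>k. e k \<ge> 0" and b: "\<And>k. b k > 0" and sg: "0 \<le> \<sigma>" "\<sigma> < s"
    and step: "\<And>k. b (Suc k) \<le> \<sigma> * b k" and rec: "\<And>k. s * x (Suc k) \<le> x k + e (Suc k)" "s * x 0 \<le> e 0"
    and se: "sqsum (\<lambda>k. b k * e k)"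
  shows "sqsum (\<lambda>k. b k * x k)" "l2norm (\<lambda>k. b k * x k) \<le> l2norm (\<lambda>k. b k * e k) / (s - \<sigma>)"
proof -
  let ?X = "\<lambda>n. L2_set (\<lambda>k. b k * x k) {..<n}"
  define y where "y k = (case k of 0 \<Rightarrow> 0 | Suc j \<Rightarrow> \<sigma> * (b j * x j))" for k
  have pt: "s * (b k * x k) \<le> y k + b k * e k" for k
  proof (cases k)
    case 0
    then show ?thesis using mult_left_mono[OF rec(2), of "b 0"] b[of 0] by (simp add: y_def mult_ac)
  next
    case (Suc j)
    have "s * (b k * x k) = b k * (s * x (Suc j))" using Suc by simp
    also have "\<dots> \<le> b k * (x j + e k)" using rec(1)[of j] b[of k] Suc by (intro mult_left_mono) auto
    also have "\<dots> \<le> \<sigma> * b j * x j + b k * e k" using mult_right_mono[OF step[of j] x[of j]] Suc by (simp add: distrib_left)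
    finally show ?thesis using Suc by (simp add: y_def mult.assoc)
  qed
  have "?X n \<le> l2norm (\<lambda>k. b k * e k) / (s - \<sigma>)" for n
  proof -
    have "s * ?X n = L2_set (\<lambda>k. s * (b k * x k)) {..<n}" using sg by (intro L2_set_right_distrib) auto
    also have "\<dots> \<le> L2_set (\<lambda>k. y k + b k * e k) {..<n}" using pt sg b x by (intro L2_set_mono) (auto simp: less_imp_le)
    also have "\<dots> \<le> L2_set y {..<n} + L2_set (\<lambda>k. b k * e k) {..<n}" by (rule L2_set_triangle_ineq)
    also have "L2_set (\<lambda>k. b k * e k) {..<n} \<le> l2norm (\<lambda>k. b k * e k)" by (rule L2_set_le_l2norm[OF se])
    also have "L2_set y {..<n} \<le> \<sigma> * ?X n"
    proof (cases n)
      case (Suc m)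
      have "(\<Sum>k<Suc m. (y k)\<^sup>2) = (\<Sum>k<m. (\<sigma> * (b k * x k))\<^sup>2)" by (subst sum.lessThan_Suc_shift) (simp add: y_def)
      then have "L2_set y {..<n} = L2_set (\<lambda>k. \<sigma> * (b k * x k)) {..<m}" by (simp add: L2_set_def Suc)
      also have "\<dots> \<le> L2_set (\<lambda>k. \<sigma> * (b k * x k)) {..<n}"
        unfolding L2_set_def by (intro real_sqrt_le_mono sum_mono2) (auto simp: Suc)
      also have "\<dots> = \<sigma> * ?X n" using sg by (simp add: L2_set_right_distrib)
      finally show ?thesis .
    qed simp
    finally have "(s - \<sigma>) * ?X n \<le> l2norm (\<lambda>k. b k * e k)" by (simp add: left_diff_distrib)
    then show ?thesis using sg by (simp add: field_simps)
  qed
  from sqsumI[OF this] show "sqsum (\<lambda>k. b k * x k)" "l2norm (\<lambda>k. b k * x k) \<le> l2norm (\<lambda>k. b k * e k) / (s - \<sigma>)" by auto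
qed

text \<open>Here a term is bounded by its successor, so a partial sum would refer to a later term;
  the absorption takes place in the full norm, and \<open>x\<close> must be square-summable
  beforehand.\<close>

lemma sqsum_growth_estimate:
  fixes x e b q :: "nat \<Rightarrow> real"
  assumes x: "\<And>k. x k \<ge> 0" and b: "\<And>k. b k > 0" and th: "0 \<le> \<theta>"
    and step: "\<And>k. q k * b k \<le> \<theta> * b (Suc k)" and rec: "\<And>k. x k \<le> q k * x (Suc k) + e k"
    and sx: "sqsum (\<lambda>k. b k * x k)" and se: "sqsum (\<lambda>k. b k * e k)"
  shows "(1 - \<theta>) * l2norm (\<lambda>k. b k * x k) \<le> l2norm (\<lambda>k. b k * e k)"
proof -
  have pt: "\<bar>b k * x k\<bar> \<le> \<bar>\<theta> * (b (Suc k) * x (Suc k))\<bar> + \<bar>b k * e k\<bar>" for k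
  proof -
    have "b k * x k \<le> b k * (q k * x (Suc k) + e k)" using rec[of k] b[of k] by (intro mult_left_mono) auto
    also have "\<dots> \<le> \<theta> * (b (Suc k) * x (Suc k)) + b k * e k"
      using mult_right_mono[OF step[of k] x[of "Suc k"]] by (simp add: algebra_simps)
    finally show ?thesis using b[of k] x[of k] by (simp add: abs_le_iff mult_nonneg_nonneg less_imp_le)
  qed
  note s1 = sqsum_Suc[OF sx]
  have s2: "sqsum (\<lambda>k. \<theta> * (b (Suc k) * x (Suc k)))" "l2norm (\<lambda>k. \<theta> * (b (Suc k) * x (Suc k))) \<le> \<theta> * l2norm (\<lambda>k. b (Suc k) * x (Suc k))"
    using sqsum_le[OF s1(1), of "\<lambda>k. \<theta> * (b (Suc k) * x (Suc k))" \<theta>] th by (auto simp: abs_mult)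
  have "l2norm (\<lambda>k. b k * x k) \<le> l2norm (\<lambda>k. \<theta> * (b (Suc k) * x (Suc k))) + l2norm (\<lambda>k. b k * e k)"
    by (rule sqsum_triangle(2)[OF s2(1) se pt])
  also have "\<dots> \<le> \<theta> * l2norm (\<lambda>k. b k * x k) + l2norm (\<lambda>k. b k * e k)"
    using s2(2) mult_left_mono[OF s1(2) th] by linarith
  finally show ?thesis by (simp add: algebra_simps)
qed

section \<open>Exactness outside the closed ball of radius R\<close>

text \<open>Taken over all \<open>i\<close>, multiplication by the coordinates preserves the norm
  and multiplication by the entries of \<open>lam\<close> scales it by \<open>norm lam\<close>. The
  first inequality feeds the downward recursion, the other two the upward one.\<close>

lemma hnorm_Mz_shift_ineq:
  fixes f :: "'n::finite fps_m"
  shows "hnorm f k \<le> norm lam * hnorm f (Suc k) + (\<Sum>i\<in>UNIV. hnorm (Mz_shift lam i f) (Suc k))"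
    and "norm lam * hnorm f (Suc k) \<le> hnorm f k + (\<Sum>i\<in>UNIV. hnorm (Mz_shift lam i f) (Suc k))"
    and "norm lam * hnorm f 0 \<le> (\<Sum>i\<in>UNIV. hnorm (Mz_shift lam i f) 0)"
proof -
  define h where "h i = Mz_shift lam i f" for i
  have L: "L2_set (\<lambda>i. hnorm (\<lambda>\<alpha>. lam $ i * f \<alpha>) k) UNIV = norm lam * hnorm f k" for k
    by (simp add: hnorm_cmult L2_set_left_distrib[symmetric] L2_cmod_vec)
  have S: "L2_set (\<lambda>i. hnorm (h i) k) UNIV \<le> (\<Sum>i\<in>UNIV. hnorm (h i) k)" for k
    by (rule L2_set_le_sum) auto
  have M: "hnorm (Mz i f) k \<le> hnorm (\<lambda>\<alpha>. lam $ i * f \<alpha>) k + hnorm (h i) k" for i k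
    using hnorm_add[of "\<lambda>\<alpha>. lam $ i * f \<alpha>" "h i" k] by (simp add: h_def Mz_shift_def)
  have N: "hnorm (\<lambda>\<alpha>. lam $ i * f \<alpha>) k \<le> hnorm (Mz i f) k + hnorm (h i) k" for i k
    using hnorm_diff[of "Mz i f" "h i" k] by (simp add: h_def Mz_shift_def)
  have "hnorm f k \<le> L2_set (\<lambda>i. hnorm (\<lambda>\<alpha>. lam $ i * f \<alpha>) (Suc k) + hnorm (h i) (Suc k)) UNIV"
    using M by (subst L2_hnorm_Mz[symmetric]) (intro L2_set_mono, auto)
  also have "\<dots> \<le> L2_set (\<lambda>i. hnorm (\<lambda>\<alpha>. lam $ i * f \<alpha>) (Suc k)) UNIV + L2_set (\<lambda>i. hnorm (h i) (Suc k)) UNIV"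
    by (rule L2_set_triangle_ineq)
  finally show "hnorm f k \<le> norm lam * hnorm f (Suc k) + (\<Sum>i\<in>UNIV. hnorm (Mz_shift lam i f) (Suc k))"
    using S[of "Suc k"] unfolding L h_def by linarith
  have *: "norm lam * hnorm f k \<le> L2_set (\<lambda>i. hnorm (Mz i f) k) UNIV + (\<Sum>i\<in>UNIV. hnorm (h i) k)" for k
  proof -
    have "norm lam * hnorm f k \<le> L2_set (\<lambda>i. hnorm (Mz i f) k + hnorm (h i) k) UNIV"
      unfolding L[symmetric] using N by (intro L2_set_mono) auto
    also have "\<dots> \<le> L2_set (\<lambda>i. hnorm (Mz i f) k) UNIV + L2_set (\<lambda>i. hnorm (h i) k) UNIV"
      by (rule L2_set_triangle_ineq)
    finally show ?thesis using S[of k] by linarith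
  qed
  show "norm lam * hnorm f (Suc k) \<le> hnorm f k + (\<Sum>i\<in>UNIV. hnorm (Mz_shift lam i f) (Suc k))"
    using *[of "Suc k"] by (simp add: L2_hnorm_Mz h_def)
  show "norm lam * hnorm f 0 \<le> (\<Sum>i\<in>UNIV. hnorm (Mz_shift lam i f) 0)"
    using *[of 0] by (simp add: h_def L2_set_def)
qed

lemma sqsum_sum:
  assumes "\<And>i. i \<in> A \<Longrightarrow> sqsum (x i)"
  shows "sqsum (\<lambda>k. \<Sum>i\<in>A. x i k) \<and> l2norm (\<lambda>k. \<Sum>i\<in>A. x i k) \<le> (\<Sum>i\<in>A. l2norm (x i))"
  using assms
proof (induction A rule: infinite_finite_induct)
  case (insert i A)
  have IH: "sqsum (\<lambda>k. \<Sum>i\<in>A. x i k)" "l2norm (\<lambda>k. \<Sum>i\<in>A. x i k) \<le> (\<Sum>i\<in>A. l2norm (x i))"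
    using insert.IH insert.prems by simp_all
  have "\<bar>\<Sum>i\<in>insert i A. x i k\<bar> \<le> \<bar>x i k\<bar> + \<bar>\<Sum>i\<in>A. x i k\<bar>" for k
    using insert.hyps by (simp add: abs_triangle_ineq)
  from sqsum_triangle[OF insert.prems[OF insertI1] IH(1) this] IH(2) insert.hyps show ?case by simp
qed (auto simp: sqsum_def l2norm_def)

definition radial_op :: "complex^'n \<Rightarrow> 'n fps_m \<Rightarrow> 'n fps_m" where
  "radial_op lam g = (\<lambda>\<alpha>. \<Sum>i\<in>UNIV. cnj (lam $ i) * Mz_shift lam i g \<alpha>)"

lemma sum_cnj_mult_vec: "(\<Sum>i\<in>UNIV. cnj (lam $ i) * lam $ i) = complex_of_real ((norm lam)\<^sup>2)" for lam :: "complex^'n"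
  unfolding norm_vec_sq of_real_sum complex_norm_square by (simp add: mult.commute)

lemma mdeg_zero [simp]: "mdeg (\<lambda>_. 0) = 0"
  by (simp add: mdeg_def)

lemma radial_op_eq: "radial_op lam g \<alpha> = (\<Sum>i\<in>UNIV. cnj (lam $ i) * Mz i g \<alpha>) - complex_of_real ((norm lam)\<^sup>2) * g \<alpha>"
  unfolding sum_cnj_mult_vec[symmetric] radial_op_def Mz_shift_def right_diff_distrib sum_subtractf sum_distrib_right mult.assoc ..

lemma radial_op_inj:
  assumes "radial_op lam g = (\<lambda>_. 0)" "lam \<noteq> 0" shows "g = (\<lambda>_. 0)"
proof -
  have "g \<alpha> = 0" if "mdeg \<alpha> = k" for k \<alpha>
    using that
  proof (induction k arbitrary: \<alpha>)
    case 0
    then have "complex_of_real ((norm lam)\<^sup>2) * g \<alpha> = 0" using fun_cong[OF assms(1), of \<alpha>] by (simp add: radial_op_eq mdeg_0_iff)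
    then show ?case using assms(2) by simp
  next
    case (Suc k)
    have "Mz i g \<alpha> = 0" for i using Suc by (cases \<alpha> i rule: inc_cases) auto
    then have "complex_of_real ((norm lam)\<^sup>2) * g \<alpha> = 0" using fun_cong[OF assms(1), of \<alpha>] by (simp add: radial_op_eq)
    then show ?case using assms(2) by simp
  qed
  then show ?thesis by auto
qed

text \<open>\<open>radial_op\<close> is a degree-raising part minus a nonzero scalar, so its inverse
  is determined degree by degree. Stage \<open>k\<close> is meant only for degree \<open>k\<close>,
  and \<open>radial_inv\<close> reads off the diagonal.\<close>

primrec radial_inv_aux :: "complex^'n \<Rightarrow> 'n fps_m \<Rightarrow> nat \<Rightarrow> 'n fps_m" where
  "radial_inv_aux lam f 0 = (\<lambda>\<alpha>. - f \<alpha> / complex_of_real ((norm lam)\<^sup>2))"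
| "radial_inv_aux lam f (Suc k) = (\<lambda>\<alpha>. ((\<Sum>i\<in>UNIV. cnj (lam $ i) * Mz i (radial_inv_aux lam f k) \<alpha>) - f \<alpha>) / complex_of_real ((norm lam)\<^sup>2))"

definition radial_inv :: "complex^'n \<Rightarrow> 'n fps_m \<Rightarrow> 'n fps_m" where
  "radial_inv lam f = (\<lambda>\<alpha>. radial_inv_aux lam f (mdeg \<alpha>) \<alpha>)"

lemma radial_op_inv:
  assumes "lam \<noteq> 0" shows "radial_op lam (radial_inv lam f) = f"
proof
  fix \<alpha>
  have "complex_of_real ((norm lam)\<^sup>2) * radial_inv lam f \<alpha> = (\<Sum>i\<in>UNIV. cnj (lam $ i) * Mz i (radial_inv lam f) \<alpha>) - f \<alpha>"
  proof (cases "mdeg \<alpha>")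
    case 0
    then show ?thesis using assms by (simp add: radial_inv_def mdeg_0_iff)
  next
    case (Suc k)
    have "Mz i (radial_inv_aux lam f k) \<alpha> = Mz i (radial_inv lam f) \<alpha>" for i
      using Suc by (cases \<alpha> i rule: inc_cases) (auto simp: radial_inv_def)
    then show ?thesis using assms Suc by (simp add: radial_inv_def[of lam f])
  qed
  then show "radial_op lam (radial_inv lam f) \<alpha> = f \<alpha>" by (simp add: radial_op_eq)
qed

text \<open>These are the recursions of \<open>sqsum_decay_estimate\<close> with
  \<open>s = norm lam\<close>.\<close>

lemma radial_inv_bound:
  assumes "lam \<noteq> 0"
  shows "norm lam * hnorm (radial_inv lam f) (Suc k) \<le> hnorm (radial_inv lam f) k + hnorm f (Suc k) / norm lam"
    and "norm lam * hnorm (radial_inv lam f) 0 \<le> hnorm f 0 / norm lam"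
proof -
  let ?g = "radial_inv lam f"
  have *: "(norm lam)\<^sup>2 * hnorm ?g k \<le> norm lam * L2_set (\<lambda>i. hnorm (Mz i ?g) k) UNIV + hnorm f k" for k
  proof -
    have "complex_of_real ((norm lam)\<^sup>2) * ?g \<alpha> = (\<Sum>i\<in>UNIV. cnj (lam $ i) * Mz i ?g \<alpha>) - f \<alpha>" for \<alpha>
      using fun_cong[OF radial_op_inv[OF assms, of f], of \<alpha>] unfolding radial_op_eq by (simp only: diff_eq_eq eq_diff_eq add.commute)
    then have "(norm lam)\<^sup>2 * hnorm ?g k = hnorm (\<lambda>\<alpha>. (\<Sum>i\<in>UNIV. cnj (lam $ i) * Mz i ?g \<alpha>) - f \<alpha>) k"
      using hnorm_cmult[of "complex_of_real ((norm lam)\<^sup>2)" ?g k] by (simp only: norm_of_real abs_power2)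
    also have "\<dots> \<le> hnorm (\<lambda>\<alpha>. \<Sum>i\<in>UNIV. cnj (lam $ i) * Mz i ?g \<alpha>) k + hnorm f k" by (rule hnorm_diff)
    also have "hnorm (\<lambda>\<alpha>. \<Sum>i\<in>UNIV. cnj (lam $ i) * Mz i ?g \<alpha>) k \<le> norm lam * L2_set (\<lambda>i. hnorm (Mz i ?g) k) UNIV"
      using hnorm_lincomb[of "\<lambda>i. cnj (lam $ i)" "\<lambda>i. Mz i ?g" k] by (simp add: L2_cmod_vec)
    finally show ?thesis by simp
  qed
  have n: "norm lam > 0" using assms by simp
  show "norm lam * hnorm ?g (Suc k) \<le> hnorm ?g k + hnorm f (Suc k) / norm lam"
    using *[of "Suc k"] n by (simp add: L2_hnorm_Mz power2_eq_square field_simps)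
  show "norm lam * hnorm ?g 0 \<le> hnorm f 0 / norm lam"
    using *[of 0] n by (simp add: L2_set_def power2_eq_square field_simps)
qed

context
  fixes b :: "nat \<Rightarrow> real" and C :: real
  assumes bpos: "\<And>k. b k > 0" and C: "C > 0" "\<And>k. b (Suc k) \<le> C * b k"
begin

lemma koszul_d_forms:
  assumes "\<omega> \<in> forms b p" shows "koszul_d lam \<omega> \<in> forms b (Suc p)"
proof -
  have 1: "koszul_d lam \<omega> S \<in> H2 b" for S
    unfolding koszul_d_eq using assms
    by (intro H2_sum[OF bpos] H2_cmult[OF bpos] H2_Mz_shift[of b _ C, OF bpos _ C(2)]) (auto simp: forms_def)
  have 2: "koszul_d lam \<omega> S = (\<lambda>_. 0)" if "card S \<noteq> Suc p" for S
  proof -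
    have "\<omega> (S - {i}) = (\<lambda>_. 0)" if "i \<in> S" for i
      using assms that \<open>card S \<noteq> Suc p\<close> by (auto simp: forms_def card_Suc_Diff1 dest: card_Suc_Diff1[rotated])
    then show ?thesis unfolding koszul_d_eq by simp
  qed
  show ?thesis using 1 2 by (simp add: forms_def)
qed

lemma koszul_ran_subset_ker: "koszul_ran b lam p \<subseteq> koszul_ker b lam p"
proof (cases p)
  case 0
  then show ?thesis using bpos by (auto simp: koszul_ran_def koszul_ker_def forms_def koszul_d_eq)
next
  case (Suc q)
  then show ?thesis
    using koszul_d_forms[of _ q lam] by (auto simp: koszul_ran_def koszul_ker_def koszul_d_koszul_d)
qed

lemma contr_forms:
  assumes "\<And>j S. Y j (\<eta> S) \<in> H2 b" "\<And>j S. card S \<noteq> p \<Longrightarrow> Y j (\<eta> S) = (\<lambda>_. 0)"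
  shows "p > 0 \<Longrightarrow> contr Y \<eta> \<in> forms b (p - 1)" "p = 0 \<Longrightarrow> contr Y \<eta> = (\<lambda>_ _. 0)"
proof -
  have *: "contr Y \<eta> S = (\<lambda>_. 0)" if "Suc (card S) \<noteq> p" for S
    using assms(2) that unfolding contr_def by (intro ext sum.neutral) auto
  show "contr Y \<eta> \<in> forms b (p - 1)" if "p > 0"
    using * that assms(1) unfolding forms_def
    by (auto simp: contr_def intro!: H2_sum[OF bpos] H2_cmult[OF bpos])
  show "contr Y \<eta> = (\<lambda>_ _. 0)" if "p = 0" using * that by auto
qed

lemma outside_weights:
  assumes "R_index b < s"
  obtains \<sigma> b' D where "\<sigma> < s" "\<sigma> > 0" "D > 0" "\<And>k. b k \<le> b' k" "\<And>k. b' k \<le> D * b k" "\<And>k. b' k > 0"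
    "\<And>k. b' (Suc k) \<le> \<sigma> * b' k"
proof -
  obtain \<sigma> where s: "R_index b < \<sigma>" "\<sigma> < s" using dense[OF assms] by blast
  have sp: "\<sigma> > 0" using s R_index_characterization(2)[of b C, OF bpos C] by simp
  show ?thesis
    by (rule decay_renorm[of b \<sigma>, OF bpos sp R_index_characterization(3)[of b C, OF bpos C s(1)]])
      (rule that[OF s(2) sp])
qed

lemma radial_inv_H2:
  fixes lam :: "complex^'n::finite"
  assumes R: "R_index b < norm lam" and f: "f \<in> H2 b"
  shows "radial_inv lam f \<in> H2 b"
proof -
  obtain \<sigma> b' D where s: "\<sigma> < norm lam" and sp: "\<sigma> > 0"
    and b': "D > 0" "\<And>k. b k \<le> b' k" "\<And>k. b' k \<le> D * b k" "\<And>k. b' k > 0" "\<And>k. b' (Suc k) \<le> \<sigma> * b' k"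
    by (rule outside_weights[OF R]) (rule that, assumption+)
  have b2: "1 * b k \<le> b' k" for k using b'(2)[of k] by simp
  have eq: "h \<in> H2 b \<longleftrightarrow> h \<in> H2 b'" for h :: "'n fps_m"
    by (rule H2_equiv(1)[of b b' 1 D, OF bpos b'(4) zero_less_one b'(1) b2 b'(3)])
  have n: "lam \<noteq> 0" using s sp by auto
  have "(\<lambda>\<alpha>. (1 / norm lam) * f \<alpha>) \<in> H2 b'" using f eq by (intro H2_cmult[OF b'(4)]) simp
  then have "sqsum (\<lambda>k. b' k * (hnorm f k / norm lam))"
    using H2_iff[OF b'(4), of "\<lambda>\<alpha>. (1 / norm lam) * f \<alpha>"] hnorm_cmult[of "complex_of_real (1 / norm lam)" f]
    by (simp add: norm_divide)
  from sqsum_decay_estimate(1)[of "hnorm (radial_inv lam f)" "\<lambda>k. hnorm f k / norm lam" b' \<sigma> "norm lam", OF _ _ b'(4) _ _ b'(5) _ _ this]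
  show ?thesis using sp s radial_inv_bound[OF n, of f] eq H2_iff[OF b'(4), of "radial_inv lam f"] by simp
qed

text \<open>\<open>radial_op\<close> commutes with \<open>koszul_d\<close> and is injective on
  formal series, so the preimage \<open>\<eta>\<close> of a cocycle is again a cocycle. The homotopy
  with constants then reads \<open>\<omega> = koszul_d lam (contr Y \<eta>)\<close>.\<close>

lemma koszul_exact_outside:
  fixes lam :: "complex^'n::{finite,linorder}"
  assumes R: "R_index b < norm lam"
  shows "koszul_ker b lam p = koszul_ran b lam p"
proof
  have n: "lam \<noteq> 0" using R R_index_characterization(2)[of b C, OF bpos C] by auto
  show "koszul_ker b lam p \<subseteq> koszul_ran b lam p"
  proof
    fix \<omega> assume "\<omega> \<in> koszul_ker b lam p"
    then have w: "\<omega> \<in> forms b p" "koszul_d lam \<omega> = (\<lambda>_ _. 0)" by (auto simp: koszul_ker_def)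
    define \<eta> where "\<eta> S = radial_inv lam (\<omega> S)" for S
    have \<eta>: "radial_op lam (\<eta> S) = \<omega> S" for S by (simp add: \<eta>_def radial_op_inv[OF n])
    have H: "\<eta> S \<in> H2 b" for S using w R by (auto simp: \<eta>_def forms_def intro!: radial_inv_H2)
    have Z: "\<eta> S = (\<lambda>_. 0)" if "card S \<noteq> p" for S
      using radial_op_inj[OF _ n, of "\<eta> S"] w that by (simp add: \<eta> forms_def)
    define Y where "Y j f = (\<lambda>\<alpha>. cnj (lam $ j) * f \<alpha>)" for j and f :: "'n fps_m"
    have dA: "radial_op lam (koszul_d lam \<eta> S) = koszul_d lam \<omega> S" for S
    proof
      fix \<alpha>
      have "radial_op lam (koszul_d lam \<eta> S) \<alpha> = (\<Sum>i\<in>UNIV. \<Sum>j\<in>S. cnj (lam $ i) * (ksign S j * Mz_shift lam i (Mz_shift lam j (\<eta> (S - {j}))) \<alpha>))"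
        unfolding radial_op_def koszul_d_eq Mz_shift_linear sum_distrib_left ..
      also have "\<dots> = (\<Sum>j\<in>S. \<Sum>i\<in>UNIV. ksign S j * (cnj (lam $ i) * Mz_shift lam j (Mz_shift lam i (\<eta> (S - {j}))) \<alpha>))"
        by (subst sum.swap) (simp only: Mz_shift_commute[of lam _ _] mult.left_commute)
      also have "\<dots> = (\<Sum>j\<in>S. ksign S j * Mz_shift lam j (radial_op lam (\<eta> (S - {j}))) \<alpha>)"
        unfolding radial_op_def Mz_shift_linear sum_distrib_left ..
      finally show "radial_op lam (koszul_d lam \<eta> S) \<alpha> = koszul_d lam \<omega> S \<alpha>" by (simp add: \<eta> koszul_d_eq)
    qed
    have d0: "koszul_d lam \<eta> = (\<lambda>_ _. 0)"
      using radial_op_inj[OF _ n] dA w(2) by (intro ext) (metis)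
    have "koszul_d lam (contr Y \<eta>) S \<alpha> + contr Y (koszul_d lam \<eta>) S \<alpha>
        = (\<Sum>i\<in>UNIV. Mz_shift lam i (Y i (\<eta> S)) \<alpha>) + 0 * of_nat (CARD('n) - card S) * \<eta> S \<alpha>" for S \<alpha>
      by (rule koszul_homotopy) (auto simp: Y_def Mz_shift_cmult sum_distrib_left mult.left_commute)
    moreover have "contr Y (koszul_d lam \<eta>) S \<alpha> = 0" for S \<alpha> by (simp add: d0 contr_def Y_def)
    moreover have "(\<Sum>i\<in>UNIV. Mz_shift lam i (Y i (\<eta> S)) \<alpha>) = \<omega> S \<alpha>" for S \<alpha>
      unfolding \<eta>[symmetric] radial_op_def Y_def Mz_shift_cmult ..
    ultimately have *: "koszul_d lam (contr Y \<eta>) = \<omega>" by (intro ext) simp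
    have HY: "Y j (\<eta> S) \<in> H2 b" for j S unfolding Y_def by (intro H2_cmult[OF bpos] H)
    have ZY: "Y j (\<eta> S) = (\<lambda>_. 0)" if "card S \<noteq> p" for j S unfolding Y_def using Z[OF that] by simp
    note c = contr_forms[of Y \<eta> p, OF HY ZY]
    show "\<omega> \<in> koszul_ran b lam p"
    proof (cases "p = 0")
      case True
      then have "\<omega> = (\<lambda>_ _. 0)" using c(2) * by (auto simp: koszul_d_eq)
      then show ?thesis using True by (simp add: koszul_ran_def)
    next
      case False
      then show ?thesis using c(1) * by (auto simp: koszul_ran_def)
    qed
  qed
qed (rule koszul_ran_subset_ker)

lemma bounded_below_outside:
  fixes lam :: "complex^'n::finite"
  assumes R: "R_index b < norm lam"
  shows "\<exists>c>0. \<forall>f\<in>H2 b. c * H2_norm b f \<le> (\<Sum>i\<in>UNIV. H2_norm b (Mz_shift lam i f))"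
proof -
  obtain \<sigma> b' D where s: "\<sigma> < norm lam" and sp: "\<sigma> > 0"
    and b': "D > 0" "\<And>k. b k \<le> b' k" "\<And>k. b' k \<le> D * b k" "\<And>k. b' k > 0" "\<And>k. b' (Suc k) \<le> \<sigma> * b' k"
    by (rule outside_weights[OF R]) (rule that, assumption+)
  have b2: "1 * b k \<le> b' k" for k using b'(2)[of k] by simp
  note E = H2_equiv[of b b' 1 D, OF bpos b'(4) zero_less_one b'(1) b2 b'(3), unfolded mult_1]
  have eq: "h \<in> H2 b \<longleftrightarrow> h \<in> H2 b'" "h \<in> H2 b \<Longrightarrow> H2_norm b h \<le> H2_norm b' h" "h \<in> H2 b \<Longrightarrow> H2_norm b' h \<le> D * H2_norm b h" for h :: "'n fps_m"
    by (rule E, assumption?)+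
  have "(norm lam - \<sigma>) / D * H2_norm b f \<le> (\<Sum>i\<in>UNIV. H2_norm b (Mz_shift lam i f))" if f: "f \<in> H2 b" for f :: "'n fps_m"
  proof -
    define h where "h i = Mz_shift lam i f" for i
    have h: "h i \<in> H2 b" for i unfolding h_def by (rule H2_Mz_shift[of b f C, OF bpos f C(2)])
    have h': "h i \<in> H2 b'" for i using h eq by blast
    define e where "e k = (\<Sum>i\<in>UNIV. hnorm (h i) k)" for k
    have e: "sqsum (\<lambda>k. b' k * e k)" "l2norm (\<lambda>k. b' k * e k) \<le> (\<Sum>i\<in>UNIV. H2_norm b' (h i))"
      using sqsum_sum[of UNIV "\<lambda>i k. b' k * hnorm (h i) k"] h' by (auto simp: e_def sum_distrib_left H2_iff[OF b'(4)] H2_norm_eq[OF b'(4)])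
    have "l2norm (\<lambda>k. b' k * hnorm f k) \<le> l2norm (\<lambda>k. b' k * e k) / (norm lam - \<sigma>)"
      by (rule sqsum_decay_estimate(2)[OF _ _ b'(4) _ s b'(5) _ _ e(1)])
        (use sp hnorm_Mz_shift_ineq(2,3)[of lam f] in \<open>auto simp: e_def h_def intro: sum_nonneg\<close>)
    then have "(norm lam - \<sigma>) * H2_norm b' f \<le> (\<Sum>i\<in>UNIV. H2_norm b' (h i))"
      using e(2) s by (simp add: H2_norm_eq[OF b'(4)] field_simps)
    also have "\<dots> \<le> (\<Sum>i\<in>UNIV. D * H2_norm b (h i))" using eq(3) h by (intro sum_mono) auto
    also have "(norm lam - \<sigma>) * H2_norm b f \<le> (norm lam - \<sigma>) * H2_norm b' f" using eq(2)[OF f] s by (intro mult_left_mono) auto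
    finally show ?thesis using b'(1) by (simp add: h_def sum_distrib_left[symmetric] field_simps)
  qed
  then show ?thesis using s b'(1) by (intro exI[of _ "(norm lam - \<sigma>) / D"]) auto
qed

text \<open>\<open>q\<close> is a sequence so as to cover both the constant \<open>norm lam\<close>
  and the factors \<open>lower_bound\<close>, which only converge to it. \<open>K\<close> makes
  lowering the degree by one a bounded operation.\<close>

lemma inside_weights:
  fixes s :: real
  assumes "0 \<le> s" "s < i_index b" and q: "\<And>k. q k \<ge> 0" "q \<longlonglongrightarrow> s"
  obtains b' c \<theta> K where "c > 0" "\<And>k. c * b k \<le> b' k" "\<And>k. b' k \<le> b k" "\<And>k. b' k > 0"
    "0 < \<theta>" "\<theta> < 1" "\<And>k. q k * b' k \<le> \<theta> * b' (Suc k)" "K > 0" "\<And>k. b k \<le> K * b (Suc k)"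
proof -
  obtain \<sigma> where s: "s < \<sigma>" "\<sigma> < i_index b" using dense[OF assms(2)] by blast
  have sp: "\<sigma> > 0" using s assms by simp
  have a: "aincr (\<lambda>k. b k / \<sigma> ^ k)" by (rule i_index_characterization(3)[of b C, OF bpos C sp s(2)])
  then obtain D where D: "D > 0" "\<And>k n. k \<le> n \<Longrightarrow> b k / \<sigma> ^ k \<le> D * (b n / \<sigma> ^ n)" by (auto simp: aincr_def)
  have K: "b k \<le> (D / \<sigma>) * b (Suc k)" for k using D(2)[of k "Suc k"] sp by (simp add: field_simps)
  have K0: "D / \<sigma> > 0" using D(1) sp by simp
  show ?thesis
    by (rule growth_renorm[of b s \<sigma> q, OF bpos assms(1) s(1) a q]) (rule that[OF _ _ _ _ _ _ _ K0 K])
qed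

lemma bounded_below_inside:
  fixes lam :: "complex^'n::finite"
  assumes i: "norm lam < i_index b"
  shows "\<exists>c>0. \<forall>f\<in>H2 b. c * H2_norm b f \<le> (\<Sum>i\<in>UNIV. H2_norm b (Mz_shift lam i f))"
proof -
  obtain b' c \<theta> K where b': "c > 0" "\<And>k. c * b k \<le> b' k" "\<And>k. b' k \<le> b k" "\<And>k. b' k > 0"
    and th: "0 < \<theta>" "\<theta> < 1" "\<And>k. norm lam * b' k \<le> \<theta> * b' (Suc k)" and K: "K > 0" "\<And>k. b k \<le> K * b (Suc k)"
    by (rule inside_weights[OF norm_ge_zero i norm_ge_zero tendsto_const]) (rule that, assumption+)
  have b3: "b' k \<le> 1 * b k" for k using b'(3)[of k] by simp
  note E = H2_equiv[of b b' c 1, OF bpos b'(4) b'(1) zero_less_one b'(2) b3]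
  have eq: "h \<in> H2 b \<longleftrightarrow> h \<in> H2 b'" "h \<in> H2 b \<Longrightarrow> c * H2_norm b h \<le> H2_norm b' h" for h :: "'n fps_m"
    by (rule E, assumption?)+
  have "(1 - \<theta>) * c / K * H2_norm b f \<le> (\<Sum>i\<in>UNIV. H2_norm b (Mz_shift lam i f))" if f: "f \<in> H2 b" for f :: "'n fps_m"
  proof -
    define h where "h i = Mz_shift lam i f" for i
    have h: "h i \<in> H2 b" for i unfolding h_def by (rule H2_Mz_shift[of b f C, OF bpos f C(2)])
    define e where "e k = (\<Sum>i\<in>UNIV. hnorm (h i) k)" for k
    have e0: "e k \<ge> 0" for k by (auto simp: e_def intro: sum_nonneg)
    have e: "sqsum (\<lambda>k. b k * e k)" "l2norm (\<lambda>k. b k * e k) \<le> (\<Sum>i\<in>UNIV. H2_norm b (h i))"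
      using sqsum_sum[of UNIV "\<lambda>i k. b k * hnorm (h i) k"] h by (auto simp: e_def sum_distrib_left H2_iff[OF bpos] H2_norm_eq[OF bpos])
    note e1 = sqsum_Suc[OF e(1)]
    \<comment> \<open>The recursion charges the error of degree \<open>Suc k\<close> to degree
      \<open>k\<close>; the factor \<open>K\<close> pays for the change of weight.\<close>
    have "\<bar>b' k * e (Suc k)\<bar> \<le> K * \<bar>b (Suc k) * e (Suc k)\<bar>" for k
      using mult_right_mono[OF order_trans[OF b'(3) K(2)], of "e (Suc k)" k] e0[of "Suc k"] bpos[of "Suc k"] b'(4)[of k]
      by (simp add: abs_mult mult.assoc)
    note e2 = sqsum_le[OF e1(1) this less_imp_le[OF K(1)]]
    have "(1 - \<theta>) * l2norm (\<lambda>k. b' k * hnorm f k) \<le> l2norm (\<lambda>k. b' k * e (Suc k))"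
      by (rule sqsum_growth_estimate[OF _ b'(4) _ th(3) _ _ e2(1)])
        (use th f eq(1) hnorm_Mz_shift_ineq(1)[of f _ lam] in \<open>auto simp: e_def h_def H2_iff[OF b'(4), symmetric]\<close>)
    also have "\<dots> \<le> K * (\<Sum>i\<in>UNIV. H2_norm b (h i))"
      using e2(2) e1(2) e(2) K(1) by (meson less_imp_le mult_left_mono order_trans)
    finally have "(1 - \<theta>) * H2_norm b' f \<le> K * (\<Sum>i\<in>UNIV. H2_norm b (h i))" by (simp add: H2_norm_eq[OF b'(4)])
    moreover have "(1 - \<theta>) * (c * H2_norm b f) \<le> (1 - \<theta>) * H2_norm b' f" using eq(2)[OF f] th by (intro mult_left_mono) auto
    ultimately show ?thesis using K(1) by (simp add: h_def field_simps)
  qed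
  then show ?thesis using th b'(1) K(1) by (intro exI[of _ "(1 - \<theta>) * c / K"]) auto
qed

lemma approx_point_spec_subset:
  assumes "lam \<in> (approx_point_spec b :: (complex^'n::finite) set)"
  shows "i_index b \<le> norm lam" "norm lam \<le> R_index b"
proof -
  from assms obtain g :: "nat \<Rightarrow> 'n fps_m" where g: "\<And>n. g n \<in> H2 b" "\<And>n. H2_norm b (g n) = 1"
    and lim: "(\<lambda>n. \<Sum>i\<in>UNIV. H2_norm b (Mz_shift lam i (g n))) \<longlonglongrightarrow> 0"
    by (auto simp: approx_point_spec_def)
  have no: False if "\<exists>c>0. \<forall>f\<in>H2 b. c * H2_norm b f \<le> (\<Sum>i\<in>UNIV. H2_norm b (Mz_shift lam i f))"
  proof -
    from that obtain c where c: "c > 0" "\<And>f. f \<in> H2 b \<Longrightarrow> c * H2_norm b f \<le> (\<Sum>i\<in>UNIV. H2_norm b (Mz_shift lam i f))" by blast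
    have "c \<le> (\<Sum>i\<in>UNIV. H2_norm b (Mz_shift lam i (g n)))" for n using c(2)[OF g(1)[of n]] g(2)[of n] by simp
    then have "c \<le> 0" by (intro LIMSEQ_le_const[OF lim]) auto
    then show False using c(1) by simp
  qed
  show "i_index b \<le> norm lam" using no bounded_below_inside[of lam] by (meson not_le)
  show "norm lam \<le> R_index b" using no bounded_below_outside[of lam] by (meson not_le)
qed

end

section \<open>The Koszul complex inside the ball of radius i\<close>

lemma summable_pw:
  assumes "0 \<le> x" "x < 1" "m > 0" shows "summable (\<lambda>k. x ^ k / pw m k)"
proof -
  define c where "c = (1 + x) / 2"
  have c: "x < c" "c < 1" using assms by (auto simp: c_def)
  have "(\<lambda>k. x * ((real m + real k) / (real k + 1))) \<longlonglongrightarrow> x * 1"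
    by (intro tendsto_intros) real_asymp
  then have "\<forall>\<^sub>F k in sequentially. x * ((real m + real k) / (real k + 1)) < c"
    using c by (intro order_tendstoD(2)) auto
  then obtain N where N: "\<And>k. k \<ge> N \<Longrightarrow> x * ((real m + real k) / (real k + 1)) < c" by (auto simp: eventually_sequentially)
  show ?thesis
  proof (rule summable_ratio_test[of c N])
    fix k assume k: "N \<le> k"
    have p: "pw m (Suc k) = pw m k * (real k + 1) / (real m + real k)"
      using pw_Suc[OF assms(3), of k] assms(3) by (simp add: field_simps)
    have "x ^ Suc k / pw m (Suc k) = x * ((real m + real k) / (real k + 1)) * (x ^ k / pw m k)"
      using pw_pos[of m k] assms(3) unfolding p by (simp add: field_simps)
    also have "\<dots> \<le> c * (x ^ k / pw m k)" using N[OF k] assms(1) pw_pos[of m k] by (intro mult_right_mono) auto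
    finally show "norm (x ^ Suc k / pw m (Suc k)) \<le> c * norm (x ^ k / pw m k)"
      using assms(1) pw_pos[of m k] pw_pos[of m "Suc k"] by simp
  qed (use c in auto)
qed

section \<open>The Euler operator and its inversion\<close>

lemma Dz_linear: "Dz j (\<lambda>\<alpha>. \<Sum>k\<in>A. c k * F k \<alpha>) = (\<lambda>\<alpha>. \<Sum>k\<in>A. c k * Dz j (F k) \<alpha>)"
  by (simp add: Dz_def sum_distrib_left mult.left_commute)

lemma Dz_zero [simp]: "Dz j (\<lambda>_. 0) = (\<lambda>_. 0)"
  by (simp add: Dz_def)

lemma Dz_Mz: "Dz j (Mz i f) \<alpha> = Mz i (Dz j f) \<alpha> + (if i = j then f \<alpha> else 0)"
proof (cases \<alpha> i rule: inc_cases)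
  case 1
  then show ?thesis by (auto simp: Dz_def inc_apply)
next
  case (2 \<beta>)
  show ?thesis
  proof (cases "i = j")
    case True
    then show ?thesis using 2 by (simp add: Dz_def inc_apply algebra_simps)
  next
    case False
    then show ?thesis unfolding 2 Dz_def inc_commute[of j i] Mz_inc by (simp add: inc_apply)
  qed
qed

lemma Dz_Mz_shift: "Dz j (Mz_shift lam i f) \<alpha> = Mz_shift lam i (Dz j f) \<alpha> + (if i = j then 1 * f \<alpha> else 0)"
proof -
  have "Dz j (Mz_shift lam i f) \<alpha> = Dz j (Mz i f) \<alpha> - lam $ i * Dz j f \<alpha>"
    by (simp add: Dz_def Mz_shift_def algebra_simps)
  then show ?thesis by (simp add: Dz_Mz Mz_shift_def)
qed

lemma Euler: "(\<Sum>i\<in>UNIV. Mz i (Dz i f) \<alpha>) = of_nat (mdeg \<alpha>) * f \<alpha>"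
proof -
  have "Mz i (Dz i f) \<alpha> = of_nat (\<alpha> i) * f \<alpha>" for i
    by (cases \<alpha> i rule: inc_cases) (auto simp: Dz_def inc_apply)
  then show ?thesis by (simp add: mdeg_def sum_distrib_right)
qed

text \<open>The right-hand side of \<open>koszul_homotopy\<close> for derivatives; on forms of
  degree \<open>p\<close> the constant is \<open>c = m - p\<close>.\<close>

definition euler_op :: "complex^'n::finite \<Rightarrow> nat \<Rightarrow> 'n fps_m \<Rightarrow> 'n fps_m" where
  "euler_op lam c f = (\<lambda>\<alpha>. (\<Sum>i\<in>UNIV. Mz_shift lam i (Dz i f) \<alpha>) + of_nat c * f \<alpha>)"

lemma euler_op_eq: "euler_op lam c f \<alpha> = of_nat (mdeg \<alpha> + c) * f \<alpha> - (\<Sum>i\<in>UNIV. lam $ i * Dz i f \<alpha>)"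
  by (simp add: euler_op_def Mz_shift_def sum_subtractf Euler algebra_simps)

lemma euler_op_linear: "euler_op lam c (\<lambda>\<alpha>. \<Sum>k\<in>A. d k * F k \<alpha>) = (\<lambda>\<alpha>. \<Sum>k\<in>A. d k * euler_op lam c (F k) \<alpha>)"
proof
  fix \<alpha>
  have "euler_op lam c (\<lambda>\<alpha>. \<Sum>k\<in>A. d k * F k \<alpha>) \<alpha>
      = (\<Sum>k\<in>A. \<Sum>i\<in>UNIV. d k * Mz_shift lam i (Dz i (F k)) \<alpha>) + (\<Sum>k\<in>A. d k * (of_nat c * F k \<alpha>))"
    unfolding euler_op_def Dz_linear Mz_shift_linear
    by (subst sum.swap) (simp add: sum_distrib_left mult.left_commute)
  then show "euler_op lam c (\<lambda>\<alpha>. \<Sum>k\<in>A. d k * F k \<alpha>) \<alpha> = (\<Sum>k\<in>A. d k * euler_op lam c (F k) \<alpha>)"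
    by (simp add: euler_op_def distrib_left sum.distrib sum_distrib_left)
qed

text \<open>The commutator of \<open>Dz j\<close> with the shift contributes one extra copy of the
  shift. This matches the change of \<open>c = m - p\<close> when \<open>koszul_d\<close> raises
  \<open>p\<close>, so the Euler operators commute with the differential.\<close>

lemma euler_op_Mz_shift: "euler_op lam c (Mz_shift lam j f) = Mz_shift lam j (euler_op lam (Suc c) f)"
proof
  fix \<alpha>
  have D: "Dz i (Mz_shift lam j f) = (\<lambda>\<alpha>. Mz_shift lam j (Dz i f) \<alpha> + (if j = i then f \<alpha> else 0))" for i
    by (rule ext) (simp add: Dz_Mz_shift)
  have A: "Mz_shift lam i (\<lambda>\<alpha>. f \<alpha> + g \<alpha>) = (\<lambda>\<alpha>. Mz_shift lam i f \<alpha> + Mz_shift lam i g \<alpha>)" for i and f g :: "'a fps_m"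
    by (auto simp: Mz_shift_def Mz_def algebra_simps)
  have S: "Mz_shift lam j (\<lambda>\<alpha>. \<Sum>i\<in>UNIV. F i \<alpha>) = (\<lambda>\<alpha>. \<Sum>i\<in>UNIV. Mz_shift lam j (F i) \<alpha>)" for F :: "'a \<Rightarrow> 'a fps_m"
    using Mz_shift_linear[of lam j "\<lambda>_. 1" F UNIV] by simp
  have "(\<Sum>i\<in>UNIV. Mz_shift lam i (Dz i (Mz_shift lam j f)) \<alpha>)
     = (\<Sum>i\<in>UNIV. Mz_shift lam j (Mz_shift lam i (Dz i f)) \<alpha> + (if j = i then Mz_shift lam i f \<alpha> else 0))"
    unfolding D A Mz_shift_commute[of lam j] by (intro sum.cong refl) auto
  also have "\<dots> = (\<Sum>i\<in>UNIV. Mz_shift lam j (Mz_shift lam i (Dz i f)) \<alpha>) + Mz_shift lam j f \<alpha>"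
    by (simp add: sum.distrib)
  finally show "euler_op lam c (Mz_shift lam j f) \<alpha> = Mz_shift lam j (euler_op lam (Suc c) f) \<alpha>"
    unfolding euler_op_def A S Mz_shift_cmult by (simp add: algebra_simps)
qed

text \<open>Solving \<open>euler_op lam c \<eta> = \<omega>\<close> amounts to \<open>u = \<omega> + lower_op lam c u\<close> for
  \<open>u \<alpha> = (mdeg \<alpha> + c) * \<eta> \<alpha>\<close>, because \<open>\<Sum>\<^sub>i z\<^sub>i \<partial>\<^sub>i\<close> multiplies degree \<open>k\<close> by \<open>k\<close>.\<close>
definition lower_op :: "complex^'n::finite \<Rightarrow> nat \<Rightarrow> 'n fps_m \<Rightarrow> 'n fps_m" where
  "lower_op lam c u = (\<lambda>\<alpha>. (\<Sum>i\<in>UNIV. lam $ i * Dz i u \<alpha>) / of_nat (mdeg \<alpha> + 1 + c))"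

text \<open>The square root is the norm of the gradient from degree \<open>k + 1\<close> to
  \<open>k\<close>. The quotient tends to 1 but may exceed 1 in low degrees, so
  \<open>lower_op\<close> need not contract in the original norm.\<close>

definition lower_bound :: "real \<Rightarrow> nat \<Rightarrow> nat \<Rightarrow> nat \<Rightarrow> real" where
  "lower_bound s m c k = s * (sqrt ((m + k) * (k + 1)) / (k + 1 + c))"

lemma lower_bound_tendsto: "lower_bound s m c \<longlonglongrightarrow> s"
proof -
  have "(\<lambda>k. s * (sqrt ((real m + real k) * (real k + 1)) / (real k + 1 + real c))) \<longlonglongrightarrow> s * 1"
    by (intro tendsto_intros) real_asymp
  then show ?thesis by (simp add: lower_bound_def[abs_def] algebra_simps)
qed

lemma hnorm_lower_op:
  "hnorm (lower_op lam c u) k \<le> lower_bound (norm lam) CARD('n) c k * hnorm u (Suc k)" for lam :: "complex^'n::finite"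
proof -
  have "hnorm (lower_op lam c u) k = hnorm (\<lambda>\<alpha>. (1 / of_nat (k + 1 + c)) * (\<Sum>i\<in>UNIV. lam $ i * Dz i u \<alpha>)) k"
    by (rule hnorm_cong) (simp add: lower_op_def)
  also have "\<dots> = hnorm (\<lambda>\<alpha>. \<Sum>i\<in>UNIV. lam $ i * Dz i u \<alpha>) k / (k + 1 + c)"
    by (subst hnorm_cmult) (simp add: norm_divide del: of_nat_add of_nat_Suc)
  also have "\<dots> \<le> norm lam * (sqrt ((CARD('n) + k) * (k + 1)) * hnorm u (Suc k)) / (k + 1 + c)"
    using hnorm_lincomb[of "\<lambda>i. lam $ i" "\<lambda>i. Dz i u" k] by (intro divide_right_mono) (simp_all add: L2_cmod_vec L2_hnorm_Dz)
  finally show ?thesis by (simp add: lower_bound_def mult.assoc)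
qed

definition top_form :: "'n::finite set \<Rightarrow> 'n fps_m" where
  "top_form S = (\<lambda>\<alpha>. if S = UNIV \<and> \<alpha> = (\<lambda>_. 0) then 1 else 0)"

context
  fixes b :: "nat \<Rightarrow> real" and C :: real
  assumes bpos: "\<And>k. b k > 0" and C: "C > 0" "\<And>k. b (Suc k) \<le> C * b k"
begin

lemma H2_lower:
  assumes u: "u \<in> H2 b" and g: "\<And>k. hnorm g k \<le> A * hnorm u (Suc k)" and A: "A \<ge> 0" and K: "K > 0" "\<And>k. b k \<le> K * b (Suc k)"
  shows "g \<in> H2 b"
proof -
  have s: "sqsum (\<lambda>k. b (Suc k) * hnorm u (Suc k))"
    using sqsum_Suc(1)[of "\<lambda>k. b k * hnorm u k"] u by (simp add: H2_iff[OF bpos])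
  have "\<bar>b k * hnorm g k\<bar> \<le> (K * A) * \<bar>b (Suc k) * hnorm u (Suc k)\<bar>" for k
  proof -
    have "b k * hnorm g k \<le> (K * b (Suc k)) * (A * hnorm u (Suc k))"
      using K g bpos A by (intro mult_mono) (auto simp: less_imp_le)
    then show ?thesis using bpos[of k] bpos[of "Suc k"] by (simp add: abs_mult mult_ac)
  qed
  from sqsum_le(1)[OF s this] show ?thesis using K A by (simp add: H2_iff[OF bpos])
qed

lemma lower_op_solve:
  fixes lam :: "complex^'n::finite"
  assumes i: "norm lam < i_index b" and f: "f \<in> H2 b"
  shows "\<exists>u\<in>H2 b. \<forall>\<alpha>. u \<alpha> = f \<alpha> + lower_op lam c u \<alpha>"
proof -
  define q where "q = lower_bound (norm lam) CARD('n) c"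
  have q0: "q k \<ge> 0" for k by (simp add: q_def lower_bound_def)
  have qlim: "q \<longlonglongrightarrow> norm lam" unfolding q_def by (rule lower_bound_tendsto)
  obtain b' d \<theta> K where b': "d > 0" "\<And>k. d * b k \<le> b' k" "\<And>k. b' k \<le> b k" "\<And>k. b' k > 0"
    and th: "0 < \<theta>" "\<theta> < 1" "\<And>k. q k * b' k \<le> \<theta> * b' (Suc k)" and K: "K > 0" "\<And>k. b k \<le> K * b (Suc k)"
    by (rule inside_weights[of b C, OF bpos C norm_ge_zero i q0 qlim]) (rule that, assumption+)
  have b3: "b' k \<le> 1 * b k" for k using b'(3)[of k] by simp
  have eq: "h \<in> H2 b \<longleftrightarrow> h \<in> H2 b'" for h :: "'n fps_m"
    by (rule H2_equiv(1)[of b b' d 1, OF bpos b'(4) b'(1) zero_less_one b'(2) b3])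
  have step: "lower_op lam c v \<in> H2 b'" "H2_norm b' (lower_op lam c v) \<le> \<theta> * H2_norm b' v" if v: "v \<in> H2 b'" for v
  proof -
    have s: "sqsum (\<lambda>k. b' k * hnorm v k)" using v by (simp add: H2_iff[OF b'(4)])
    note s1 = sqsum_Suc[OF s]
    have "\<bar>b' k * hnorm (lower_op lam c v) k\<bar> \<le> \<theta> * \<bar>b' (Suc k) * hnorm v (Suc k)\<bar>" for k
    proof -
      have "b' k * hnorm (lower_op lam c v) k \<le> b' k * (q k * hnorm v (Suc k))"
        unfolding q_def using b'(4)[of k] by (intro mult_left_mono hnorm_lower_op) auto
      also have "\<dots> \<le> \<theta> * b' (Suc k) * hnorm v (Suc k)"
        using mult_right_mono[OF th(3)[of k], of "hnorm v (Suc k)"] by (simp add: mult_ac)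
      finally show ?thesis using b'(4)[of k] b'(4)[of "Suc k"] by (simp add: abs_mult mult.assoc)
    qed
    note s2 = sqsum_le[OF s1(1) this less_imp_le[OF th(1)]]
    show "lower_op lam c v \<in> H2 b'" using s2(1) by (simp add: H2_iff[OF b'(4)])
    show "H2_norm b' (lower_op lam c v) \<le> \<theta> * H2_norm b' v"
      using s2(2) mult_left_mono[OF s1(2) less_imp_le[OF th(1)]] by (simp add: H2_norm_eq[OF b'(4)])
  qed
  \<comment> \<open>Neumann series; in the norm of \<open>b'\<close> each application of
    \<open>lower_op\<close> gains the factor \<open>\<theta>\<close>.\<close>
  define u where "u n = (lower_op lam c ^^ n) f" for n
  have u: "u n \<in> H2 b' \<and> H2_norm b' (u n) \<le> H2_norm b' f * \<theta> ^ n" for n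
  proof (induction n)
    case 0 then show ?case using f eq by (simp add: u_def)
  next
    case (Suc n)
    have "u (Suc n) = lower_op lam c (u n)" by (simp add: u_def)
    then show ?case using step[of "u n"] Suc th(1) by (auto intro: order_trans[OF _ mult_left_mono] simp: mult_ac)
  qed
  define w where "w \<alpha> = (\<Sum>n. u n \<alpha>)" for \<alpha>
  have sm: "summable (\<lambda>n. u n \<alpha>)" for \<alpha>
    by (rule H2_suminf(1)[of b' u "H2_norm b' f" \<theta>, OF b'(4)]) (use u th in auto)
  have w: "w \<in> H2 b'" unfolding w_def
    by (rule H2_suminf(2)[of b' u "H2_norm b' f" \<theta>, OF b'(4)]) (use u th in auto)
  have "w \<alpha> = f \<alpha> + lower_op lam c w \<alpha>" for \<alpha>
  proof -
    have "w \<alpha> = u 0 \<alpha> + (\<Sum>n. u (Suc n) \<alpha>)" unfolding w_def using suminf_split_head[OF sm[of \<alpha>]] by simp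
    also have "(\<Sum>n. u (Suc n) \<alpha>) = (\<Sum>n. (\<Sum>i\<in>UNIV. lam $ i * (of_nat (Suc (\<alpha> i)) * u n (inc i \<alpha>))) / of_nat (mdeg \<alpha> + 1 + c))"
      by (simp add: u_def lower_op_def Dz_def)
    \<comment> \<open>A coefficient of \<open>lower_op\<close> involves finitely many coefficients
      of its argument, so it commutes with the coefficientwise sum.\<close>
    also have "\<dots> = lower_op lam c w \<alpha>"
      unfolding lower_op_def Dz_def w_def
      by (simp only: suminf_divide suminf_sum suminf_mult summable_mult summable_sum sm)
    finally show ?thesis by (simp add: u_def)
  qed
  then show ?thesis using w eq by blast
qed

lemma lower_op_unique:
  fixes lam :: "complex^'n::finite"
  assumes i: "norm lam < i_index b" and v: "v \<in> H2 b" "\<And>\<alpha>. v \<alpha> = lower_op lam c v \<alpha>"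
  shows "v = (\<lambda>_. 0)"
proof -
  define q where "q = lower_bound (norm lam) CARD('n) c"
  have q0: "q k \<ge> 0" for k by (simp add: q_def lower_bound_def)
  have qlim: "q \<longlonglongrightarrow> norm lam" unfolding q_def by (rule lower_bound_tendsto)
  obtain b' d \<theta> K where b': "d > 0" "\<And>k. d * b k \<le> b' k" "\<And>k. b' k \<le> b k" "\<And>k. b' k > 0"
    and th: "0 < \<theta>" "\<theta> < 1" "\<And>k. q k * b' k \<le> \<theta> * b' (Suc k)" and K: "K > 0" "\<And>k. b k \<le> K * b (Suc k)"
    by (rule inside_weights[of b C, OF bpos C norm_ge_zero i q0 qlim]) (rule that, assumption+)
  have b3: "b' k \<le> 1 * b k" for k using b'(3)[of k] by simp
  have eq: "h \<in> H2 b \<longleftrightarrow> h \<in> H2 b'" for h :: "'n fps_m"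
    by (rule H2_equiv(1)[of b b' d 1, OF bpos b'(4) b'(1) zero_less_one b'(2) b3])
  have vl: "v = lower_op lam c v" using v(2) by auto
  have rec: "hnorm v k \<le> q k * hnorm v (Suc k) + 0" for k
    using hnorm_lower_op[of lam c v k] by (subst vl) (simp add: q_def)
  have s: "sqsum (\<lambda>k. b' k * hnorm v k)" using v(1) eq by (simp add: H2_iff[OF b'(4), symmetric])
  have "(1 - \<theta>) * l2norm (\<lambda>k. b' k * hnorm v k) \<le> l2norm (\<lambda>k. b' k * 0)"
    by (rule sqsum_growth_estimate[OF hnorm_nonneg b'(4) less_imp_le[OF th(1)] th(3) rec s]) (simp add: sqsum_def)
  then have "l2norm (\<lambda>k. b' k * hnorm v k) \<le> 0" using th by (simp add: l2norm_def mult_le_0_iff)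
  then have "hnorm v k = 0" for k using l2norm_eq_0[OF s, of k] b'(4)[of k] by simp
  then show ?thesis by (auto simp: hnorm_eq_0)
qed

lemma H2_single: "(\<lambda>\<alpha>. if \<alpha> = \<beta> then c else 0) \<in> H2 b"
proof -
  have "hnorm (\<lambda>\<alpha>. if \<alpha> = \<beta> then c else 0) k = 0" if "k \<noteq> mdeg \<beta>" for k
    using that by (auto simp: hnorm_eq_0)
  then show ?thesis unfolding H2_iff[OF bpos] sqsum_def
    by (intro summable_finite[of "{mdeg \<beta>}"]) auto
qed

lemma top_form_ker: "top_form \<in> koszul_ker b (lam :: complex^'n::{finite,linorder}) CARD('n)"
proof -
  have "(top_form :: 'n set \<Rightarrow> _) \<in> forms b CARD('n)"
  proof -
    have H: "top_form S \<in> H2 b" for S :: "'n set"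
      using H2_single[of "\<lambda>_. 0" 1] H2_0[of b, OF bpos] by (cases "S = UNIV") (simp_all add: top_form_def)
    have "top_form S = (\<lambda>_. 0)" if "card S \<noteq> CARD('n)" for S :: "'n set"
      using that by (auto simp: top_form_def)
    with H show ?thesis by (simp add: forms_def)
  qed
  moreover have "koszul_d lam top_form S \<alpha> = 0" for S \<alpha>
  proof -
    have "S - {i} \<noteq> UNIV" for i by blast
    then have "top_form (S - {i}) = (\<lambda>_. 0)" for i by (simp add: top_form_def)
    then show ?thesis by (simp add: koszul_d_eq)
  qed
  ultimately show ?thesis by (auto simp: koszul_ker_def)
qed

text \<open>Solve the Euler equation for \<open>\<omega>\<close> and apply the homotopy to the
  solution \<open>\<eta>\<close>. The term with \<open>koszul_d lam \<eta>\<close> drops out: by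
  uniqueness that form has only constant coefficients, which the derivatives in
  \<open>contr Dz\<close> annihilate. The constant term in form degree \<open>m\<close> stays out of
  reach, whence the multiple of \<open>top_form\<close>.\<close>

lemma koszul_inside:
  fixes lam :: "complex^'n::{finite,linorder}"
  assumes i: "norm lam < i_index b" and w: "\<omega> \<in> koszul_ker b lam p"
  shows "\<exists>a. (p \<noteq> CARD('n) \<longrightarrow> a = 0) \<and> (\<lambda>S \<alpha>. \<omega> S \<alpha> - a * top_form S \<alpha>) \<in> koszul_ran b lam p"
proof (cases "p \<le> CARD('n)")
  case False
  have "card S \<noteq> p" for S :: "'n set" using False card_mono[of UNIV S] by auto
  then have "\<omega> = (\<lambda>_ _. 0)" using w by (auto simp: koszul_ker_def forms_def)
  moreover have "koszul_d lam (\<lambda>_ _. 0) = (\<lambda>_ _. 0)" by (auto simp: koszul_d_eq)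
  moreover have "(\<lambda>_ _. 0) \<in> forms b (p - 1)" using H2_0[OF bpos] by (simp add: forms_def)
  ultimately have "(\<lambda>S \<alpha>. \<omega> S \<alpha> - 0 * top_form S \<alpha>) \<in> koszul_ran b lam p"
    using False by (auto simp: koszul_ran_def intro!: rev_image_eqI)
  then show ?thesis by blast
next
  case True
  define c where "c = CARD('n) - p"
  have w1: "\<omega> S \<in> H2 b" "card S \<noteq> p \<Longrightarrow> \<omega> S = (\<lambda>_. 0)" for S using w by (auto simp: koszul_ker_def forms_def)
  have w2: "koszul_d lam \<omega> = (\<lambda>_ _. 0)" using w by (simp add: koszul_ker_def)
  obtain K where K: "K > 0" "\<And>k. b k \<le> K * b (Suc k)"
    by (rule inside_weights[of b C, OF bpos C norm_ge_zero i norm_ge_zero tendsto_const]) (rule that, assumption+)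
  have "\<exists>u. u \<in> H2 b \<and> (\<forall>\<alpha>. u \<alpha> = \<omega> S \<alpha> + lower_op lam c u \<alpha>) \<and> (card S \<noteq> p \<longrightarrow> u = (\<lambda>_. 0))" for S
  proof (cases "card S = p")
    case True
    then show ?thesis using lower_op_solve[OF i w1(1)[of S], of c] by blast
  next
    case False
    then show ?thesis using w1(2)[of S] H2_0[OF bpos] by (intro exI[of _ "\<lambda>_. 0"]) (auto simp: lower_op_def)
  qed
  then obtain u where u: "\<And>S. u S \<in> H2 b" "\<And>S \<alpha>. u S \<alpha> = \<omega> S \<alpha> + lower_op lam c (u S) \<alpha>" "\<And>S. card S \<noteq> p \<Longrightarrow> u S = (\<lambda>_. 0)"
    by metis
  \<comment> \<open>For \<open>c = 0\<close> and \<open>\<alpha> = 0\<close> the divisor is 0 and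
    the value 0 by convention; the lost constant term reappears as the defect in \<open>E\<close>
    and as \<open>a\<close> below.\<close>
  define \<eta> where "\<eta> S = (\<lambda>\<alpha>. u S \<alpha> / of_nat (mdeg \<alpha> + c))" for S
  have \<eta>0: "\<eta> S = (\<lambda>_. 0)" if "card S \<noteq> p" for S using u(3)[OF that] by (simp add: \<eta>_def)
  have D\<eta>: "Dz j (\<eta> S) \<alpha> = Dz j (u S) \<alpha> / of_nat (mdeg \<alpha> + 1 + c)" for j S \<alpha>
    by (simp add: Dz_def \<eta>_def)
  have E: "euler_op lam c (\<eta> S) \<alpha> = \<omega> S \<alpha> - (if mdeg \<alpha> + c = 0 then u S \<alpha> else 0)" for S \<alpha>
  proof -
    have "(\<Sum>i\<in>UNIV. lam $ i * Dz i (\<eta> S) \<alpha>) = lower_op lam c (u S) \<alpha>"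
      by (simp add: D\<eta> lower_op_def sum_divide_distrib)
    moreover have "of_nat (mdeg \<alpha> + c) * \<eta> S \<alpha> = (if mdeg \<alpha> + c = 0 then 0 else u S \<alpha>)"
      by (auto simp: \<eta>_def simp del: of_nat_add)
    ultimately show ?thesis using u(2)[of S \<alpha>] by (auto simp: euler_op_eq)
  qed
  have HD: "Dz j (\<eta> S) \<in> H2 b" for j S
  \<comment> \<open>A derivative costs a factor of the order of the degree, which the division in
    \<open>\<eta>\<close> provides; what is left is estimated crudely by
    \<open>CARD('n)\<close>.\<close>
  proof (rule H2_lower[OF u(1)[of S] _ _ K])
    show "hnorm (Dz j (\<eta> S)) k \<le> real CARD('n) * hnorm (u S) (Suc k)" for k
    proof -
      have "hnorm (Dz j (\<eta> S)) k = hnorm (\<lambda>\<alpha>. (1 / of_nat (k + 1 + c)) * Dz j (u S) \<alpha>) k"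
        by (rule hnorm_cong) (simp add: D\<eta>)
      also have "\<dots> = hnorm (Dz j (u S)) k / (k + 1 + c)"
        by (subst hnorm_cmult) (simp add: norm_divide del: of_nat_add of_nat_Suc)
      also have "\<dots> \<le> hnorm (Dz j (u S)) k / (k + 1)" by (intro divide_left_mono) auto
      finally have 1: "hnorm (Dz j (\<eta> S)) k \<le> hnorm (Dz j (u S)) k / (k + 1)" .
      have "CARD('n) \<ge> 1" using zero_less_card_finite[where 'a='n] by linarith
      then have "CARD('n) + k \<le> CARD('n) * (k + 1) * CARD('n)"
        by (metis add.commute add_mono distrib_left le_refl mult.right_neutral mult_le_mono nat_mult_1 order_trans)
      then have "(CARD('n) + k) * (k + 1) \<le> (CARD('n) * (k + 1) * CARD('n)) * (k + 1)" by (rule mult_right_mono) simp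
      then have "(CARD('n) + k) * (k + 1) \<le> (CARD('n) * (k + 1))\<^sup>2" by (simp add: power2_eq_square algebra_simps)
      then have "real ((CARD('n) + k) * (k + 1)) \<le> (real (CARD('n) * (k + 1)))\<^sup>2"
        unfolding of_nat_power[symmetric] by (simp only: of_nat_le_iff)
      then have 2: "sqrt ((CARD('n) + k) * (k + 1)) \<le> real (CARD('n) * (k + 1))"
        by (intro real_le_lsqrt) auto
      have "hnorm (Dz j (u S)) k \<le> sqrt ((CARD('n) + k) * (k + 1)) * hnorm (u S) (Suc k)"
        using member_le_L2_set[of UNIV j "\<lambda>j. hnorm (Dz j (u S)) k"] by (simp only: L2_hnorm_Dz) simp
      also have "\<dots> \<le> real (CARD('n) * (k + 1)) * hnorm (u S) (Suc k)" using 2 by (intro mult_right_mono) auto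
      finally have "hnorm (Dz j (u S)) k / (k + 1) \<le> (real (CARD('n) * (k + 1)) * hnorm (u S) (Suc k)) / (k + 1)"
        by (intro divide_right_mono) auto
      also have "\<dots> = real CARD('n) * hnorm (u S) (Suc k)" unfolding of_nat_mult by (simp add: field_simps)
      finally show ?thesis using 1 by linarith
    qed
  qed auto
  have \<xi>: "contr Dz (koszul_d lam \<eta>) S \<alpha> = 0" for S \<alpha>
  proof (cases c)
    case 0
    have "\<eta> (T - {j}) = (\<lambda>_. 0)" for T j
    proof (rule \<eta>0)
      have "card (T - {j}) < CARD('n)" by (rule psubset_card_mono) auto
      then show "card (T - {j}) \<noteq> p" using 0 True unfolding c_def by linarith
    qed
    then show ?thesis by (simp add: koszul_d_eq contr_def Dz_def)
  next
    case (Suc c')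
    define \<xi> where "\<xi> T = koszul_d lam \<eta> T" for T
    have e0: "euler_op lam c' (\<xi> T) \<alpha> = 0" for T \<alpha>
    proof -
      have "euler_op lam (Suc c') (\<eta> S) = \<omega> S" for S using E[of S] Suc by auto
      then have "euler_op lam c' (\<xi> T) = koszul_d lam \<omega> T"
        unfolding \<xi>_def koszul_d_eq euler_op_linear euler_op_Mz_shift by simp
      then show ?thesis using w2 by simp
    qed
    \<comment> \<open>Multiplied by \<open>mdeg \<alpha> + c'\<close>, the equation
      \<open>e0\<close> becomes a fixed point equation for \<open>lower_op\<close>, to which
      \<open>lower_op_unique\<close> applies.\<close>
    define v where "v T = (\<lambda>\<alpha>. of_nat (mdeg \<alpha> + c') * \<xi> T \<alpha>)" for T
    have v_low: "v T \<alpha> = lower_op lam c' (v T) \<alpha>" for T \<alpha>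
    proof -
      have "Dz i (v T) \<alpha> = of_nat (mdeg \<alpha> + 1 + c') * Dz i (\<xi> T) \<alpha>" for i
        by (simp add: v_def Dz_def mult_ac del: of_nat_Suc of_nat_add)
      then have "lower_op lam c' (v T) \<alpha> = (\<Sum>i\<in>UNIV. lam $ i * Dz i (\<xi> T) \<alpha>)"
        unfolding lower_op_def sum_divide_distrib by (intro sum.cong refl) (simp del: of_nat_add of_nat_Suc)
      then show ?thesis using e0[of T \<alpha>] by (simp add: euler_op_eq v_def)
    qed
    have v_H2: "v T \<in> H2 b" for T
    proof -
      \<comment> \<open>\<open>Mz j\<close> raises the degree by one and \<open>c = Suc c'\<close>,
        so the factor matches the divisor in \<open>\<eta>\<close> exactly.\<close>
      have 1: "(\<lambda>\<alpha>. of_nat (mdeg \<alpha> + c') * Mz j (\<eta> S) \<alpha>) = Mz j (u S)" for j S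
      proof
        fix \<alpha> show "of_nat (mdeg \<alpha> + c') * Mz j (\<eta> S) \<alpha> = Mz j (u S) \<alpha>"
          by (cases \<alpha> j rule: inc_cases) (auto simp: \<eta>_def Suc simp del: of_nat_add of_nat_Suc)
      qed
      have 2: "(\<lambda>\<alpha>. of_nat (mdeg \<alpha> + c') * \<eta> S \<alpha>) \<in> H2 b" for S
      proof (rule H2_mono(1)[of b "u S" _ 1, OF bpos u(1)])
        fix k
        have "hnorm (\<lambda>\<alpha>. of_nat (mdeg \<alpha> + c') * \<eta> S \<alpha>) k = hnorm (\<lambda>\<alpha>. (of_nat (k + c') / of_nat (k + c)) * u S \<alpha>) k"
          by (rule hnorm_cong) (simp add: \<eta>_def)
        also have "\<dots> = (of_nat (k + c') / of_nat (k + c)) * hnorm (u S) k"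
          by (subst hnorm_cmult) (simp add: norm_divide del: of_nat_add)
        also have "\<dots> \<le> 1 * hnorm (u S) k" by (intro mult_right_mono) (auto simp: Suc divide_le_eq_1)
        finally show "hnorm (\<lambda>\<alpha>. of_nat (mdeg \<alpha> + c') * \<eta> S \<alpha>) k \<le> 1 * hnorm (u S) k" .
      qed simp
      have "v T = (\<lambda>\<alpha>. \<Sum>j\<in>T. ksign T j * (of_nat (mdeg \<alpha> + c') * Mz j (\<eta> (T - {j})) \<alpha> - lam $ j * (of_nat (mdeg \<alpha> + c') * \<eta> (T - {j}) \<alpha>)))"
        by (rule ext) (simp add: v_def \<xi>_def koszul_d_eq Mz_shift_def sum_distrib_left algebra_simps)
      then show ?thesis
        by (simp only:) (intro H2_sum[OF bpos] H2_cmult[OF bpos] H2_diff(1)[OF bpos], simp_all only: 1 2 H2_cmult[OF bpos] H2_Mz[of b _ C, OF bpos u(1) C(2)])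
    qed
    have "v T = (\<lambda>_. 0)" for T by (rule lower_op_unique[OF i v_H2 v_low])
    \<comment> \<open>For \<open>c' = 0\<close> the constant term of \<open>\<xi>\<close> escapes,
      but \<open>Dz\<close> reads only coefficients at shifted indices.\<close>
    then have "\<xi> T (inc j \<alpha>) = 0" for T j \<alpha>
      unfolding v_def by (metis (mono_tags) add_eq_0_iff_both_eq_0 mdeg_inc mult_eq_0_iff nat.simps(3) of_nat_eq_0_iff)
    then show ?thesis by (simp add: contr_def Dz_def \<xi>_def)
  qed
  have hom: "koszul_d lam (contr Dz \<eta>) S \<alpha> = \<omega> S \<alpha> - (if mdeg \<alpha> + c = 0 then u S \<alpha> else 0)" for S \<alpha>
  proof -
    have "koszul_d lam (contr Dz \<eta>) S \<alpha> + contr Dz (koszul_d lam \<eta>) S \<alpha>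
        = (\<Sum>i\<in>UNIV. Mz_shift lam i (Dz i (\<eta> S)) \<alpha>) + 1 * of_nat (CARD('n) - card S) * \<eta> S \<alpha>"
      by (rule koszul_homotopy) (rule Dz_linear Dz_Mz_shift)+
    also have "\<dots> = euler_op lam c (\<eta> S) \<alpha>"
      by (cases "card S = p") (simp_all add: euler_op_def c_def \<eta>0)
    finally show ?thesis unfolding \<xi> E by simp
  qed
  note cf = contr_forms[of b C Dz \<eta> p, OF bpos C HD]
  define a where "a = (if c = 0 then u UNIV (\<lambda>_. 0) else 0)"
  have "(if mdeg \<alpha> + c = 0 then u S \<alpha> else 0) = a * top_form S \<alpha>" for S \<alpha>
  proof -
    have "u S = (\<lambda>_. 0)" if "c = 0" "S \<noteq> UNIV"
    proof (rule u(3))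
      have "card S < CARD('n)" using that(2) by (intro psubset_card_mono) auto
      then show "card S \<noteq> p" using that(1) True unfolding c_def by linarith
    qed
    then show ?thesis by (auto simp: a_def top_form_def mdeg_0_iff)
  qed
  then have *: "(\<lambda>S \<alpha>. \<omega> S \<alpha> - a * top_form S \<alpha>) = koszul_d lam (contr Dz \<eta>)" using hom by (intro ext) simp
  have D0: "Dz j (\<eta> S) = (\<lambda>_. 0)" if "card S \<noteq> p" for j S using \<eta>0[OF that] by simp
  have "(\<lambda>S \<alpha>. \<omega> S \<alpha> - a * top_form S \<alpha>) \<in> koszul_ran b lam p"
  proof (cases "p = 0")
    case True
    then show ?thesis unfolding * using cf(2)[OF D0 True] by (auto simp: koszul_ran_def koszul_d_eq)
  next
    case False
    then show ?thesis unfolding * using cf(1)[OF D0] by (auto simp: koszul_ran_def)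
  qed
  moreover have "p \<noteq> CARD('n) \<longrightarrow> a = 0" using True by (auto simp: a_def c_def)
  ultimately show ?thesis by blast
qed

text \<open>The room between \<open>s\<close> and \<open>\<rho>\<close> turns into a geometric
  factor \<open>x ^ k\<close>, which beats the polynomial growth of \<open>1 / pw\<close>; the two
  factors are separated by \<open>A * B \<le> A^2 + B^2\<close>.\<close>

lemma eval_summable:
  fixes f :: "'n::finite fps_m"
  assumes f: "f \<in> H2 b" and s: "0 \<le> s" "s < r_index b"
  shows "summable (\<lambda>k. hnorm f k * (s ^ k / sqrt (pw CARD('n) k)))"
proof -
  obtain \<rho> where r: "s < \<rho>" "\<rho> < r_index b" using dense[OF s(2)] by blast
  have rp: "\<rho> > 0" using r s by simp
  define x where "x = (s / \<rho>)\<^sup>2"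
  have x: "0 \<le> x" "x < 1" using r s rp by (auto simp: x_def power_less_one_iff abs_square_less_1)
  have sm: "summable (\<lambda>k. (b k * hnorm f k)\<^sup>2 + x ^ k / pw CARD('n) k)"
    using f summable_pw[OF x zero_less_card_finite[where 'a='n]] by (intro summable_add) (auto simp: H2_iff[OF bpos] sqsum_def)
  have "\<forall>\<^sub>F k in sequentially. norm (hnorm f k * (s ^ k / sqrt (pw CARD('n) k))) \<le> (b k * hnorm f k)\<^sup>2 + x ^ k / pw CARD('n) k"
    using less_r_index[of b C, OF bpos C rp r(2)]
  proof eventually_elim
    case (elim k)
    define A where "A = b k * hnorm f k"
    define B where "B = (s / \<rho>) ^ k / sqrt (pw CARD('n) k)"
    have AB: "0 \<le> A" "0 \<le> B" using bpos[of k] s rp pw_pos[of "CARD('n)" k] by (auto simp: A_def B_def)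
    have "hnorm f k * (s ^ k / sqrt (pw CARD('n) k)) = (\<rho> ^ k * hnorm f k) * B"
      using rp by (simp add: B_def power_divide)
    also have "\<dots> \<le> A * B" unfolding A_def using elim AB by (intro mult_right_mono) auto
    also have "\<dots> \<le> A\<^sup>2 + B\<^sup>2" using sum_squares_bound[of A B] AB mult_nonneg_nonneg[of A B] by linarith
    also have "B\<^sup>2 = ((s / \<rho>) ^ k)\<^sup>2 / pw CARD('n) k"
      unfolding B_def power_divide[of "(s / \<rho>) ^ k"] using pw_pos[of "CARD('n)" k] by simp
    also have "((s / \<rho>) ^ k)\<^sup>2 = x ^ k" by (simp add: x_def power_mult[symmetric] mult.commute)
    finally show ?case unfolding A_def using s pw_pos[of "CARD('n)" k] by simp
  qed
  then show ?thesis by (rule summable_comparison_test_ev[OF _ sm])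
qed

lemma norm_hom_part_le: "cmod (hom_part f k z) \<le> hnorm f k * (norm z ^ k / sqrt (pw CARD('n) k))" for z :: "complex^'n::finite"
  unfolding hom_part_def by (rule order_trans[OF norm_sum hom_part_abs_le])

lemma hom_part_Mz: "hom_part (Mz i f) (Suc k) z = z $ i * hom_part f k z" "hom_part (Mz i f) 0 z = 0"
proof -
  have "hom_part (Mz i f) (Suc k) z = (\<Sum>\<alpha>\<in>{\<alpha>. mdeg \<alpha> = Suc k}. if \<alpha> i = 0 then 0 else Mz i f \<alpha> * monom \<alpha> z)"
    unfolding hom_part_def by (intro sum.cong) auto
  then show "hom_part (Mz i f) (Suc k) z = z $ i * hom_part f k z"
    by (simp only: sum_inc Mz_inc monom_inc) (simp add: hom_part_def sum_distrib_left mult.left_commute)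
  show "hom_part (Mz i f) 0 z = 0" by (simp add: hom_part_def mdeg_0_iff)
qed

text \<open>A boundary vanishes when evaluated at \<open>lam\<close>, whereas
  \<open>top_form\<close> has the value 1. Evaluated degree by degree, consecutive
  \<open>A k\<close> agree, so \<open>A\<close> stays at \<open>-1\<close>, yet it tends to 0 by
  convergence inside radius \<open>r\<close>.\<close>

lemma top_form_not_ran:
  fixes lam :: "complex^'n::{finite,linorder}"
  assumes i: "norm lam < r_index b"
  shows "top_form \<notin> koszul_ran b lam CARD('n)"
proof
  assume "top_form \<in> koszul_ran b lam CARD('n)"
  then obtain \<zeta> where z: "\<zeta> \<in> forms b (CARD('n) - 1)" "top_form = koszul_d lam \<zeta>"
    by (auto simp: koszul_ran_def split: if_splits)
  define F where "F i = \<zeta> (UNIV - {i})" for i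
  have F: "F i \<in> H2 b" for i using z by (simp add: F_def forms_def)
  define A where "A k = (\<Sum>i\<in>UNIV. ksign UNIV i * (lam $ i * hom_part (F i) k lam))" for k
  have eq: "hom_part (top_form (UNIV :: 'n set)) k lam = (\<Sum>i\<in>UNIV. ksign UNIV i * (hom_part (Mz i (F i)) k lam - lam $ i * hom_part (F i) k lam))" for k
  proof -
    have "top_form (UNIV :: 'n set) = (\<lambda>\<alpha>. \<Sum>i\<in>UNIV. ksign UNIV i * Mz_shift lam i (F i) \<alpha>)"
      unfolding z(2) koszul_d_eq F_def ..
    then have "hom_part (top_form (UNIV :: 'n set)) k lam = (\<Sum>i\<in>UNIV. ksign UNIV i * hom_part (Mz_shift lam i (F i)) k lam)"
      by (simp add: hom_part_def sum_distrib_left sum_distrib_right mult.assoc) (rule sum.swap)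
    also have "\<dots> = (\<Sum>i\<in>UNIV. ksign UNIV i * (hom_part (Mz i (F i)) k lam - lam $ i * hom_part (F i) k lam))"
      by (simp add: hom_part_def Mz_shift_def left_diff_distrib sum_subtractf sum_distrib_left mult.assoc)
    finally show ?thesis .
  qed
  have A0: "A 0 = -1"
  proof -
    have "hom_part (top_form (UNIV :: 'n set)) 0 lam = 1" by (simp add: hom_part_def mdeg_0_iff top_form_def monom_def)
    then have "- A 0 = 1" using eq[of 0] by (simp add: hom_part_Mz A_def sum_negf)
    then show ?thesis by (metis minus_minus)
  qed
  have A_Suc: "A (Suc k) = A k" for k
  proof -
    have "hom_part (top_form (UNIV :: 'n set)) (Suc k) lam = 0" by (auto simp: hom_part_def top_form_def intro!: sum.neutral)
    then show ?thesis using eq[of "Suc k"] by (simp add: hom_part_Mz A_def right_diff_distrib sum_subtractf)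
  qed
  have Ac: "A k = -1" for k by (induction k) (simp_all add: A0 A_Suc)
  have "A \<longlonglongrightarrow> (\<Sum>i\<in>UNIV. ksign UNIV i * (lam $ i * 0))" unfolding A_def
  proof (intro tendsto_intros)
    fix j
    show "(\<lambda>k. hom_part (F j) k lam) \<longlonglongrightarrow> 0"
      by (rule Lim_null_comparison[OF always_eventually summable_LIMSEQ_zero[OF eval_summable[OF F norm_ge_zero i]]])
        (use norm_hom_part_le in auto)
  qed
  moreover have "A = (\<lambda>_. -1)" using Ac by auto
  ultimately have "(\<lambda>k. -1 :: complex) \<longlonglongrightarrow> 0" by simp
  then show False by (simp add: LIMSEQ_const_iff)
qed

end

section \<open>Approximate eigenvectors on the shell\<close>

text \<open>If endpoints dominate all interval sums, sums and terms become comparable: for a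
  summable sequence the tails, which then shrink by a fixed factor at each step; otherwise the sums
  starting at \<open>N\<close>, which then grow by a fixed factor.\<close>

lemma interval_sum_dichotomy:
  fixes Y :: "nat \<Rightarrow> real"
  assumes Y: "\<And>k. Y k > 0" and D: "D > 1" and bd: "\<And>p q. N \<le> p \<Longrightarrow> p \<le> q \<Longrightarrow> (\<Sum>k=p..q. Y k) \<le> D * (Y p + Y q)"
  shows "(\<exists>\<theta> E. 0 < \<theta> \<and> \<theta> < 1 \<and> (\<forall>k\<ge>N. \<forall>j. Y (k + j) \<le> E * \<theta> ^ j * Y k)) \<or>
    (\<exists>\<theta> E K. 1 < \<theta> \<and> E > 0 \<and> (\<forall>k\<ge>K. \<forall>j. \<theta> ^ j * Y k \<le> E * Y (k + j)))"
proof (cases "summable Y")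
  case True
  define T where "T p = (\<Sum>k. Y (p + k))" for p
  have sm: "summable (\<lambda>k. Y (p + k))" for p using summable_ignore_initial_segment[OF True, of p] by (simp add: add.commute)
  have T1: "Y p \<le> T p" for p
    unfolding T_def using sum_le_suminf[OF sm[of p], of "{0}"] Y by (simp add: less_imp_le)
  have T2: "T p \<le> D * Y p" if "N \<le> p" for p
  proof -
    have "(\<lambda>q. \<Sum>k=p..p+q. Y k) = (\<lambda>q. \<Sum>k\<le>q. Y (p + k))"
    proof
      fix q show "(\<Sum>k=p..p+q. Y k) = (\<Sum>k\<le>q. Y (p + k))"
        using sum.shift_bounds_cl_nat_ivl[of Y 0 p q] by (simp add: atMost_atLeast0 add.commute)
    qed
    moreover have "(\<lambda>q. \<Sum>k\<le>q. Y (p + k)) \<longlonglongrightarrow> T p" unfolding T_def by (rule summable_LIMSEQ'[OF sm])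
    ultimately have 1: "(\<lambda>q. \<Sum>k=p..p+q. Y k) \<longlonglongrightarrow> T p" by simp
    have 2: "(\<lambda>q. D * (Y p + Y (p + q))) \<longlonglongrightarrow> D * (Y p + 0)"
      by (intro tendsto_intros summable_LIMSEQ_zero[OF sm])
    show ?thesis using LIMSEQ_le[OF 1 2] bd[OF that] by auto
  qed
  have T3: "T p = Y p + T (Suc p)" for p
    unfolding T_def using suminf_split_head[OF sm[of p]] by simp
  \<comment> \<open>From \<open>T2\<close> and \<open>T3\<close>: passing to the next tail removes
    \<open>Y p\<close>, at least the share \<open>1 / D\<close> of \<open>T p\<close>.\<close>
  define \<theta> where "\<theta> = 1 - 1 / D"
  have \<theta>: "0 < \<theta>" "\<theta> < 1" using D by (auto simp: \<theta>_def)
  have T4: "T (Suc p) \<le> \<theta> * T p" if "N \<le> p" for p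
    using T2[OF that] T3[of p] D by (simp add: \<theta>_def field_simps)
  have T5: "T (p + j) \<le> \<theta> ^ j * T p" if "N \<le> p" for p j
  proof (induction j)
    case (Suc j)
    have "T (p + Suc j) \<le> \<theta> * T (p + j)" using T4[of "p + j"] that by simp
    also have "\<dots> \<le> \<theta> * (\<theta> ^ j * T p)" using Suc \<theta> by (intro mult_left_mono) auto
    finally show ?case by simp
  qed simp
  have "Y (k + j) \<le> D * \<theta> ^ j * Y k" if "N \<le> k" for k j
  proof -
    have "Y (k + j) \<le> \<theta> ^ j * T k" using T1[of "k + j"] T5[OF that, of j] by linarith
    also have "\<dots> \<le> \<theta> ^ j * (D * Y k)" using T2[OF that] \<theta> by (intro mult_left_mono) auto
    finally show ?thesis by (simp add: mult_ac)
  qed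
  then show ?thesis using \<theta> by blast
next
  case False
  define A where "A q = (\<Sum>k=N..q. Y k)" for q
  \<comment> \<open>Beyond this size the left endpoint accounts for at most half of the sum, so the
    right endpoint alone controls it.\<close>
  have "\<exists>q0\<ge>N. 2 * D * Y N \<le> A q0"
  proof (rule ccontr)
    assume "\<not> ?thesis"
    then have le: "A q \<le> 2 * D * Y N" if "q \<ge> N" for q using that linorder_le_cases by blast
    have "(\<Sum>k<n. Y (k + N)) \<le> 2 * D * Y N" for n
    proof (cases n)
      case (Suc m)
      have "(\<Sum>k<n. Y (k + N)) = A (m + N)"
        unfolding A_def Suc lessThan_Suc_atMost atMost_atLeast0 using sum.shift_bounds_cl_nat_ivl[of Y 0 N m] by simp
      then show ?thesis using le[of "m + N"] by simp
    qed (use D Y[of N] in simp)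
    then have "summable (\<lambda>k. Y (k + N))" using Y by (intro summableI_nonneg_bounded[of _ "2 * D * Y N"]) (auto simp: less_imp_le)
    then show False using False by (simp add: summable_iff_shift)
  qed
  then obtain q0 where q0: "q0 \<ge> N" "2 * D * Y N \<le> A q0" by blast
  have AY: "A q \<le> 2 * D * Y q" if "q \<ge> q0" for q
  proof -
    have "A q0 \<le> A q" unfolding A_def using that Y by (intro sum_mono2) (auto simp: less_imp_le)
    moreover have "A q \<le> D * (Y N + Y q)" using bd[of N q] q0 that by (simp add: A_def)
    ultimately show ?thesis using q0 D by (simp add: distrib_left)
  qed
  have AS: "A (Suc q) = A q + Y (Suc q)" if "q \<ge> N" for q using that by (simp add: A_def)
  have Ap: "A q \<ge> Y q" if "q \<ge> N" for q
    unfolding A_def using that Y by (intro member_le_sum) (auto simp: less_imp_le)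
  define \<theta> where "\<theta> = 2 * D / (2 * D - 1)"
  have \<theta>: "1 < \<theta>" using D by (simp add: \<theta>_def)
  have A1: "\<theta> * A q \<le> A (Suc q)" if "q \<ge> q0" for q
  proof -
    have "A (Suc q) \<le> 2 * D * (A (Suc q) - A q)" using AY[of "Suc q"] AS[of q] that q0 by simp
    then show ?thesis using D by (simp add: \<theta>_def field_simps)
  qed
  have A2: "\<theta> ^ j * A q \<le> A (q + j)" if "q \<ge> q0" for q j
  proof (induction j)
    case (Suc j)
    have "\<theta> * (\<theta> ^ j * A q) \<le> \<theta> * A (q + j)" using Suc \<theta> by (intro mult_left_mono) auto
    also have "\<dots> \<le> A (q + Suc j)" using A1[of "q + j"] that by simp
    finally show ?case by simp
  qed simp
  have "\<theta> ^ j * Y k \<le> 2 * D * Y (k + j)" if "k \<ge> q0" for k j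
  proof -
    have "\<theta> ^ j * Y k \<le> \<theta> ^ j * A k" using Ap[of k] q0 that \<theta> by (intro mult_left_mono) auto
    also have "\<dots> \<le> A (k + j)" using A2 that by simp
    also have "\<dots> \<le> 2 * D * Y (k + j)" using AY that by simp
    finally show ?thesis .
  qed
  then show ?thesis using \<theta> D by (intro disjI2 exI[of _ \<theta>] exI[of _ "2 * D"] exI[of _ q0]) auto
qed

text \<open>\<open>1 / pw m k\<close> is a binomial coefficient, polynomial in \<open>k\<close>, so
  any geometric factor below 1 wins eventually. This removes \<open>pw\<close> from the decay case
  of \<open>exists_window\<close>.\<close>

lemma pw_geometric_adecr:
  assumes "0 < x" "x < 1" "m > 0" shows "adecr (\<lambda>k. x ^ k / pw m k)"
proof -
  have "(\<lambda>k. x * ((real m + real k) / (real k + 1))) \<longlonglongrightarrow> x * 1"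
    by (intro tendsto_intros) real_asymp
  then have "\<forall>\<^sub>F k in sequentially. x * ((real m + real k) / (real k + 1)) < 1"
    using assms by (intro order_tendstoD(2)) auto
  then obtain N where N: "\<And>k. k \<ge> N \<Longrightarrow> x * ((real m + real k) / (real k + 1)) < 1" by (auto simp: eventually_sequentially)
  define w where "w k = x ^ k / pw m k" for k
  have wpos: "w k > 0" for k using assms pw_pos by (simp add: w_def)
  have step: "w (Suc k) \<le> w k" if "N \<le> k" for k
  proof -
    have p: "pw m (Suc k) = pw m k * (real k + 1) / (real m + real k)"
      using pw_Suc[OF assms(3), of k] assms(3) by (simp add: field_simps)
    have "w (Suc k) = x * ((real m + real k) / (real k + 1)) * w k"
      using pw_pos[of m k] assms(3) unfolding p w_def by (simp add: field_simps)
    also have "\<dots> \<le> 1 * w k" using N[OF that] wpos[of k] by (intro mult_right_mono) auto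
    finally show ?thesis by simp
  qed
  have "w n \<le> 1 * w k" if "N \<le> k" "k \<le> n" for k n
    using that(2)
  proof (induction n rule: dec_induct)
    case (step n)
    then show ?case using \<open>\<And>p. N \<le> p \<Longrightarrow> w (Suc p) \<le> w p\<close>[of n] that(1) by simp
  qed simp
  then have "adecr w" using adecr_tail[of w N 1] wpos by blast
  then show ?thesis by (simp add: w_def[abs_def])
qed

lemma pw_decreasing:
  assumes m: "m > 0" and "k \<le> n" shows "pw m n \<le> pw m k"
  using assms(2)
proof (induction n rule: dec_induct)
  case (step n)
  have "pw m (Suc n) * (m + n) \<le> pw m n * (m + n)"
    using pw_Suc[OF m, of n] pw_pos[of m n] m by (simp add: mult_left_mono)
  then have "pw m (Suc n) \<le> pw m n" using m by (simp add: mult_le_cancel_right)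
  then show ?case using step by simp
qed simp

text \<open>Expansion of \<open>\<Sum>\<^sub>k (\<langle>z, lam\<rangle> / \<bar>lam\<bar>\<^sup>2) ^ k\<close>. Multiplication by \<open>\<langle>z, lam\<rangle> / \<bar>lam\<bar>\<^sup>2\<close> shifts this
  series, so only the components of \<open>z\<close> orthogonal to \<open>lam\<close> contribute to the eigenvector equation in the inner degrees.\<close>
definition kernel_series :: "complex^'n::finite \<Rightarrow> 'n fps_m" where
  "kernel_series lam = (\<lambda>\<alpha>. of_real (fact (mdeg \<alpha>) / (\<Prod>i\<in>UNIV. fact (\<alpha> i)) / norm lam ^ (2 * mdeg \<alpha>)) * cnj (monom \<alpha> lam))"

lemma hom_norm2_kernel_series:
  fixes lam :: "complex^'n::finite"
  assumes "lam \<noteq> 0"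
  shows "hom_norm2 (kernel_series lam) k = pw CARD('n) k / norm lam ^ (2 * k)"
proof -
  have n: "norm lam > 0" using assms by simp
  have "hom_norm2 (kernel_series lam) k = (\<Sum>\<alpha>\<in>{\<alpha>. mdeg \<alpha> = k}. (pw CARD('n) k * fact k / norm lam ^ (4 * k)) *
      ((\<Prod>i\<in>UNIV. ((cmod (lam $ i))\<^sup>2) ^ \<alpha> i) / (\<Prod>i\<in>UNIV. fact (\<alpha> i))))"
    unfolding hom_norm2_eq
  proof (intro sum.cong refl)
    fix \<alpha> :: "'n mindex" assume "\<alpha> \<in> {\<alpha>. mdeg \<alpha> = k}"
    then have k: "mdeg \<alpha> = k" by simp
    define P :: real where "P = (\<Prod>i\<in>UNIV. fact (\<alpha> i))"
    have P: "P > 0" by (simp add: P_def prod_pos)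
    have mono: "(cmod (monom \<alpha> lam))\<^sup>2 = (\<Prod>i\<in>UNIV. ((cmod (lam $ i))\<^sup>2) ^ \<alpha> i)"
      by (simp add: norm_monom prod_power_distrib mult.commute flip: power_mult)
    have "(cmod (kernel_series lam \<alpha>))\<^sup>2 = (fact k / P / norm lam ^ (2 * k))\<^sup>2 * (cmod (monom \<alpha> lam))\<^sup>2"
      unfolding kernel_series_def k P_def[symmetric] norm_mult norm_of_real complex_mod_cnj power_mult_distrib power2_abs ..
    also have "(fact k / P / norm lam ^ (2 * k))\<^sup>2 = fact k * fact k / (P * P) / norm lam ^ (4 * k)"
      by (simp add: power2_eq_square flip: power_add)
    finally show "cw \<alpha> * (cmod (kernel_series lam \<alpha>))\<^sup>2 = (pw CARD('n) k * fact k / norm lam ^ (4 * k)) *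
      ((\<Prod>i\<in>UNIV. ((cmod (lam $ i))\<^sup>2) ^ \<alpha> i) / (\<Prod>i\<in>UNIV. fact (\<alpha> i)))"
      unfolding mono cw_def pw_def P_def[symmetric] k using P by (simp add: field_simps)
  qed
  also have "\<dots> = (pw CARD('n) k * fact k / norm lam ^ (4 * k)) * ((norm lam)\<^sup>2 ^ k / fact k)"
    unfolding sum_distrib_left[symmetric] multinomial norm_vec_sq ..
  also have "\<dots> = pw CARD('n) k / norm lam ^ (2 * k)"
  proof -
    have "norm lam ^ (4 * k) = norm lam ^ (2 * k) * norm lam ^ (2 * k)" by (simp flip: power_add)
    then show ?thesis using n by (simp add: power_mult[symmetric])
  qed
  finally show ?thesis .
qed

text \<open>Summed over \<open>i\<close> this is the shift property of the series; the version for a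
  single \<open>i\<close> supplies the mixed term in the square of the error.\<close>

lemma kernel_series_Mz:
  assumes "lam \<noteq> 0"
  shows "cnj (lam $ i) * Mz i (kernel_series lam) \<alpha> * of_nat (mdeg \<alpha>) = of_nat (\<alpha> i) * of_real ((norm lam)\<^sup>2) * kernel_series lam \<alpha>"
proof (cases \<alpha> i rule: inc_cases)
  case (2 \<beta>)
  define P :: real where "P = (\<Prod>i\<in>UNIV. fact (\<beta> i))"
  have P: "P > 0" by (simp add: P_def prod_pos)
  have n: "norm lam > 0" using assms by simp
  have r: "(real (\<beta> i) + 1) * (norm lam)\<^sup>2 * (fact (Suc (mdeg \<beta>)) / ((real (\<beta> i) + 1) * P) / norm lam ^ (2 * Suc (mdeg \<beta>)))
      = (fact (mdeg \<beta>) / P / norm lam ^ (2 * mdeg \<beta>)) * real (Suc (mdeg \<beta>))"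
  proof -
    have "norm lam ^ (2 * Suc (mdeg \<beta>)) = (norm lam)\<^sup>2 * norm lam ^ (2 * mdeg \<beta>)"
      unfolding power_add[symmetric] by simp
    moreover have "real (\<beta> i) + 1 \<noteq> 0" by linarith
    ultimately show ?thesis using P n by (simp only: fact_Suc) (simp del: of_nat_Suc)
  qed
  have "of_nat (\<alpha> i) * of_real ((norm lam)\<^sup>2) * kernel_series lam \<alpha> =
     of_real ((real (\<beta> i) + 1) * (norm lam)\<^sup>2 * (fact (Suc (mdeg \<beta>)) / ((real (\<beta> i) + 1) * P) / norm lam ^ (2 * Suc (mdeg \<beta>)))) * (cnj (lam $ i) * cnj (monom \<beta> lam))"
    unfolding 2 kernel_series_def prod_fact_inc P_def[symmetric] mdeg_inc monom_inc
    using of_nat_neq_0[of "\<beta> i", where 'a=complex] by (simp add: inc_apply add.commute)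
  also have "\<dots> = cnj (lam $ i) * Mz i (kernel_series lam) \<alpha> * of_nat (mdeg \<alpha>)"
    unfolding r unfolding 2 Mz_inc mdeg_inc kernel_series_def P_def[symmetric] by (simp add: mult_ac)
  finally show ?thesis by simp
qed auto

text \<open>Summed over \<open>i\<close>, the mixed terms are twice the second square, so the error
  is a difference of two squared norms. It is small because
  \<open>pw m (k + 1) / pw m k = (k + 1) / (m + k)\<close> tends to 1.\<close>

lemma sum_hom_norm2_kernel_error:
  fixes lam :: "complex^'n::finite"
  assumes "lam \<noteq> 0"
  shows "(\<Sum>i\<in>UNIV. hom_norm2 (Mz_shift lam i (kernel_series lam)) (Suc k))
     = pw CARD('n) k / norm lam ^ (2 * k) * ((CARD('n) - 1) / (CARD('n) + k))"
proof -
  let ?A = "kernel_series lam"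
  have n: "norm lam > 0" using assms by simp
  have pt: "(\<Sum>i\<in>UNIV. (cmod (Mz_shift lam i ?A \<alpha>))\<^sup>2) = (\<Sum>i\<in>UNIV. (cmod (Mz i ?A \<alpha>))\<^sup>2) - (norm lam)\<^sup>2 * (cmod (?A \<alpha>))\<^sup>2"
    if k: "mdeg \<alpha> = Suc k" for \<alpha>
  proof -
    have "(cmod (Mz_shift lam i ?A \<alpha>))\<^sup>2 = (cmod (Mz i ?A \<alpha>))\<^sup>2 + (cmod (lam $ i))\<^sup>2 * (cmod (?A \<alpha>))\<^sup>2
        - 2 * (real (\<alpha> i) / real (Suc k) * ((norm lam)\<^sup>2 * (cmod (?A \<alpha>))\<^sup>2))" for i
    proof -
      have "cnj (lam $ i) * Mz i ?A \<alpha> = of_real (real (\<alpha> i) / real (Suc k) * (norm lam)\<^sup>2) * ?A \<alpha>"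
        using kernel_series_Mz[OF assms, of i \<alpha>] by (simp add: k field_simps del: of_nat_Suc)
      moreover have "Mz i ?A \<alpha> * cnj (lam $ i * ?A \<alpha>) = (cnj (lam $ i) * Mz i ?A \<alpha>) * cnj (?A \<alpha>)"
        by (simp only: complex_cnj_mult mult_ac)
      ultimately have "Mz i ?A \<alpha> * cnj (lam $ i * ?A \<alpha>) = of_real (real (\<alpha> i) / real (Suc k) * (norm lam)\<^sup>2) * (?A \<alpha> * cnj (?A \<alpha>))"
        by (simp only: mult.assoc)
      also have "\<dots> = of_real (real (\<alpha> i) / real (Suc k) * ((norm lam)\<^sup>2 * (cmod (?A \<alpha>))\<^sup>2))"
        unfolding complex_norm_square[symmetric] by simp
      finally have re: "Re (Mz i ?A \<alpha> * cnj (lam $ i * ?A \<alpha>)) = real (\<alpha> i) / real (Suc k) * ((norm lam)\<^sup>2 * (cmod (?A \<alpha>))\<^sup>2)"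
        by (simp only: Re_complex_of_real)
      have sq: "(cmod (x - y))\<^sup>2 = (cmod x)\<^sup>2 + (cmod y)\<^sup>2 - 2 * Re (x * cnj y)" for x y
        unfolding cmod_power2 by (simp add: power2_eq_square algebra_simps)
      show ?thesis unfolding Mz_shift_def sq re norm_mult power_mult_distrib ..
    qed
    then have "(\<Sum>i\<in>UNIV. (cmod (Mz_shift lam i ?A \<alpha>))\<^sup>2) = (\<Sum>i\<in>UNIV. (cmod (Mz i ?A \<alpha>))\<^sup>2) + (norm lam)\<^sup>2 * (cmod (?A \<alpha>))\<^sup>2
        - 2 * ((\<Sum>i\<in>UNIV. real (\<alpha> i)) / real (Suc k) * ((norm lam)\<^sup>2 * (cmod (?A \<alpha>))\<^sup>2))"
      unfolding norm_vec_sq[of lam]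
      by (simp add: sum.distrib sum_subtractf sum_distrib_left[symmetric] sum_distrib_right[symmetric] sum_divide_distrib[symmetric] del: of_nat_Suc)
    also have "(\<Sum>i\<in>UNIV. real (\<alpha> i)) = real (Suc k)" using k unfolding of_nat_sum[symmetric] by (simp add: mdeg_def)
    finally show ?thesis by (simp del: of_nat_Suc)
  qed
  have "(\<Sum>i\<in>UNIV. hom_norm2 (Mz_shift lam i ?A) (Suc k)) = (\<Sum>\<alpha>\<in>{\<alpha>. mdeg \<alpha> = Suc k}. cw \<alpha> * (\<Sum>i\<in>UNIV. (cmod (Mz_shift lam i ?A \<alpha>))\<^sup>2))"
    unfolding hom_norm2_eq by (subst sum.swap) (simp add: sum_distrib_left)
  also have "\<dots> = (\<Sum>\<alpha>\<in>{\<alpha>. mdeg \<alpha> = Suc k}. \<Sum>i\<in>UNIV. cw \<alpha> * (cmod (Mz i ?A \<alpha>))\<^sup>2) - (norm lam)\<^sup>2 * hom_norm2 ?A (Suc k)"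
    unfolding hom_norm2_eq by (simp add: pt right_diff_distrib sum_subtractf sum_distrib_left mult.left_commute)
  also have "\<dots> = (\<Sum>i\<in>UNIV. hom_norm2 (Mz i ?A) (Suc k)) - (norm lam)\<^sup>2 * hom_norm2 ?A (Suc k)"
    unfolding hom_norm2_eq by (subst sum.swap) simp
  also have "\<dots> = pw CARD('n) k / norm lam ^ (2 * k) - (norm lam)\<^sup>2 * (pw CARD('n) (Suc k) / norm lam ^ (2 * Suc k))"
    unfolding sum_hom_norm2_Mz hom_norm2_kernel_series[OF assms] ..
  also have "\<dots> = (pw CARD('n) k - pw CARD('n) (Suc k)) / norm lam ^ (2 * k)"
    using n by (simp add: field_simps power2_eq_square)
  also have "pw CARD('n) (Suc k) = pw CARD('n) k * ((k + 1) / (CARD('n) + k))"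
  proof -
    have nz: "real (CARD('n) + k) \<noteq> 0" by (simp del: of_nat_add)
    have "pw CARD('n) (Suc k) = pw CARD('n) k * (k + 1) / real (CARD('n) + k)"
      unfolding nonzero_eq_divide_eq[OF nz] using pw_Suc[of "CARD('n)" k] zero_less_card_finite[where 'a='n] by simp
    then show ?thesis by simp
  qed
  also have "pw CARD('n) k - pw CARD('n) k * ((k + 1) / (CARD('n) + k)) = pw CARD('n) k * ((CARD('n) - 1) / (CARD('n) + k))"
  proof -
    have h: "1 - (real k + 1) / (CARD('n) + k) = (CARD('n) - 1) / (CARD('n) + k)"
    proof -
      have "real k + real CARD('n) \<noteq> 0" by (simp add: add_nonneg_eq_0_iff)
      then show ?thesis by (simp add: field_simps of_nat_diff Suc_leI)
    qed
    have "pw CARD('n) k - pw CARD('n) k * ((real k + 1) / (CARD('n) + k)) = pw CARD('n) k * (1 - (real k + 1) / (CARD('n) + k))"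
      by (simp only: right_diff_distrib mult_1_right)
    then show ?thesis unfolding h by (simp add: add.commute[of 1])
  qed
  finally show ?thesis by simp
qed

text \<open>Gaussian elimination of one equation. It serves to combine one cocycle more than
  \<open>F\<close> has elements so that the contributions of \<open>F\<close> cancel.\<close>

lemma homogeneous_system_nontrivial:
  fixes c :: "'j \<Rightarrow> 'e \<Rightarrow> 'f::field"
  assumes "finite F" "finite J" "card F < card J"
  shows "\<exists>t. (\<exists>j\<in>J. t j \<noteq> 0) \<and> (\<forall>e\<in>F. (\<Sum>j\<in>J. t j * c j e) = 0)"
  using assms
proof (induction F arbitrary: J c rule: finite_induct)
  case empty
  then show ?case by (intro exI[of _ "\<lambda>_. 1"]) (auto simp: card_gt_0_iff)
next
  case (insert x F)
  show ?case
  proof (cases "\<forall>j\<in>J. c j x = 0")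
    case True
    have "card F < card J" using insert by simp
    from insert.IH[OF insert.prems(1) this, of c] show ?thesis using True by auto
  next
    case False
    then obtain l where l: "l \<in> J" "c l x \<noteq> 0" by blast
    define c' where "c' j e = c j e - c j x / c l x * c l e" for j e
    have "card F < card (J - {l})" using insert l by simp
    from insert.IH[OF _ this, of c'] insert.prems obtain t where
      t: "\<exists>j\<in>J - {l}. t j \<noteq> 0" "\<And>e. e \<in> F \<Longrightarrow> (\<Sum>j\<in>J - {l}. t j * c' j e) = 0" by auto
    define s where "s = - (\<Sum>j\<in>J - {l}. t j * c j x) / c l x"
    define t' where "t' = t(l := s)"
    have sum: "(\<Sum>j\<in>J. t' j * c j e) = s * c l e + (\<Sum>j\<in>J - {l}. t j * c j e)" for e
      using insert.prems(1) l(1) by (simp add: sum.remove t'_def)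
    have "(\<Sum>j\<in>J. t' j * c j x) = 0" unfolding sum using l(2) by (simp add: s_def)
    moreover have "(\<Sum>j\<in>J. t' j * c j e) = 0" if "e \<in> F" for e
    proof -
      have "(\<Sum>j\<in>J - {l}. t j * c' j e) = (\<Sum>j\<in>J - {l}. t j * c j e) + s * c l e"
        by (simp add: c'_def s_def right_diff_distrib sum_subtractf sum_distrib_right sum_divide_distrib mult.assoc)
      then show ?thesis unfolding sum using t(2)[OF that] by (simp add: add.commute)
    qed
    moreover have "\<exists>j\<in>J. t' j \<noteq> 0" using t(1) by (auto simp: t'_def)
    ultimately show ?thesis by blast
  qed
qed

text \<open>Stated for formal series, as it is applied to a difference not yet known to lie in
  \<open>H2 b\<close>.\<close>

lemma Mz_shift_inj:
  assumes "Mz_shift lam i g = (\<lambda>_. 0)" shows "g = (\<lambda>_. 0)"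
proof -
  have eq: "Mz i g \<alpha> = lam $ i * g \<alpha>" for \<alpha> using fun_cong[OF assms, of \<alpha>] by (simp add: Mz_shift_def)
  show ?thesis
  proof (cases "lam $ i = 0")
    case True
    then have "g \<alpha> = 0" for \<alpha> using eq[of "inc i \<alpha>"] by simp
    then show ?thesis by auto
  next
    case False
    have "g \<alpha> = 0" if "\<alpha> i = k" for k \<alpha> using that
    proof (induction k arbitrary: \<alpha>)
      case 0 then show ?case using eq[of \<alpha>] False by simp
    next
      case (Suc k)
      then obtain \<beta> where \<beta>: "\<alpha> = inc i \<beta>" by (cases \<alpha> i rule: inc_cases) auto
      then have "g \<beta> = 0" using Suc by (simp add: inc_def)
      then show ?case using eq[of "inc i \<beta>"] False by (simp add: \<beta>)
    qed
    then show ?thesis by auto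
  qed
qed

context
  fixes b :: "nat \<Rightarrow> real" and C :: real
  assumes bpos: "\<And>k. b k > 0" and C: "C > 0" "\<And>k. b (Suc k) \<le> C * b k"
begin

text \<open>Otherwise the dichotomy applies to \<open>Y\<close>. Geometric decay makes
  \<open>b k / t ^ k\<close> almost decreasing for some \<open>t < s\<close>, hence
  \<open>R < s\<close>; geometric growth makes it almost increasing for some \<open>t > s\<close>,
  hence \<open>i > s\<close>.\<close>

lemma exists_window:
  assumes s: "0 < s" "i_index b \<le> s" "s \<le> R_index b" and m: "m > 0" and e: "\<epsilon> > 0"
  defines "Y \<equiv> \<lambda>k. (b k)\<^sup>2 * (pw m k / s ^ (2 * k))"
  shows "\<exists>p\<ge>N. \<exists>q\<ge>p. Y p + Y (Suc q) \<le> \<epsilon> * (\<Sum>k=p..q. Y k)"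
proof (rule ccontr)
  assume "\<not> ?thesis"
  then have no: "\<epsilon> * (\<Sum>k=p..q. Y k) < Y p + Y (Suc q)" if "N \<le> p" "p \<le> q" for p q using that by (meson not_le)
  have Y: "Y k > 0" for k using bpos[of k] pw_pos[of m k] s by (simp add: Y_def)
  define C' where "C' = C\<^sup>2 / s\<^sup>2"
  have YS: "Y (Suc k) \<le> C' * Y k" for k
  proof -
    have "(b (Suc k))\<^sup>2 \<le> (C * b k)\<^sup>2" using C bpos[of "Suc k"] by (intro power_mono) (auto simp: less_imp_le)
    moreover have "pw m (Suc k) \<le> pw m k" by (rule pw_decreasing[OF m]) simp
    ultimately have "(b (Suc k))\<^sup>2 * pw m (Suc k) / s ^ (2 * Suc k) \<le> (C * b k)\<^sup>2 * pw m k / s ^ (2 * Suc k)"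
      using pw_pos[of m "Suc k"] s by (intro divide_right_mono mult_mono) auto
    also have "\<dots> = C' * Y k" using s by (simp add: C'_def Y_def power_mult_distrib power2_eq_square mult_ac)
    finally show ?thesis by (simp add: Y_def)
  qed
  \<comment> \<open>\<open>Y (Suc q)\<close> is replaced by \<open>C' * Y q\<close>, which gives the
    fraction; adding 2 ensures \<open>D > 1\<close>.\<close>
  define D where "D = (1 + C') / \<epsilon> + 2"
  have C'0: "C' \<ge> 0" by (simp add: C'_def)
  have D: "D > 1" using e C'0 by (simp add: D_def add_nonneg_pos)
  have bd: "(\<Sum>k=p..q. Y k) \<le> D * (Y p + Y q)" if "N \<le> p" "p \<le> q" for p q
  proof -
    have "\<epsilon> * (\<Sum>k=p..q. Y k) \<le> Y p + C' * Y q" using no[OF that] YS[of q] by simp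
    also have "\<dots> \<le> (1 + C') * (Y p + Y q)" using Y[of p] Y[of q] C'0 by (simp add: algebra_simps)
    finally have "(\<Sum>k=p..q. Y k) \<le> (1 + C') / \<epsilon> * (Y p + Y q)" using e by (simp add: field_simps)
    also have "\<dots> \<le> D * (Y p + Y q)" unfolding D_def using Y[of p] Y[of q] by (intro mult_right_mono) auto
    finally show ?thesis .
  qed
  have "(\<exists>\<theta> E. 0 < \<theta> \<and> \<theta> < 1 \<and> (\<forall>k\<ge>N. \<forall>j. Y (k + j) \<le> E * \<theta> ^ j * Y k)) \<or>
    (\<exists>\<theta> E K. 1 < \<theta> \<and> E > 0 \<and> (\<forall>k\<ge>K. \<forall>j. \<theta> ^ j * Y k \<le> E * Y (k + j)))"
    by (rule interval_sum_dichotomy[OF Y D bd])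
  then show False
  proof (elim disjE exE conjE)
    fix \<theta> E assume th: "0 < \<theta>" "\<theta> < 1" and decay: "\<forall>k\<ge>N. \<forall>j. Y (k + j) \<le> E * \<theta> ^ j * Y k"
    \<comment> \<open>\<open>\<theta>\<close> is split as \<open>x * \<theta>'\<close>: powers of
      \<open>x\<close> absorb the quotient of the \<open>pw\<close>, and \<open>\<theta>'\<close>
      determines \<open>t\<close>.\<close>
    define \<theta>' where "\<theta>' = (1 + \<theta>) / 2"
    have th': "\<theta> < \<theta>'" "\<theta>' < 1" "0 < \<theta>'" using th by (auto simp: \<theta>'_def)
    define x where "x = \<theta> / \<theta>'"
    have x: "0 < x" "x < 1" using th th' by (auto simp: x_def)
    from pw_geometric_adecr[OF x m] obtain B where B: "B > 0" "\<And>k n. k \<le> n \<Longrightarrow> x ^ n / pw m n \<le> B * (x ^ k / pw m k)"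
      by (auto simp: adecr_def)
    define t where "t = s * sqrt \<theta>'"
    have t: "0 < t" "t < s" using s th' by (auto simp: t_def)
    have t2: "t ^ (2 * k) = s ^ (2 * k) * \<theta>' ^ k" for k using th' by (simp add: t_def power_mult power_mult_distrib)
    have E0: "E > 0" using decay[rule_format, of N 0] Y[of N] zero_less_mult_pos2[of E "Y N"] by (simp add: less_le_trans)
    have "adecr (\<lambda>k. b k / t ^ k)"
    proof (rule adecr_tail[of _ N "sqrt (E * B)"])
      fix k n assume kn: "N \<le> k" "k \<le> n"
      define j where "j = n - k"
      have n: "n = k + j" using kn by (simp add: j_def)
      have px: "x ^ j * pw m k \<le> B * pw m n"
        using B(2)[of k n] kn x pw_pos[of m k] pw_pos[of m n] by (simp add: n power_add field_simps)
      have "(b n)\<^sup>2 * pw m n / s ^ (2 * n) \<le> E * \<theta> ^ j * ((b k)\<^sup>2 * pw m k / s ^ (2 * k))"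
        using decay[rule_format, of k j] kn by (simp add: n Y_def)
      also have "\<dots> = E * \<theta>' ^ j * (b k)\<^sup>2 / s ^ (2 * k) * (x ^ j * pw m k)"
        using th' by (simp add: x_def power_divide)
      also have "\<dots> \<le> E * \<theta>' ^ j * (b k)\<^sup>2 / s ^ (2 * k) * (B * pw m n)"
        using px E0 th' s by (intro mult_left_mono) auto
      finally have "pw m n * ((b n)\<^sup>2 / s ^ (2 * n)) \<le> pw m n * (E * B * \<theta>' ^ j * ((b k)\<^sup>2 / s ^ (2 * k)))"
        by (simp add: mult_ac)
      then have "(b n)\<^sup>2 / s ^ (2 * n) \<le> E * B * \<theta>' ^ j * ((b k)\<^sup>2 / s ^ (2 * k))"
        by (rule mult_left_le_imp_le[OF _ pw_pos])
      then have "(b n)\<^sup>2 / s ^ (2 * n) / \<theta>' ^ n \<le> E * B * \<theta>' ^ j * ((b k)\<^sup>2 / s ^ (2 * k)) / \<theta>' ^ n"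
        using th' by (intro divide_right_mono) auto
      also have "\<dots> = E * B * ((b k)\<^sup>2 / s ^ (2 * k) / \<theta>' ^ k)" using th' by (simp add: n power_add)
      finally have "(b n / t ^ n)\<^sup>2 \<le> E * B * (b k / t ^ k)\<^sup>2"
        by (simp add: power_divide t2[symmetric] power_mult[symmetric] mult.commute[of _ 2])
      then have "sqrt ((b n / t ^ n)\<^sup>2) \<le> sqrt (E * B * (b k / t ^ k)\<^sup>2)" by (rule real_sqrt_le_mono)
      then show "b n / t ^ n \<le> sqrt (E * B) * (b k / t ^ k)"
        using bpos[of k] bpos[of n] t by (simp add: real_sqrt_mult)
    qed (use bpos t in auto)
    then have "R_index b \<le> t" by (rule R_index_characterization(4)[of b C, OF bpos C t(1)])
    then show False using t s by simp
  next
    fix \<theta> E K assume th: "1 < \<theta>" and E0: "0 < E" and growth: "\<forall>k\<ge>K. \<forall>j. \<theta> ^ j * Y k \<le> E * Y (k + j)"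
    \<comment> \<open>Since \<open>pw\<close> decreases, its quotient helps here, and all of
      \<open>\<theta>\<close> goes into \<open>t\<close>.\<close>
    define t where "t = s * sqrt \<theta>"
    have t: "0 < t" "s < t" using s th by (auto simp: t_def)
    have t2: "t ^ (2 * k) = s ^ (2 * k) * \<theta> ^ k" for k using th by (simp add: t_def power_mult power_mult_distrib)
    have "aincr (\<lambda>k. b k / t ^ k)"
    proof (rule aincr_tail[of _ K "sqrt E"])
      fix k n assume kn: "K \<le> k" "k \<le> n"
      define j where "j = n - k"
      have n: "n = k + j" using kn by (simp add: j_def)
      have "\<theta> ^ j * ((b k)\<^sup>2 * (pw m k / s ^ (2 * k))) \<le> E * ((b n)\<^sup>2 * (pw m n / s ^ (2 * n)))"
        using growth[rule_format, of k j] kn by (simp add: n Y_def)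
      also have "\<dots> \<le> E * ((b n)\<^sup>2 * (pw m k / s ^ (2 * n)))"
        using E0 pw_decreasing[OF m kn(2)] s by (intro mult_left_mono divide_right_mono) auto
      finally have "pw m k * (\<theta> ^ j * ((b k)\<^sup>2 / s ^ (2 * k))) \<le> pw m k * (E * ((b n)\<^sup>2 / s ^ (2 * n)))"
        by (simp add: mult_ac)
      then have "\<theta> ^ j * ((b k)\<^sup>2 / s ^ (2 * k)) \<le> E * ((b n)\<^sup>2 / s ^ (2 * n))"
        by (rule mult_left_le_imp_le[OF _ pw_pos])
      then have "\<theta> ^ j * ((b k)\<^sup>2 / s ^ (2 * k)) / \<theta> ^ n \<le> E * ((b n)\<^sup>2 / s ^ (2 * n)) / \<theta> ^ n"
        using th by (intro divide_right_mono) auto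
      then have "(b k)\<^sup>2 / s ^ (2 * k) / \<theta> ^ k \<le> E * ((b n)\<^sup>2 / s ^ (2 * n) / \<theta> ^ n)"
        using th by (simp add: n power_add)
      then have "(b k / t ^ k)\<^sup>2 \<le> E * (b n / t ^ n)\<^sup>2"
        by (simp add: power_divide t2[symmetric] power_mult[symmetric] mult.commute[of _ 2])
      then have "sqrt ((b k / t ^ k)\<^sup>2) \<le> sqrt (E * (b n / t ^ n)\<^sup>2)" by (rule real_sqrt_le_mono)
      then show "b k / t ^ k \<le> sqrt E * (b n / t ^ n)"
        using bpos[of k] bpos[of n] t by (simp add: real_sqrt_mult)
    qed (use bpos t in auto)
    then have "t \<le> i_index b" by (rule i_index_characterization(4)[of b C, OF bpos C t(1)])
    then show False using t s by simp
  qed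
qed

section \<open>Truncated kernels as test vectors\<close>

lemma H2_finite_support:
  assumes "\<And>k. k \<notin> A \<Longrightarrow> hnorm f k = 0" "finite A"
  shows "f \<in> H2 b" "(H2_norm b f)\<^sup>2 = (\<Sum>k\<in>A. (b k)\<^sup>2 * hom_norm2 f k)"
proof -
  have z: "(b k * hnorm f k)\<^sup>2 = 0" if "k \<notin> A" for k using assms(1)[OF that] by simp
  show "f \<in> H2 b" unfolding H2_iff[OF bpos] sqsum_def by (rule summable_finite[OF assms(2) z])
  have "(\<Sum>k. (b k * hnorm f k)\<^sup>2) = (\<Sum>k\<in>A. (b k * hnorm f k)\<^sup>2)" by (rule suminf_finite[OF assms(2) z])
  then show "(H2_norm b f)\<^sup>2 = (\<Sum>k\<in>A. (b k)\<^sup>2 * hom_norm2 f k)"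
    unfolding H2_norm_eq[OF bpos] l2norm_def by (simp add: sum_nonneg hom_norm2_nonneg power_mult_distrib hnorm_sq)
qed

definition window :: "complex^'n::finite \<Rightarrow> nat \<Rightarrow> nat \<Rightarrow> 'n fps_m" where
  "window lam p q = (\<lambda>\<alpha>. if p \<le> mdeg \<alpha> \<and> mdeg \<alpha> \<le> q then kernel_series lam \<alpha> else 0)"

text \<open>Truncation leaves unbalanced terms exactly in degrees \<open>p\<close> and
  \<open>Suc q\<close>; in between the error keeps the small relative size
  \<open>(m - 1) / (m + k)\<close>.\<close>

lemma sum_hom_norm2_window_error:
  fixes lam :: "complex^'n::finite"
  assumes n: "lam \<noteq> 0" and pq: "p \<le> q"
  defines "a \<equiv> \<lambda>k. pw CARD('n) k / norm lam ^ (2 * k)"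
  shows "k < p \<Longrightarrow> (\<Sum>i\<in>UNIV. hom_norm2 (Mz_shift lam i (window lam p q)) k) = 0"
    and "(\<Sum>i\<in>UNIV. hom_norm2 (Mz_shift lam i (window lam p q)) p) = (norm lam)\<^sup>2 * a p"
    and "p \<le> k \<Longrightarrow> k < q \<Longrightarrow> (\<Sum>i\<in>UNIV. hom_norm2 (Mz_shift lam i (window lam p q)) (Suc k)) = a k * ((CARD('n) - 1) / (CARD('n) + k))"
    and "(\<Sum>i\<in>UNIV. hom_norm2 (Mz_shift lam i (window lam p q)) (Suc q)) = a q"
    and "k > Suc q \<Longrightarrow> (\<Sum>i\<in>UNIV. hom_norm2 (Mz_shift lam i (window lam p q)) k) = 0"
proof -
  let ?w = "window lam p q"
  have cong: "hom_norm2 f k = hom_norm2 g k" if "\<And>\<alpha>. mdeg \<alpha> = k \<Longrightarrow> f \<alpha> = g \<alpha>" for f g :: "'n fps_m" and k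
    unfolding hom_norm2_eq using that by (intro sum.cong) auto
  have zero: "hom_norm2 (\<lambda>_ :: 'n mindex. 0) k = 0" for k by (simp add: hom_norm2_eq)
  have w: "?w \<alpha> = (if p \<le> mdeg \<alpha> \<and> mdeg \<alpha> \<le> q then kernel_series lam \<alpha> else 0)" for \<alpha>
    by (simp add: window_def)
  have Mz: "Mz i ?w \<alpha> = (if p < mdeg \<alpha> \<and> mdeg \<alpha> \<le> Suc q then Mz i (kernel_series lam) \<alpha> else 0)" for i \<alpha>
    by (cases \<alpha> i rule: inc_cases) (auto simp: window_def)
  show "(\<Sum>i\<in>UNIV. hom_norm2 (Mz_shift lam i ?w) k) = 0" if "k < p"
  proof -
    have "hom_norm2 (Mz_shift lam i ?w) k = hom_norm2 (\<lambda>_ :: 'n mindex. 0) k" for i :: 'n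
      using that by (intro cong) (auto simp: Mz_shift_def Mz w)
    then show ?thesis by (simp add: zero)
  qed
  show "(\<Sum>i\<in>UNIV. hom_norm2 (Mz_shift lam i ?w) k) = 0" if "k > Suc q"
  proof -
    have "hom_norm2 (Mz_shift lam i ?w) k = hom_norm2 (\<lambda>_ :: 'n mindex. 0) k" for i :: 'n
      using that by (intro cong) (auto simp: Mz_shift_def Mz w)
    then show ?thesis by (simp add: zero)
  qed
  show "(\<Sum>i\<in>UNIV. hom_norm2 (Mz_shift lam i ?w) p) = (norm lam)\<^sup>2 * a p"
  proof -
    have "hom_norm2 (Mz_shift lam i ?w) p = (cmod (lam $ i))\<^sup>2 * a p" for i
    proof -
      have "hom_norm2 (Mz_shift lam i ?w) p = hom_norm2 (\<lambda>\<alpha>. - lam $ i * kernel_series lam \<alpha>) p"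
        using pq by (intro cong) (auto simp: Mz_shift_def Mz w)
      also have "\<dots> = (cmod (lam $ i))\<^sup>2 * a p"
        unfolding hnorm_sq[symmetric] hnorm_cmult power_mult_distrib unfolding hnorm_sq hom_norm2_kernel_series[OF n] a_def by simp
      finally show ?thesis .
    qed
    then show ?thesis by (simp add: sum_distrib_right norm_vec_sq)
  qed
  show "(\<Sum>i\<in>UNIV. hom_norm2 (Mz_shift lam i ?w) (Suc q)) = a q"
  proof -
    have "hom_norm2 (Mz_shift lam i ?w) (Suc q) = hom_norm2 (Mz i (kernel_series lam)) (Suc q)" for i
      using pq by (intro cong) (auto simp: Mz_shift_def Mz w)
    then show ?thesis by (simp add: sum_hom_norm2_Mz hom_norm2_kernel_series[OF n] a_def)
  qed
  show "(\<Sum>i\<in>UNIV. hom_norm2 (Mz_shift lam i ?w) (Suc k)) = a k * ((CARD('n) - 1) / (CARD('n) + k))" if "p \<le> k" "k < q"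
  proof -
    have "hom_norm2 (Mz_shift lam i ?w) (Suc k) = hom_norm2 (Mz_shift lam i (kernel_series lam)) (Suc k)" for i
      using that by (intro cong) (auto simp: Mz_shift_def Mz w)
    then show ?thesis by (simp add: sum_hom_norm2_kernel_error[OF n] a_def)
  qed
qed

lemma approx_eigenvector_nonzero:
  fixes lam :: "complex^'n::finite"
  assumes n: "lam \<noteq> 0" and i: "i_index b \<le> norm lam" and R: "norm lam \<le> R_index b" and e: "\<epsilon> > 0"
  shows "\<exists>f q. f \<in> H2 b \<and> H2_norm b f = 1 \<and> (\<forall>\<alpha>. f \<alpha> \<noteq> 0 \<longrightarrow> N \<le> mdeg \<alpha> \<and> mdeg \<alpha> \<le> q)
     \<and> (\<forall>i. H2_norm b (Mz_shift lam i f) \<le> \<epsilon>)"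
proof -
  let ?m = "CARD('n)"
  define s where "s = norm lam"
  have s: "s > 0" using n by (simp add: s_def)
  define a where "a k = pw ?m k / s ^ (2 * k)" for k
  define Y where "Y k = (b k)\<^sup>2 * a k" for k
  have apos: "a k > 0" for k using pw_pos[of ?m k] s by (simp add: a_def)
  have Y: "Y k > 0" for k using bpos[of k] apos[of k] by (simp add: Y_def)
  \<comment> \<open>The total error will be at most \<open>(m * s^2 + 1) * \<delta>\<close> times
    the squared norm \<open>S\<close>.\<close>
  define \<delta> where "\<delta> = \<epsilon>\<^sup>2 / (?m * s\<^sup>2 + 1)"
  have dd: "?m * s\<^sup>2 + 1 > 0" by (simp add: add_nonneg_pos)
  have \<delta>: "\<delta> > 0" using e dd by (simp add: \<delta>_def)
  \<comment> \<open>From degree \<open>N'\<close> on, the interior factor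
    \<open>C^2 * (m - 1) / (m + k)\<close> is at most \<open>\<delta>\<close>.\<close>
  obtain N' where N': "C\<^sup>2 * ?m / \<delta> \<le> real N'" using real_arch_simple by blast
  from exists_window[OF s i[folded s_def] R[folded s_def] zero_less_card_finite[where 'a='n] \<delta>, of "max N N'"]
  obtain p q where pq: "p \<ge> N" "p \<ge> N'" "p \<le> q" and small: "Y p + Y (Suc q) \<le> \<delta> * (\<Sum>k=p..q. Y k)"
    unfolding Y_def a_def by auto
  define S where "S = (\<Sum>k=p..q. Y k)"
  have S: "S > 0" unfolding S_def using Y pq(3) by (intro sum_pos) auto
  let ?w = "window lam p q"
  have hw: "hom_norm2 ?w k = (if p \<le> k \<and> k \<le> q then a k else 0)" for k
  proof -
    have "hom_norm2 ?w k = hom_norm2 (if p \<le> k \<and> k \<le> q then kernel_series lam else (\<lambda>_. 0)) k"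
      unfolding hom_norm2_eq by (intro sum.cong) (auto simp: window_def)
    then show ?thesis using hom_norm2_kernel_series[OF n, of k] by (simp add: a_def s_def hom_norm2_eq)
  qed
  have wH: "?w \<in> H2 b" "(H2_norm b ?w)\<^sup>2 = S"
  proof -
    have z: "hnorm ?w k = 0" if "k \<notin> {p..q}" for k using that by (auto simp: hnorm_def hw)
    show "?w \<in> H2 b" by (rule H2_finite_support(1)[of "{p..q}", OF z]) auto
    have "(H2_norm b ?w)\<^sup>2 = (\<Sum>k=p..q. (b k)\<^sup>2 * hom_norm2 ?w k)" by (rule H2_finite_support(2)[of "{p..q}", OF z]) auto
    also have "\<dots> = S" unfolding S_def Y_def by (intro sum.cong) (auto simp: hw)
    finally show "(H2_norm b ?w)\<^sup>2 = S" .
  qed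
  have err: "(H2_norm b (Mz_shift lam i ?w))\<^sup>2 \<le> \<epsilon>\<^sup>2 * S" for i
  proof -
    let ?E = "\<lambda>k. \<Sum>i\<in>UNIV. hom_norm2 (Mz_shift lam i ?w) k"
    have E1: "hom_norm2 (Mz_shift lam i ?w) k \<le> ?E k" for k
      by (rule member_le_sum) (auto simp: hom_norm2_nonneg)
    note W = sum_hom_norm2_window_error[OF n pq(3)]
    have z: "hnorm (Mz_shift lam i ?w) k = 0" if "k \<notin> {p..Suc q}" for k
    proof -
      have "?E k = 0" using that W(1)[of k] W(5)[of k] by auto
      then have "hom_norm2 (Mz_shift lam i ?w) k = 0" using E1[of k] hom_norm2_nonneg[of "Mz_shift lam i ?w" k] by simp
      then show ?thesis by (simp add: hnorm_def)
    qed
    have "(H2_norm b (Mz_shift lam i ?w))\<^sup>2 = (\<Sum>k=p..Suc q. (b k)\<^sup>2 * hom_norm2 (Mz_shift lam i ?w) k)"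
      by (rule H2_finite_support(2)[of "{p..Suc q}", OF z]) auto
    also have "\<dots> \<le> (\<Sum>k=p..Suc q. (b k)\<^sup>2 * ?E k)" using E1 by (intro sum_mono mult_left_mono) auto
    also have "\<dots> = (b p)\<^sup>2 * ?E p + (\<Sum>k=p..q. (b (Suc k))\<^sup>2 * ?E (Suc k))"
      using pq(3) by (simp add: sum.atLeast_Suc_atMost[of p "Suc q"] sum.shift_bounds_cl_Suc_ivl[of _ p q] del: sum.cl_ivl_Suc)
    also have "(\<Sum>k=p..q. (b (Suc k))\<^sup>2 * ?E (Suc k)) = (\<Sum>k\<in>{p..<q}. (b (Suc k))\<^sup>2 * ?E (Suc k)) + (b (Suc q))\<^sup>2 * ?E (Suc q)"
      using pq(3) by (simp add: sum.last_plus[of p q] add.commute)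
    also have "(b p)\<^sup>2 * ?E p = s\<^sup>2 * Y p" unfolding W(2) by (simp add: Y_def a_def s_def)
    \<comment> \<open>The top error has size \<open>a q\<close> in degree \<open>Suc q\<close>,
      whereas the window controls \<open>Y (Suc q)\<close>; consecutive \<open>pw\<close> differ at
      most by the factor \<open>m\<close>.\<close>
    also have "(b (Suc q))\<^sup>2 * ?E (Suc q) \<le> ?m * s\<^sup>2 * Y (Suc q)"
    proof -
      have m1: "?m \<ge> 1" using zero_less_card_finite[where 'a='n] by linarith
      have "real q * 1 \<le> real q * real ?m" using m1 by (intro mult_left_mono) auto
      then have mq: "real (?m + q) \<le> real ?m * real (q + 1)" by (simp add: algebra_simps)
      have "pw ?m q * (q + 1) = pw ?m (Suc q) * (?m + q)" using pw_Suc[of ?m q] m1 by simp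
      also have "\<dots> \<le> pw ?m (Suc q) * (?m * (q + 1))" using mq pw_pos[of ?m "Suc q"] by (intro mult_left_mono) (auto simp: algebra_simps)
      also have "\<dots> = (?m * pw ?m (Suc q)) * real (q + 1)" by (simp only: of_nat_mult mult_ac)
      finally have "pw ?m q * real (q + 1) \<le> (?m * pw ?m (Suc q)) * real (q + 1)" .
      then have "pw ?m q \<le> ?m * pw ?m (Suc q)" by (rule mult_right_le_imp_le) simp
      then have "a q \<le> ?m * s\<^sup>2 * a (Suc q)" using s by (simp add: a_def field_simps power2_eq_square)
      then have "(b (Suc q))\<^sup>2 * a q \<le> (b (Suc q))\<^sup>2 * (?m * s\<^sup>2 * a (Suc q))" by (intro mult_left_mono) auto
      then show ?thesis unfolding W(4) by (simp add: Y_def a_def s_def mult_ac)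
    qed
    also have "(\<Sum>k\<in>{p..<q}. (b (Suc k))\<^sup>2 * ?E (Suc k)) \<le> (\<Sum>k\<in>{p..<q}. \<delta> * Y k)"
    proof (intro sum_mono)
      fix k assume k: "k \<in> {p..<q}"
      have "(b (Suc k))\<^sup>2 \<le> C\<^sup>2 * (b k)\<^sup>2"
        unfolding power_mult_distrib[symmetric] using C bpos[of "Suc k"] by (intro power_mono) (auto simp: less_imp_le)
      moreover have "C\<^sup>2 * ((?m - 1) / (?m + k)) \<le> \<delta>"
      proof -
        have mk: "real (?m + k) > 0" by (simp del: of_nat_add)
        have "C\<^sup>2 * ?m \<le> \<delta> * N'" using N' \<delta> by (simp add: field_simps)
        also have "\<dots> \<le> \<delta> * (?m + k)" using \<delta> k pq by (intro mult_left_mono) auto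
        finally have "C\<^sup>2 * ?m / real (?m + k) \<le> \<delta>" using mk by (simp add: divide_le_eq del: of_nat_add)
        moreover have "C\<^sup>2 * ((?m - 1) / (?m + k)) \<le> C\<^sup>2 * ?m / real (?m + k)"
          using mk by (simp add: divide_right_mono mult_left_mono del: of_nat_add)
        ultimately show ?thesis by linarith
      qed
      ultimately have "(b (Suc k))\<^sup>2 * (a k * ((?m - 1) / (?m + k))) \<le> (C\<^sup>2 * (b k)\<^sup>2) * (a k * ((?m - 1) / (?m + k)))"
        using apos[of k] by (intro mult_right_mono) auto
      also have "\<dots> = (C\<^sup>2 * ((?m - 1) / (?m + k))) * Y k" by (simp add: Y_def)
      also have "\<dots> \<le> \<delta> * Y k" using \<open>C\<^sup>2 * ((?m - 1) / (?m + k)) \<le> \<delta>\<close> Y[of k] by (intro mult_right_mono) auto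
      finally show "(b (Suc k))\<^sup>2 * ?E (Suc k) \<le> \<delta> * Y k" using W(3)[of k] k by (simp add: a_def s_def)
    qed
    also have "(\<Sum>k\<in>{p..<q}. \<delta> * Y k) \<le> \<delta> * S"
      unfolding S_def sum_distrib_left using \<delta> Y by (intro sum_mono2) (auto simp: less_imp_le)
    finally have "(H2_norm b (Mz_shift lam i ?w))\<^sup>2 \<le> s\<^sup>2 * Y p + (\<delta> * S + ?m * s\<^sup>2 * Y (Suc q))" by simp
    also have "s\<^sup>2 * Y p \<le> ?m * s\<^sup>2 * Y p"
    proof -
      have "1 * (s\<^sup>2 * Y p) \<le> ?m * (s\<^sup>2 * Y p)" using zero_less_card_finite[where 'a='n] Y[of p] by (intro mult_right_mono) auto
      then show ?thesis by simp
    qed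
    finally have "(H2_norm b (Mz_shift lam i ?w))\<^sup>2 \<le> ?m * s\<^sup>2 * (Y p + Y (Suc q)) + \<delta> * S" by (simp add: algebra_simps)
    also have "\<dots> \<le> ?m * s\<^sup>2 * (\<delta> * S) + \<delta> * S" using small by (intro add_right_mono mult_left_mono) (auto simp: S_def)
    also have "\<dots> = (?m * s\<^sup>2 + 1) * \<delta> * S" by (simp add: algebra_simps)
    also have "(?m * s\<^sup>2 + 1) * \<delta> = \<epsilon>\<^sup>2" using dd by (simp add: \<delta>_def)
    finally show ?thesis .
  qed
  define f where "f = (\<lambda>\<alpha>. complex_of_real (1 / sqrt S) * ?w \<alpha>)"
  have wn: "H2_norm b ?w = sqrt S" using wH H2_norm_nonneg[of b ?w, OF bpos] by (metis real_sqrt_abs abs_of_nonneg)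
  have "f \<in> H2 b" unfolding f_def by (rule H2_cmult[OF bpos wH(1)])
  moreover have "H2_norm b f = 1"
  proof -
    have "H2_norm b f = cmod (complex_of_real (1 / sqrt S)) * H2_norm b ?w"
      unfolding f_def by (rule H2_norm_cmult[of b, OF bpos wH(1)])
    then show ?thesis unfolding wn norm_of_real using S by simp
  qed
  moreover have "\<forall>\<alpha>. f \<alpha> \<noteq> 0 \<longrightarrow> N \<le> mdeg \<alpha> \<and> mdeg \<alpha> \<le> q" using pq by (auto simp: f_def window_def)
  moreover have "H2_norm b (Mz_shift lam i f) \<le> \<epsilon>" for i
  proof -
    have M: "Mz_shift lam i ?w \<in> H2 b" by (rule H2_Mz_shift[of b _ C, OF bpos wH(1) C(2)])
    have "H2_norm b (Mz_shift lam i ?w) \<le> \<epsilon> * sqrt S"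
      using real_sqrt_le_mono[OF err[of i]] H2_norm_nonneg[of b, OF bpos M] e S by (simp add: real_sqrt_mult)
    moreover have "H2_norm b (Mz_shift lam i f) = cmod (complex_of_real (1 / sqrt S)) * H2_norm b (Mz_shift lam i ?w)"
      unfolding f_def Mz_shift_cmult by (rule H2_norm_cmult[of b, OF bpos M])
    ultimately show ?thesis unfolding norm_of_real using S by (simp add: divide_le_eq)
  qed
  ultimately show ?thesis by blast
qed

text \<open>The kernel series degenerates at \<open>lam = 0\<close>. A normalized power of one
  coordinate works instead, in a degree \<open>k\<close> with
  \<open>b (Suc k) \<le> \<epsilon> * b k\<close>; if such degrees ran out,
  \<open>i \<ge> \<epsilon>\<close> would follow.\<close>

lemma approx_eigenvector_zero:
  fixes lam :: "complex^'n::finite"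
  assumes n: "lam = 0" and i: "i_index b \<le> 0" and e: "\<epsilon> > 0"
  shows "\<exists>f q. f \<in> H2 b \<and> H2_norm b f = 1 \<and> (\<forall>\<alpha>. f \<alpha> \<noteq> 0 \<longrightarrow> N \<le> mdeg \<alpha> \<and> mdeg \<alpha> \<le> q)
     \<and> (\<forall>i. H2_norm b (Mz_shift lam i f) \<le> \<epsilon>)"
proof -
  have "\<exists>k\<ge>N. b (Suc k) \<le> \<epsilon> * b k"
  proof (rule ccontr)
    assume "\<not> ?thesis"
    then have g: "\<epsilon> * b k \<le> b (Suc k)" if "k \<ge> N" for k using that by (meson less_imp_le not_le)
    have "aincr (\<lambda>k. b k / \<epsilon> ^ k)"
    proof (rule aincr_tail[of _ N 1])
      fix k n assume kn: "N \<le> k" "k \<le> n"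
      from kn(2) show "b k / \<epsilon> ^ k \<le> 1 * (b n / \<epsilon> ^ n)"
      proof (induction n rule: dec_induct)
        case (step n)
        have "b n / \<epsilon> ^ n \<le> b (Suc n) / \<epsilon> ^ Suc n" using g[of n] step kn e by (simp add: field_simps)
        then show ?case using step by simp
      qed simp
    qed (use bpos e in auto)
    then have "\<epsilon> \<le> i_index b" by (rule i_index_characterization(4)[of b C, OF bpos C e])
    then show False using i e by simp
  qed
  then obtain k where k: "k \<ge> N" "b (Suc k) \<le> \<epsilon> * b k" by blast
  define j :: 'n where "j = (SOME j. True)"
  define \<beta> where "\<beta> = (\<lambda>i. if i = j then k else 0)"
  have \<beta>: "mdeg \<beta> = k" by (simp add: mdeg_def \<beta>_def)
  define f where "f = (\<lambda>\<alpha>. if \<alpha> = \<beta> then complex_of_real (1 / (b k * sqrt (cw \<beta>))) else 0)"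
  have hk: "hom_norm2 f l = (if l = k then 1 / (b k)\<^sup>2 else 0)" for l
  proof -
    have "hom_norm2 f l = (\<Sum>\<alpha>\<in>{\<alpha>. mdeg \<alpha> = l}. if \<alpha> = \<beta> then 1 / (b k)\<^sup>2 else 0)"
      unfolding hom_norm2_eq using bpos[of k] by (intro sum.cong) (auto simp: f_def norm_divide norm_mult power_divide power_mult_distrib)
    then show ?thesis using finite_mdeg[of l, where 'n='n] \<beta> by auto
  qed
  have f: "f \<in> H2 b" "(H2_norm b f)\<^sup>2 = 1"
    using H2_finite_support[of "{k}" f] hk bpos[of k] by (auto simp: hnorm_def)
  have M: "(H2_norm b (Mz i f))\<^sup>2 \<le> \<epsilon>\<^sup>2" for i
  proof -
    have h: "hnorm (Mz i f) (Suc l) \<le> hnorm f l" for l by (rule hnorm_Mz_le)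
    have z: "hnorm (Mz i f) l = 0" if "l \<notin> {Suc k}" for l
    proof (cases l)
      case (Suc l')
      then have "hnorm f l' = 0" using that by (simp add: hnorm_def hk)
      then have "hnorm (Mz i f) l \<le> 0" using h[of l'] Suc by simp
      then show ?thesis using hnorm_nonneg[of "Mz i f" l] by linarith
    qed simp
    have "(H2_norm b (Mz i f))\<^sup>2 = (b (Suc k))\<^sup>2 * hom_norm2 (Mz i f) (Suc k)"
      using H2_finite_support(2)[of "{Suc k}" "Mz i f", OF z] by simp
    also have "\<dots> \<le> (\<epsilon> * b k)\<^sup>2 * (1 / (b k)\<^sup>2)"
    proof (intro mult_mono power_mono k(2))
      show "hom_norm2 (Mz i f) (Suc k) \<le> 1 / (b k)\<^sup>2"
        using power_mono[OF h[of k] hnorm_nonneg, of 2] by (simp add: hnorm_sq hk)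
    qed (use bpos[of "Suc k"] hom_norm2_nonneg in \<open>auto simp: less_imp_le\<close>)
    also have "\<dots> = \<epsilon>\<^sup>2" using bpos[of k] by (simp add: power_mult_distrib)
    finally show ?thesis .
  qed
  have "Mz_shift lam i f = Mz i f" for i by (simp add: Mz_shift_def n)
  moreover have "H2_norm b (Mz i f) \<le> \<epsilon>" for i by (rule power2_le_imp_le[OF M less_imp_le[OF e]])
  moreover have "H2_norm b f = 1" using f H2_norm_nonneg[of b f, OF bpos f(1)] by (simp add: power2_eq_1_iff)
  moreover have "\<forall>\<alpha>. f \<alpha> \<noteq> 0 \<longrightarrow> N \<le> mdeg \<alpha> \<and> mdeg \<alpha> \<le> k" using k(1) \<beta> by (auto simp: f_def)
  ultimately show ?thesis using f(1) by (intro exI[of _ f] exI[of _ k]) auto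
qed

end

section \<open>Infinite-dimensional cohomology on the shell\<close>

lemma koszul_d_singleton: "koszul_d lam \<zeta> {i} = Mz_shift lam i (\<zeta> {})"
proof -
  have "{j \<in> {i}. j < i} = {}" by auto
  then have "ksign {i} i = 1" by (simp only: ksign_def) simp
  then show ?thesis by (simp add: koszul_d_eq)
qed

lemma Mz_shift_diff: "Mz_shift lam i (\<lambda>\<alpha>. f \<alpha> - g \<alpha>) = (\<lambda>\<alpha>. Mz_shift lam i f \<alpha> - Mz_shift lam i g \<alpha>)"
  by (auto simp: Mz_shift_def Mz_def algebra_simps)

definition zero_form :: "'n fps_m \<Rightarrow> 'n set \<Rightarrow> 'n fps_m" where
  "zero_form G S = (if S = {} then G else (\<lambda>_. 0))"

text \<open>The cutoff makes the sum finite; block \<open>n\<close> will live in degrees at least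
  \<open>n\<close>, so no term is lost.\<close>

definition block_sum :: "(nat \<Rightarrow> 'n::finite fps_m) \<Rightarrow> (nat \<Rightarrow> complex) \<Rightarrow> 'n fps_m" where
  "block_sum f \<tau> = (\<lambda>\<alpha>. \<Sum>n\<le>mdeg \<alpha>. \<tau> n * f n \<alpha>)"

lemma block_sum_linear: "block_sum f (\<lambda>n. \<Sum>j\<in>J. t j * \<tau> j n) = (\<lambda>\<alpha>. \<Sum>j\<in>J. t j * block_sum f (\<tau> j) \<alpha>)"
proof
  fix \<alpha>
  have "block_sum f (\<lambda>n. \<Sum>j\<in>J. t j * \<tau> j n) \<alpha> = (\<Sum>n\<le>mdeg \<alpha>. \<Sum>j\<in>J. t j * (\<tau> j n * f n \<alpha>))"
    unfolding block_sum_def sum_distrib_right by (simp only: mult.assoc)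
  also have "\<dots> = (\<Sum>j\<in>J. t j * block_sum f (\<tau> j) \<alpha>)"
    unfolding block_sum_def sum_distrib_left by (rule sum.swap)
  finally show "block_sum f (\<lambda>n. \<Sum>j\<in>J. t j * \<tau> j n) \<alpha> = (\<Sum>j\<in>J. t j * block_sum f (\<tau> j) \<alpha>)" .
qed

context
  fixes b :: "nat \<Rightarrow> real" and C :: real
  assumes bpos: "\<And>k. b k > 0" and C: "C > 0" "\<And>k. b (Suc k) \<le> C * b k"
begin

lemma approx_eigenvector:
  fixes lam :: "complex^'n::finite"
  assumes i: "i_index b \<le> norm lam" and R: "norm lam \<le> R_index b" and e: "\<epsilon> > 0"
  shows "\<exists>f q. f \<in> H2 b \<and> H2_norm b f = 1 \<and> (\<forall>\<alpha>. f \<alpha> \<noteq> 0 \<longrightarrow> N \<le> mdeg \<alpha> \<and> mdeg \<alpha> \<le> q)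
     \<and> (\<forall>i. H2_norm b (Mz_shift lam i f) \<le> \<epsilon>)"
proof (cases "lam = 0")
  case True
  then have "i_index b \<le> 0" using i by simp
  from approx_eigenvector_zero[of b C, OF bpos C True this e] show ?thesis .
next
  case False
  from approx_eigenvector_nonzero[of b C, OF bpos C False i R e] show ?thesis .
qed

lemma approx_point_spec_superset:
  fixes lam :: "complex^'n::finite"
  assumes i: "i_index b \<le> norm lam" and R: "norm lam \<le> R_index b"
  shows "lam \<in> approx_point_spec b"
proof -
  have "\<exists>f. f \<in> H2 b \<and> H2_norm b f = 1 \<and> (\<forall>i. H2_norm b (Mz_shift lam i f) \<le> 1 / real (Suc n))" for n
    using approx_eigenvector[OF i R, of "1 / real (Suc n)" 0] by (auto simp del: of_nat_Suc)
  then obtain g :: "nat \<Rightarrow> 'n fps_m" where g: "\<And>n. g n \<in> H2 b" "\<And>n. H2_norm b (g n) = 1"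
    "\<And>n i. H2_norm b (Mz_shift lam i (g n)) \<le> 1 / real (Suc n)" by metis
  have "(\<lambda>n. \<Sum>i\<in>UNIV. H2_norm b (Mz_shift lam i (g n))) \<longlonglongrightarrow> (\<Sum>i\<in>(UNIV :: 'n set). 0)"
  proof (intro tendsto_sum)
    fix i :: 'n
    show "(\<lambda>n. H2_norm b (Mz_shift lam i (g n))) \<longlonglongrightarrow> 0"
    proof (rule tendsto_sandwich[OF _ _ tendsto_const LIMSEQ_Suc[OF lim_1_over_n]])
      show "\<forall>\<^sub>F n in sequentially. 0 \<le> H2_norm b (Mz_shift lam i (g n))"
        using H2_norm_nonneg[of b, OF bpos H2_Mz_shift[of b _ C, OF bpos g(1) C(2)]] by auto
      show "\<forall>\<^sub>F n in sequentially. H2_norm b (Mz_shift lam i (g n)) \<le> 1 / real (Suc n)"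
        using g(3) by (intro always_eventually) blast
    qed
  qed
  then show ?thesis unfolding approx_point_spec_def using g(1,2) by (auto simp del: of_nat_Suc)
qed

text \<open>Dependent choice: each block starts in the degree where the range of its predecessor
  ends, and the errors are made summable.\<close>

lemma shell_blocks:
  fixes lam :: "complex^'n::finite"
  assumes i: "i_index b \<le> norm lam" and R: "norm lam \<le> R_index b"
  obtains f :: "nat \<Rightarrow> 'n fps_m" and N :: "nat \<Rightarrow> nat" where "\<And>n. f n \<in> H2 b" "\<And>n. H2_norm b (f n) = 1"
    "\<And>n \<alpha>. f n \<alpha> \<noteq> 0 \<Longrightarrow> N n \<le> mdeg \<alpha> \<and> mdeg \<alpha> < N (Suc n)"
    "\<And>n i. H2_norm b (Mz_shift lam i (f n)) \<le> (1 / 2) ^ n" "\<And>n. n \<le> N n" "\<And>n. N n < N (Suc n)"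
proof -
  define P where "P n x = (case x of (f :: 'n fps_m, lo, hi) \<Rightarrow> f \<in> H2 b \<and> H2_norm b f = 1
      \<and> (\<forall>\<alpha>. f \<alpha> \<noteq> 0 \<longrightarrow> lo \<le> mdeg \<alpha> \<and> mdeg \<alpha> < hi) \<and> (\<forall>i. H2_norm b (Mz_shift lam i f) \<le> (1 / 2) ^ n) \<and> n \<le> lo \<and> lo < hi)" for n :: nat and x
  have ex: "\<exists>y. P n y \<and> fst (snd y) = l" if "n \<le> l" for n l
  proof -
    from approx_eigenvector[OF i R, of "(1 / 2) ^ n" l] obtain f q where
      f: "f \<in> H2 b" "H2_norm b f = 1" "\<forall>\<alpha>. f \<alpha> \<noteq> 0 \<longrightarrow> l \<le> mdeg \<alpha> \<and> mdeg \<alpha> \<le> q" "\<forall>i. H2_norm b (Mz_shift lam i f) \<le> (1 / 2) ^ n"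
      by auto
    then have "P n (f, l, Suc (max l q))" using that by (auto simp: P_def le_imp_less_Suc max.coboundedI2)
    then show ?thesis by force
  qed
  have "\<exists>g. \<forall>n. P n (g n) \<and> snd (snd (g n)) = fst (snd (g (Suc n)))"
  proof (rule dependent_nat_choice)
    show "\<exists>x. P 0 x" using ex[of 0 0] by auto
  next
    fix x n assume "P n x"
    then have "Suc n \<le> snd (snd x)" by (auto simp: P_def)
    from ex[OF this] show "\<exists>y. P (Suc n) y \<and> snd (snd x) = fst (snd y)" by auto
  qed
  then obtain g where g: "\<And>n. P n (g n)" "\<And>n. snd (snd (g n)) = fst (snd (g (Suc n)))" by blast
  have G: "fst (g n) \<in> H2 b" "H2_norm b (fst (g n)) = 1"
    "fst (g n) \<alpha> \<noteq> 0 \<Longrightarrow> fst (snd (g n)) \<le> mdeg \<alpha> \<and> mdeg \<alpha> < snd (snd (g n))"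
    "H2_norm b (Mz_shift lam i (fst (g n))) \<le> (1 / 2) ^ n" "n \<le> fst (snd (g n))" "fst (snd (g n)) < snd (snd (g n))" for n \<alpha> i
    using g(1)[of n] by (auto simp: P_def split: prod.splits)
  show ?thesis
    by (rule that[of "\<lambda>n. fst (g n)" "\<lambda>n. fst (snd (g n))"]) (rule G[unfolded g(2)], assumption?)+
qed

context
  fixes lam :: "complex^'n::finite" and f :: "nat \<Rightarrow> 'n fps_m" and N :: "nat \<Rightarrow> nat"
  assumes f: "\<And>n. f n \<in> H2 b" "\<And>n. H2_norm b (f n) = 1"
    "\<And>n \<alpha>. f n \<alpha> \<noteq> 0 \<Longrightarrow> N n \<le> mdeg \<alpha> \<and> mdeg \<alpha> < N (Suc n)"
    "\<And>n i. H2_norm b (Mz_shift lam i (f n)) \<le> (1 / 2) ^ n" "\<And>n. n \<le> N n" "\<And>n. N n < N (Suc n)"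
begin

lemma block_vanish: "mdeg \<alpha> < n \<Longrightarrow> f n \<alpha> = 0"
  using f(3)[of n \<alpha>] f(5)[of n] by (cases "f n \<alpha> = 0") auto

text \<open>The shifted blocks have geometrically small norms, so their series converges even when
  the sum of the blocks themselves has infinite norm.\<close>

lemma Mz_shift_block_sum_H2:
  assumes B: "\<And>n. cmod (\<tau> n) \<le> B"
  shows "Mz_shift lam i (block_sum f \<tau>) \<in> H2 b"
proof -
  define u where "u n = (\<lambda>\<alpha>. \<tau> n * Mz_shift lam i (f n) \<alpha>)" for n
  have M: "Mz_shift lam i (f n) \<in> H2 b" for n by (rule H2_Mz_shift[of b _ C, OF bpos f(1) C(2)])
  have B0: "B \<ge> 0" using B[of 0] norm_ge_zero[of "\<tau> 0"] by linarith
  have uH: "u n \<in> H2 b" for n unfolding u_def by (rule H2_cmult[of b, OF bpos M])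
  have un: "H2_norm b (u n) \<le> B * (1 / 2) ^ n" for n
    unfolding u_def H2_norm_cmult[of b, OF bpos M] using B B0 f(4) H2_norm_nonneg[of b, OF bpos M]
    by (intro mult_mono) auto
  have fin: "(\<lambda>\<alpha>. \<Sum>n. u n \<alpha>) \<in> H2 b" by (rule H2_suminf(2)[of b u B "1 / 2", OF bpos uH un]) auto
  have "(\<Sum>n. u n \<alpha>) = Mz_shift lam i (block_sum f \<tau>) \<alpha>" for \<alpha>
  proof -
    have "u n \<alpha> = 0" if "n \<notin> {..mdeg \<alpha>}" for n
      using that block_vanish[of \<alpha> n]
      by (cases \<alpha> i rule: inc_cases) (auto simp: u_def Mz_shift_def block_vanish)
    then have "(\<Sum>n. u n \<alpha>) = (\<Sum>n\<le>mdeg \<alpha>. u n \<alpha>)" by (intro suminf_finite) auto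
    also have "\<dots> = (\<Sum>n\<le>mdeg \<alpha>. \<tau> n * Mz i (f n) \<alpha>) - lam $ i * block_sum f \<tau> \<alpha>"
      by (simp add: u_def Mz_shift_def block_sum_def right_diff_distrib sum_subtractf sum_distrib_left mult.left_commute)
    also have "(\<Sum>n\<le>mdeg \<alpha>. \<tau> n * Mz i (f n) \<alpha>) = Mz i (block_sum f \<tau>) \<alpha>"
      by (cases \<alpha> i rule: inc_cases) (auto simp: block_sum_def block_vanish)
    finally show ?thesis by (simp add: Mz_shift_def)
  qed
  then show ?thesis using fin by simp
qed

text \<open>Blocks have disjoint degrees and norm 1, so \<open>(cmod (\<tau> n))^2\<close> is the
  share of the squared norm in block \<open>n\<close>, a Cauchy segment of a convergent
  series.\<close>

lemma block_sum_H2_imp_tendsto: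
  assumes G: "block_sum f \<tau> \<in> H2 b"
  shows "\<tau> \<longlonglongrightarrow> 0"
proof -
  define g where "g k = (b k * hnorm (block_sum f \<tau>) k)\<^sup>2" for k
  have sm: "summable g" using G by (simp add: H2_iff[OF bpos] sqsum_def g_def[abs_def])
  have Nmono: "N m \<le> N n" if "m \<le> n" for m n by (rule lift_Suc_mono_le[of N, OF less_imp_le[OF f(6)] that])
  have uniq: "n' = n" if "N n \<le> k" "k < N (Suc n)" "N n' \<le> k" "k < N (Suc n')" for n n' k
  proof (rule ccontr)
    assume "n' \<noteq> n"
    then consider "Suc n' \<le> n" | "Suc n \<le> n'" by linarith
    then show False using Nmono[of "Suc n'" n] Nmono[of "Suc n" n'] that by cases auto
  qed
  have val: "(cmod (\<tau> n))\<^sup>2 = (\<Sum>k\<in>{N n..<N (Suc n)}. g k)" for n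
  proof -
    have z: "hnorm (f n) k = 0" if "k \<notin> {N n..<N (Suc n)}" for k
      using that f(3)[of n] by (auto simp: hnorm_eq_0)
    have one: "1 = (\<Sum>k\<in>{N n..<N (Suc n)}. (b k)\<^sup>2 * hom_norm2 (f n) k)"
      using H2_finite_support(2)[of b C "{N n..<N (Suc n)}" "f n", OF bpos C z] f(2)[of n] by simp
    have h: "hnorm (block_sum f \<tau>) k = cmod (\<tau> n) * hnorm (f n) k" if k: "k \<in> {N n..<N (Suc n)}" for k
    proof -
      have "hnorm (block_sum f \<tau>) k = hnorm (\<lambda>\<alpha>. \<tau> n * f n \<alpha>) k"
      proof (rule hnorm_cong)
        fix \<alpha> :: "'n mindex" assume a: "mdeg \<alpha> = k"
        have "f n' \<alpha> = 0" if "n' \<noteq> n" for n'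
          using uniq[of n k n'] f(3)[of n' \<alpha>] that k a by auto
        moreover have "n \<le> mdeg \<alpha>" using k a f(5)[of n] by simp
        ultimately show "block_sum f \<tau> \<alpha> = \<tau> n * f n \<alpha>"
          unfolding block_sum_def by (subst sum.remove[of _ n]) (auto intro!: sum.neutral)
      qed
      then show ?thesis by (simp add: hnorm_cmult)
    qed
    have "(\<Sum>k\<in>{N n..<N (Suc n)}. g k) = (\<Sum>k\<in>{N n..<N (Suc n)}. (cmod (\<tau> n))\<^sup>2 * ((b k)\<^sup>2 * hom_norm2 (f n) k))"
      by (intro sum.cong refl) (simp add: g_def h power_mult_distrib hnorm_sq mult_ac)
    then show ?thesis unfolding sum_distrib_left[symmetric] one[symmetric] by simp
  qed
  have "(\<lambda>n. (cmod (\<tau> n))\<^sup>2) \<longlonglongrightarrow> 0"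
  proof (rule LIMSEQ_I)
    fix r :: real assume "0 < r"
    then obtain M where M: "\<And>m n. m \<ge> M \<Longrightarrow> norm (sum g {m..<n}) < r" using sm unfolding summable_Cauchy by blast
    have "norm ((cmod (\<tau> n))\<^sup>2 - 0) < r" if "n \<ge> M" for n
      using M[of "N n" "N (Suc n)"] f(5)[of n] that by (simp add: val)
    then show "\<exists>no. \<forall>n\<ge>no. norm ((cmod (\<tau> n))\<^sup>2 - 0) < r" by blast
  qed
  from tendsto_real_sqrt[OF this] have "(\<lambda>n. cmod (\<tau> n)) \<longlonglongrightarrow> 0" by simp
  then show ?thesis by (rule tendsto_norm_zero_cancel)
qed

end

text \<open>\<open>G\<close> may lie outside \<open>H2 b\<close>. Then this cocycle is a boundary
  only formally, which makes it a candidate for a nonzero class.\<close>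

lemma koszul_d_zero_form_ker:
  fixes lam :: "complex^'n::{finite,linorder}"
  assumes G: "\<And>i. Mz_shift lam i G \<in> H2 b"
  shows "koszul_d lam (zero_form G) \<in> koszul_ker b lam 1"
proof -
  have t: "Mz_shift lam i (zero_form G (S - {i})) \<in> H2 b" for S i
    using G[of i] H2_0[of b, OF bpos] by (cases "S - {i} = {}") (simp_all add: zero_form_def)
  have "koszul_d lam (zero_form G) S \<in> H2 b" for S
    unfolding koszul_d_eq by (intro H2_sum[OF bpos] H2_cmult[OF bpos] t)
  moreover have "koszul_d lam (zero_form G) S = (\<lambda>_. 0)" if "card S \<noteq> 1" for S
  proof -
    have "S - {i} \<noteq> {}" if "i \<in> S" for i using that \<open>card S \<noteq> 1\<close> by (metis card_1_singleton_iff One_nat_def Diff_eq_empty_iff subset_singletonD empty_iff)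
    then show ?thesis by (auto simp: koszul_d_eq zero_form_def intro!: sum.neutral)
  qed
  ultimately show ?thesis by (simp add: koszul_ker_def forms_def koszul_d_koszul_d)
qed

lemma infinite_cohomology_shell:
  fixes lam :: "complex^'n::{finite,linorder}"
  assumes i: "i_index b \<le> norm lam" and R: "norm lam \<le> R_index b"
  shows "lam \<in> taylor_ess_spectrum b"
proof (rule ccontr)
  assume "lam \<notin> taylor_ess_spectrum b"
  then have "\<exists>F. finite F \<and> F \<subseteq> koszul_ker b lam 1 \<and>
      (\<forall>\<omega>\<in>koszul_ker b lam 1. \<exists>c. (\<lambda>S \<alpha>. \<omega> S \<alpha> - (\<Sum>\<eta>\<in>F. c \<eta> * \<eta> S \<alpha>)) \<in> koszul_ran b lam 1)"
    unfolding taylor_ess_spectrum_def by blast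
  then obtain F where F: "finite F"
    "\<And>\<omega>. \<omega> \<in> koszul_ker b lam 1 \<Longrightarrow> \<exists>c. (\<lambda>S \<alpha>. \<omega> S \<alpha> - (\<Sum>\<eta>\<in>F. c \<eta> * \<eta> S \<alpha>)) \<in> koszul_ran b lam 1" by blast
  obtain f :: "nat \<Rightarrow> 'n fps_m" and N where f: "\<And>n. f n \<in> H2 b" "\<And>n. H2_norm b (f n) = 1"
    "\<And>n \<alpha>. f n \<alpha> \<noteq> 0 \<Longrightarrow> N n \<le> mdeg \<alpha> \<and> mdeg \<alpha> < N (Suc n)"
    "\<And>n i. H2_norm b (Mz_shift lam i (f n)) \<le> (1 / 2) ^ n" "\<And>n. n \<le> N n" "\<And>n. N n < N (Suc n)"
    by (rule shell_blocks[OF i R]) (rule that, assumption+)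
  \<comment> \<open>\<open>prod_decode\<close> splits the indices into infinitely many infinite
    classes; \<open>\<tau> j\<close> is the indicator of class \<open>j\<close>.\<close>
  define \<tau> where "\<tau> j n = (if fst (prod_decode n) = j then 1 else 0 :: complex)" for j n
  define G where "G j = block_sum f (\<tau> j)" for j
  have "Mz_shift lam i (G j) \<in> H2 b" for i j
    unfolding G_def by (rule Mz_shift_block_sum_H2[of f N lam _ 1, OF f(1,2) _ f(4,5,6)]) (use f(3) in \<open>auto simp: \<tau>_def\<close>)
  note ker = koszul_d_zero_form_ker[OF this]
  have "\<exists>c \<xi>. \<xi> \<in> forms b 0 \<and> (\<forall>S \<alpha>. koszul_d lam (zero_form (G j)) S \<alpha> - (\<Sum>\<eta>\<in>F. c \<eta> * \<eta> S \<alpha>) = koszul_d lam \<xi> S \<alpha>)" for j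
  proof -
    from F(2)[OF ker[of j]] obtain c where
      "(\<lambda>S \<alpha>. koszul_d lam (zero_form (G j)) S \<alpha> - (\<Sum>\<eta>\<in>F. c \<eta> * \<eta> S \<alpha>)) \<in> koszul_ran b lam 1" by blast
    then obtain \<xi> where X: "\<xi> \<in> forms b 0"
      "(\<lambda>S \<alpha>. koszul_d lam (zero_form (G j)) S \<alpha> - (\<Sum>\<eta>\<in>F. c \<eta> * \<eta> S \<alpha>)) = koszul_d lam \<xi>" by (auto simp: koszul_ran_def)
    show ?thesis using X(1) fun_cong[OF fun_cong[OF X(2)]] by blast
  qed
  then have "\<forall>j. \<exists>c \<xi>. \<xi> \<in> forms b 0 \<and> (\<forall>S \<alpha>. koszul_d lam (zero_form (G j)) S \<alpha> - (\<Sum>\<eta>\<in>F. c \<eta> * \<eta> S \<alpha>) = koszul_d lam \<xi> S \<alpha>)" ..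
  from choice[OF this] obtain c where
    "\<forall>j. \<exists>\<xi>. \<xi> \<in> forms b 0 \<and> (\<forall>S \<alpha>. koszul_d lam (zero_form (G j)) S \<alpha> - (\<Sum>\<eta>\<in>F. c j \<eta> * \<eta> S \<alpha>) = koszul_d lam \<xi> S \<alpha>)" ..
  from choice[OF this] obtain \<xi> where
    c': "\<forall>j. \<xi> j \<in> forms b 0 \<and> (\<forall>S \<alpha>. koszul_d lam (zero_form (G j)) S \<alpha> - (\<Sum>\<eta>\<in>F. c j \<eta> * \<eta> S \<alpha>) = koszul_d lam (\<xi> j) S \<alpha>)" ..
  have c: "\<xi> j \<in> forms b 0"
    "koszul_d lam (zero_form (G j)) S \<alpha> - (\<Sum>\<eta>\<in>F. c j \<eta> * \<eta> S \<alpha>) = koszul_d lam (\<xi> j) S \<alpha>" for j S \<alpha>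
    using c' by blast+
  define J where "J = {..card F}"
  from homogeneous_system_nontrivial[OF F(1), of J c] obtain t where
    t: "\<exists>j\<in>J. t j \<noteq> 0" "\<And>\<eta>. \<eta> \<in> F \<Longrightarrow> (\<Sum>j\<in>J. t j * c j \<eta>) = 0" by (auto simp: J_def)
  \<comment> \<open>A single component is enough to compare the forms, because one shift is already
    injective.\<close>
  obtain i :: 'n where True by blast
  have eq: "Mz_shift lam i (G j) \<alpha> - (\<Sum>\<eta>\<in>F. c j \<eta> * \<eta> {i} \<alpha>) = Mz_shift lam i (\<xi> j {}) \<alpha>" for j \<alpha>
    using c(2)[of j "{i}" \<alpha>] by (simp add: koszul_d_singleton zero_form_def)
  have "Mz_shift lam i (\<lambda>\<alpha>. \<Sum>j\<in>J. t j * (\<xi> j {} \<alpha>)) \<alpha> = Mz_shift lam i (\<lambda>\<alpha>. \<Sum>j\<in>J. t j * G j \<alpha>) \<alpha>" for \<alpha>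
  proof -
    have "(\<Sum>j\<in>J. t j * (\<Sum>\<eta>\<in>F. c j \<eta> * \<eta> {i} \<alpha>)) = (\<Sum>\<eta>\<in>F. (\<Sum>j\<in>J. t j * c j \<eta>) * \<eta> {i} \<alpha>)"
      by (simp add: sum_distrib_left sum_distrib_right mult.assoc) (rule sum.swap)
    then have z: "(\<Sum>j\<in>J. t j * (\<Sum>\<eta>\<in>F. c j \<eta> * \<eta> {i} \<alpha>)) = 0" using t(2) by simp
    show ?thesis
      unfolding Mz_shift_linear eq[symmetric] right_diff_distrib sum_subtractf z by simp
  qed
  then have "Mz_shift lam i (\<lambda>\<alpha>. (\<Sum>j\<in>J. t j * G j \<alpha>) - (\<Sum>j\<in>J. t j * (\<xi> j {} \<alpha>))) = (\<lambda>_. 0)"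
    by (simp add: Mz_shift_diff)
  from fun_cong[OF Mz_shift_inj[OF this]] have "(\<lambda>\<alpha>. \<Sum>j\<in>J. t j * G j \<alpha>) = (\<lambda>\<alpha>. \<Sum>j\<in>J. t j * (\<xi> j {} \<alpha>))" by simp
  moreover have "(\<lambda>\<alpha>. \<Sum>j\<in>J. t j * (\<xi> j {} \<alpha>)) \<in> H2 b"
    using c(1) by (intro H2_sum[OF bpos] H2_cmult[OF bpos]) (simp add: forms_def)
  ultimately have GH: "block_sum f (\<lambda>n. \<Sum>j\<in>J. t j * \<tau> j n) \<in> H2 b" by (simp add: block_sum_linear G_def)
  have lim: "(\<lambda>n. \<Sum>j\<in>J. t j * \<tau> j n) \<longlonglongrightarrow> 0"
    by (rule block_sum_H2_imp_tendsto[of f N lam, OF f(1,2) _ f(4,5,6) GH]) (use f(3) in blast)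
  from t(1) obtain l where l: "l \<in> J" "t l \<noteq> 0" by blast
  from LIMSEQ_D[OF lim, of "cmod (t l)"] l obtain M where M: "\<And>n. n \<ge> M \<Longrightarrow> norm ((\<Sum>j\<in>J. t j * \<tau> j n) - 0) < cmod (t l)" by auto
  \<comment> \<open>The index \<open>prod_encode (l, M)\<close> lies in class \<open>l\<close> and
    is at least \<open>M\<close>.\<close>
  have "(\<Sum>j\<in>J. t j * \<tau> j (prod_encode (l, M))) = (\<Sum>j\<in>J. if j = l then t l else 0)"
    by (intro sum.cong) (auto simp: \<tau>_def)
  also have "\<dots> = t l" using l by (simp add: J_def)
  finally show False using M[OF le_prod_encode_2[of M l]] by simp
qed

end

lemma taylor_ess_spectrum_subset: "taylor_ess_spectrum b \<subseteq> (taylor_spectrum b :: (complex^'n::{finite,linorder}) set)"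
proof
  fix lam :: "complex^'n::{finite,linorder}"
  assume lam: "lam \<in> taylor_ess_spectrum b"
  show "lam \<in> taylor_spectrum b"
  proof (rule ccontr)
    assume "lam \<notin> taylor_spectrum b"
    then have "koszul_ker b lam p = koszul_ran b lam p" for p by (simp add: taylor_spectrum_def)
    then have "\<exists>F. finite F \<and> F \<subseteq> koszul_ker b lam p \<and>
      (\<forall>\<omega>\<in>koszul_ker b lam p. \<exists>c. (\<lambda>S \<alpha>. \<omega> S \<alpha> - (\<Sum>\<eta>\<in>F. c \<eta> * \<eta> S \<alpha>)) \<in> koszul_ran b lam p)" for p
      by (intro exI[of _ "{}"]) simp
    with lam show False unfolding taylor_ess_spectrum_def by blast
  qed
qed

section \<open>Convergence, the point spectrum of the adjoint, and the spectra\<close>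

context
  fixes b :: "nat \<Rightarrow> real" and C :: real
  assumes bpos: "\<And>k. b k > 0" and C: "C > 0" "\<And>k. b (Suc k) \<le> C * b k"
begin

lemma H2_converges_at:
  fixes z :: "complex^'n::finite"
  assumes f: "f \<in> H2 b" and z: "norm z < r_index b"
  shows "converges_at f z"
proof -
  define h where "h k = hnorm f k * (norm z ^ k / sqrt (pw CARD('n) k))" for k
  have sm: "summable h" unfolding h_def by (rule eval_summable[of b C, OF bpos C f norm_ge_zero z])
  have h0: "h k \<ge> 0" for k using pw_pos[of "CARD('n)" k] by (simp add: h_def)
  have "(\<lambda>\<alpha>. cmod (f \<alpha> * monom \<alpha> z)) summable_on UNIV"
  proof (rule nonneg_bdd_above_summable_on)
    show "bdd_above (sum (\<lambda>\<alpha>. cmod (f \<alpha> * monom \<alpha> z)) ` {F. F \<subseteq> UNIV \<and> finite F})"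
    proof (rule bdd_aboveI2)
      fix F :: "'n mindex set" assume "F \<in> {F. F \<subseteq> UNIV \<and> finite F}"
      then have F: "finite F" by simp
      have "(\<Sum>\<alpha>\<in>F. cmod (f \<alpha> * monom \<alpha> z)) = (\<Sum>k\<in>mdeg ` F. \<Sum>\<alpha>\<in>{\<alpha>\<in>F. mdeg \<alpha> = k}. cmod (f \<alpha> * monom \<alpha> z))"
        using F by (intro sum.group[symmetric]) auto
      also have "\<dots> \<le> (\<Sum>k\<in>mdeg ` F. h k)"
      proof (intro sum_mono)
        fix k
        have "(\<Sum>\<alpha>\<in>{\<alpha>\<in>F. mdeg \<alpha> = k}. cmod (f \<alpha> * monom \<alpha> z)) \<le> (\<Sum>\<alpha>\<in>{\<alpha>. mdeg \<alpha> = k}. cmod (f \<alpha> * monom \<alpha> z))"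
          by (intro sum_mono2 finite_mdeg) auto
        also have "\<dots> \<le> h k" unfolding h_def by (rule hom_part_abs_le)
        finally show "(\<Sum>\<alpha>\<in>{\<alpha>\<in>F. mdeg \<alpha> = k}. cmod (f \<alpha> * monom \<alpha> z)) \<le> h k" .
      qed
      also have "\<dots> \<le> suminf h" using F h0 by (intro sum_le_suminf sm) auto
      finally show "(\<Sum>\<alpha>\<in>F. cmod (f \<alpha> * monom \<alpha> z)) \<le> suminf h" .
    qed
  qed auto
  then show ?thesis unfolding converges_at_def by (rule abs_summable_summable)
qed

text \<open>A lacunary series in one coordinate, supported in the infinitely many degrees with
  \<open>b k < s ^ k\<close>. With coefficients \<open>1 / t ^ k\<close> its norm is dominated by
  powers of \<open>s / t\<close>, while its nonzero terms at \<open>z\<close> have modulus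
  1.\<close>

lemma H2_diverges_outside:
  assumes rho: "\<rho> > r_index b"
  shows "\<exists>z::complex^'n::finite. norm z < \<rho> \<and> (\<exists>f\<in>H2 b. \<not> converges_at f z)"
proof -
  obtain t where t: "r_index b < t" "t < \<rho>" using dense[OF rho] by blast
  obtain s where s: "r_index b < s" "s < t" using dense[OF t(1)] by blast
  have sp: "s > 0" using s r_index_nonneg[of b C, OF bpos C] by simp
  define i :: 'n where "i = (SOME i. True)"
  define e where "e k = (\<lambda>j. if j = i then k else 0 :: nat)" for k
  have me: "mdeg (e k) = k" for k by (simp add: e_def mdeg_def)
  have cwe: "cw (e k) = pw CARD('n) k" for k
  proof -
    have "(\<Prod>j\<in>UNIV. fact (e k j) :: real) = (\<Prod>j\<in>UNIV. if j = i then fact k else 1)"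
      by (intro prod.cong) (auto simp: e_def)
    then show ?thesis by (simp add: cw_def pw_def me)
  qed
  define f :: "'n fps_m" where "f \<alpha> = (if \<alpha> = e (mdeg \<alpha>) \<and> b (mdeg \<alpha>) < s ^ mdeg \<alpha> then complex_of_real (1 / t ^ mdeg \<alpha>) else 0)" for \<alpha>
  define z :: "complex^'n" where "z = axis i (complex_of_real t)"
  have "(norm z)\<^sup>2 = (\<Sum>j\<in>UNIV. if j = i then t\<^sup>2 else 0)"
    unfolding norm_vec_sq by (intro sum.cong) (auto simp: z_def axis_def)
  then have nz: "norm z = t" using s sp by simp
  have hf: "hom_norm2 f k = (if b k < s ^ k then pw CARD('n) k / (t ^ k)\<^sup>2 else 0)" for k
  proof -
    have "hom_norm2 f k = (\<Sum>\<alpha>\<in>{\<alpha>. mdeg \<alpha> = k}. if \<alpha> = e k then (if b k < s ^ k then pw CARD('n) k / (t ^ k)\<^sup>2 else 0) else 0)"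
      unfolding hom_norm2_eq using s sp by (intro sum.cong) (auto simp: f_def cwe norm_divide norm_power power_divide)
    then show ?thesis using finite_mdeg[of k, where 'n='n] by (simp add: me)
  qed
  have "f \<in> H2 b" unfolding H2_def
  proof (rule CollectI, rule summable_comparison_test'[where g = "\<lambda>k. ((s / t)\<^sup>2) ^ k" and N = 0])
    show "summable (\<lambda>k. ((s / t)\<^sup>2) ^ k)" using s sp by (intro summable_geometric) (simp add: abs_square_less_1)
    fix k
    have "(b k)\<^sup>2 * (pw CARD('n) k / (t ^ k)\<^sup>2) \<le> (s ^ k)\<^sup>2 * (1 / (t ^ k)\<^sup>2)" if "b k < s ^ k"
      using that bpos[of k] pw_decreasing[of "CARD('n)" 0 k] pw_pos[of "CARD('n)" k]
      by (intro mult_mono power_mono divide_right_mono) (auto simp: less_imp_le)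
    moreover have "(s ^ k)\<^sup>2 * (1 / (t ^ k)\<^sup>2) = ((s / t)\<^sup>2) ^ k" by (simp add: power_divide power_mult[symmetric] mult.commute)
    ultimately show "norm ((b k)\<^sup>2 * hom_norm2 f k) \<le> ((s / t)\<^sup>2) ^ k"
      using pw_pos[of "CARD('n)" k] by (auto simp: hf)
  qed
  moreover have "\<not> converges_at f z"
  proof
    assume "converges_at f z"
    then have "(\<lambda>\<alpha>. f \<alpha> * monom \<alpha> z) summable_on range e"
      unfolding converges_at_def by (rule summable_on_subset_banach) simp
    moreover have "inj e" by (rule inj_on_inverseI[of _ mdeg]) (simp add: me)
    ultimately have "((\<lambda>\<alpha>. f \<alpha> * monom \<alpha> z) \<circ> e) summable_on UNIV" by (subst (asm) summable_on_reindex) auto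
    then have "(\<lambda>k. f (e k) * monom (e k) z) \<longlonglongrightarrow> 0"
      using summable_LIMSEQ_zero[OF summable_on_imp_summable] by (auto simp: o_def)
    then have "\<forall>\<^sub>F k in sequentially. norm (f (e k) * monom (e k) z) < 1"
      by (intro order_tendstoD(2)[OF tendsto_norm_zero]) auto
    moreover have "norm (f (e k) * monom (e k) z) = 1" if "b k < s ^ k" for k
    proof -
      have "monom (e k) z = (\<Prod>j\<in>UNIV. if j = i then complex_of_real t ^ k else 1)"
        unfolding monom_def z_def by (intro prod.cong) (auto simp: e_def axis_def)
      then show ?thesis using that s sp by (simp add: f_def me norm_mult norm_divide norm_power)
    qed
    ultimately have "\<forall>\<^sub>F k in sequentially. \<not> b k < s ^ k" by (auto elim!: eventually_mono)
    then show False using greater_r_index[of b C, OF bpos C s(1)] by (simp add: frequently_def)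
  qed
  ultimately show ?thesis using nz t by blast
qed

section \<open>Eigenvectors of the adjoint\<close>

lemma H2_inner_single:
  fixes g :: "'n::finite fps_m"
  shows "H2_inner b (\<lambda>\<alpha>. if \<alpha> = \<beta> then 1 else 0) g = of_real ((b (mdeg \<beta>))\<^sup>2 * cw \<beta>) * cnj (g \<beta>)"
proof -
  have h: "hom_inner (\<lambda>\<alpha>. if \<alpha> = \<beta> then 1 else 0) g k = (if k = mdeg \<beta> then cw \<beta> * cnj (g \<beta>) else 0)" for k
  proof -
    have "hom_inner (\<lambda>\<alpha>. if \<alpha> = \<beta> then 1 else 0) g k = (\<Sum>\<alpha>\<in>{\<alpha>. mdeg \<alpha> = k}. if \<alpha> = \<beta> then cw \<beta> * cnj (g \<beta>) else 0)"
      unfolding hom_inner_eq by (intro sum.cong) auto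
    then show ?thesis using finite_mdeg[of k, where 'n='n] by auto
  qed
  have "H2_inner b (\<lambda>\<alpha>. if \<alpha> = \<beta> then 1 else 0) g = (\<Sum>k\<in>{mdeg \<beta>}. complex_of_real ((b k)\<^sup>2) * hom_inner (\<lambda>\<alpha>. if \<alpha> = \<beta> then 1 else 0) g k)"
    unfolding H2_inner_def by (rule suminf_finite) (auto simp: h)
  then show ?thesis by (simp add: h)
qed

lemma hom_norm2_eigenvector:
  fixes lam :: "complex^'n::finite"
  assumes f: "\<And>\<alpha>. f \<alpha> = a * monom \<alpha> lam / of_real ((b (mdeg \<alpha>))\<^sup>2 * cw \<alpha>)"
  shows "(b k)\<^sup>2 * hom_norm2 f k = (cmod a)\<^sup>2 * (norm lam ^ (2 * k) / (pw CARD('n) k * (b k)\<^sup>2))"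
proof -
  have "hom_norm2 f k = (\<Sum>\<alpha>\<in>{\<alpha>. mdeg \<alpha> = k}. (cmod a)\<^sup>2 / (b k) ^ 4 * ((cmod (monom \<alpha> lam))\<^sup>2 / cw \<alpha>))"
    unfolding hom_norm2_eq
  proof (intro sum.cong refl)
    fix \<alpha> :: "'n mindex" assume "\<alpha> \<in> {\<alpha>. mdeg \<alpha> = k}"
    then have k: "mdeg \<alpha> = k" by simp
    have "cmod (f \<alpha>) = cmod a * cmod (monom \<alpha> lam) / ((b k)\<^sup>2 * cw \<alpha>)"
      unfolding f k norm_divide norm_mult norm_of_real by simp
    then have "cw \<alpha> * (cmod (f \<alpha>))\<^sup>2 = cw \<alpha> * ((cmod a)\<^sup>2 * (cmod (monom \<alpha> lam))\<^sup>2 / (((b k)\<^sup>2)\<^sup>2 * (cw \<alpha>)\<^sup>2))"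
      by (simp add: power_divide power_mult_distrib)
    also have "\<dots> = (cmod a)\<^sup>2 / (b k) ^ 4 * ((cmod (monom \<alpha> lam))\<^sup>2 / cw \<alpha>)"
      by (simp add: power2_eq_square[of "cw \<alpha>"] power_mult[symmetric])
    finally show "cw \<alpha> * (cmod (f \<alpha>))\<^sup>2 = (cmod a)\<^sup>2 / (b k) ^ 4 * ((cmod (monom \<alpha> lam))\<^sup>2 / cw \<alpha>)" .
  qed
  also have "\<dots> = (cmod a)\<^sup>2 / (b k) ^ 4 * (norm lam ^ (2 * k) / pw CARD('n) k)"
    unfolding sum_distrib_left[symmetric] sum_monom_cw ..
  finally have h: "hom_norm2 f k = (cmod a)\<^sup>2 / (b k) ^ 4 * (norm lam ^ (2 * k) / pw CARD('n) k)" .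
  have b4: "(b k) ^ 4 = (b k)\<^sup>2 * (b k)\<^sup>2" by (simp flip: power_add)
  have "B * (A / (B * B) * (x / p)) = A * (x / (p * B))" if "B \<noteq> 0" for A B x p :: real
    using that by simp
  note * = this
  show ?thesis unfolding h b4 by (rule *) (use bpos[of k] in simp)
qed

text \<open>Testing against monomials shows that
  \<open>(b (mdeg \<alpha>))^2 * cw \<alpha> * f \<alpha>\<close> obeys the recursion of
  \<open>monom \<alpha> lam\<close>. Eigenvectors are therefore multiples of one explicit series,
  and the condition is that its norm be finite.\<close>

lemma point_spec_adj_iff:
  fixes lam :: "complex^'n::finite"
  shows "lam \<in> point_spec_adj b \<longleftrightarrow> summable (\<lambda>k. norm lam ^ (2 * k) / (pw CARD('n) k * (b k)\<^sup>2))"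
proof
  assume sm: "summable (\<lambda>k. norm lam ^ (2 * k) / (pw CARD('n) k * (b k)\<^sup>2))"
  define f :: "'n fps_m" where "f \<alpha> = 1 * monom \<alpha> lam / of_real ((b (mdeg \<alpha>))\<^sup>2 * cw \<alpha>)" for \<alpha>
  have "f \<in> H2 b" unfolding H2_def using sm by (simp add: hom_norm2_eigenvector[OF f_def])
  moreover have "f (\<lambda>_. 0) \<noteq> 0" using bpos[of 0] by (simp add: f_def monom_def)
  moreover have "H2_inner b (Mz i h) f = H2_inner b h (\<lambda>\<alpha>. lam $ i * f \<alpha>)" for i h
  proof -
    define u where "u k = complex_of_real ((b k)\<^sup>2) * hom_inner (Mz i h) f k" for k
    define v where "v k = complex_of_real ((b k)\<^sup>2) * hom_inner h (\<lambda>\<alpha>. lam $ i * f \<alpha>) k" for k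
    have u0: "u 0 = 0" by (simp add: u_def hom_inner_eq mdeg_0_iff)
    have uv: "u (Suc k) = v k" for k
    proof -
      have w: "of_real ((b (mdeg \<alpha>))\<^sup>2) * (of_real (cw \<alpha>) * cnj (f \<alpha>)) = cnj (monom \<alpha> lam)" for \<alpha>
        using bpos[of "mdeg \<alpha>"] by (simp add: f_def)
      have "hom_inner (Mz i h) f (Suc k) = (\<Sum>\<alpha>\<in>{\<alpha>. mdeg \<alpha> = Suc k}. if \<alpha> i = 0 then 0 else cw \<alpha> * (Mz i h \<alpha> * cnj (f \<alpha>)))"
        unfolding hom_inner_eq by (intro sum.cong) auto
      also have "\<dots> = (\<Sum>\<beta>\<in>{\<beta>. mdeg \<beta> = k}. cw (inc i \<beta>) * (h \<beta> * cnj (f (inc i \<beta>))))" by (simp only: sum_inc Mz_inc)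
      finally have "u (Suc k) = (\<Sum>\<beta>\<in>{\<beta>. mdeg \<beta> = k}. h \<beta> * (of_real ((b (Suc k))\<^sup>2) * (of_real (cw (inc i \<beta>)) * cnj (f (inc i \<beta>)))))"
        by (simp add: u_def sum_distrib_left mult_ac)
      also have "\<dots> = (\<Sum>\<beta>\<in>{\<beta>. mdeg \<beta> = k}. h \<beta> * (cnj (lam $ i) * (of_real ((b k)\<^sup>2) * (of_real (cw \<beta>) * cnj (f \<beta>)))))"
      proof (intro sum.cong refl)
        fix \<beta> :: "'n mindex" assume "\<beta> \<in> {\<beta>. mdeg \<beta> = k}"
        then show "h \<beta> * (of_real ((b (Suc k))\<^sup>2) * (of_real (cw (inc i \<beta>)) * cnj (f (inc i \<beta>))))
            = h \<beta> * (cnj (lam $ i) * (of_real ((b k)\<^sup>2) * (of_real (cw \<beta>) * cnj (f \<beta>))))"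
          using w[of "inc i \<beta>"] w[of \<beta>] by (simp add: monom_inc)
      qed
      also have "\<dots> = v k" by (simp add: v_def hom_inner_eq sum_distrib_left mult_ac)
      finally show ?thesis .
    qed
    \<comment> \<open>The series differ by a vanishing first term. Comparing the \<open>sums\<close>
      relations gives equal values of \<open>suminf\<close> whether or not they converge.\<close>
    have "(sums) u = (sums) v" using sums_Suc_iff[of u] u0 by (auto simp: uv fun_eq_iff)
    then have "(\<Sum>k. u k) = (\<Sum>k. v k)" unfolding suminf_def by simp
    then show ?thesis by (simp add: H2_inner_def u_def v_def)
  qed
  ultimately show "lam \<in> point_spec_adj b" unfolding point_spec_adj_def by (intro CollectI bexI[of _ f]) auto
next
  assume "lam \<in> point_spec_adj b"
  then obtain f :: "'n fps_m" where f: "f \<in> H2 b" "f \<noteq> (\<lambda>_. 0)"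
    "\<And>i h. h \<in> H2 b \<Longrightarrow> H2_inner b (Mz i h) f = H2_inner b h (\<lambda>\<alpha>. lam $ i * f \<alpha>)"
    unfolding point_spec_adj_def by blast
  define \<phi> where "\<phi> \<alpha> = of_real ((b (mdeg \<alpha>))\<^sup>2 * cw \<alpha>) * f \<alpha>" for \<alpha>
  have step: "\<phi> (inc i \<alpha>) = lam $ i * \<phi> \<alpha>" for i \<alpha>
  proof -
    have M: "Mz i (\<lambda>\<gamma>. if \<gamma> = \<alpha> then 1 else 0) = (\<lambda>\<gamma>. if \<gamma> = inc i \<alpha> then 1 else 0)"
    proof
      fix \<gamma> show "Mz i (\<lambda>\<gamma>. if \<gamma> = \<alpha> then 1 else 0) \<gamma> = (if \<gamma> = inc i \<alpha> then 1 else 0)"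
        by (cases \<gamma> i rule: inc_cases) (auto simp: inj_eq[OF inj_inc] inc_apply)
    qed
    have "H2_inner b (Mz i (\<lambda>\<gamma>. if \<gamma> = \<alpha> then 1 else 0)) f = H2_inner b (\<lambda>\<gamma>. if \<gamma> = \<alpha> then 1 else 0) (\<lambda>\<alpha>. lam $ i * f \<alpha>)"
      by (rule f(3)[OF H2_single[of b C, OF bpos C]])
    then have "cnj (\<phi> (inc i \<alpha>)) = cnj (lam $ i * \<phi> \<alpha>)"
      unfolding M H2_inner_single by (simp add: \<phi>_def mult_ac)
    then show ?thesis by (simp only: complex_cnj_cancel_iff)
  qed
  have \<phi>: "\<phi> \<alpha> = \<phi> (\<lambda>_. 0) * monom \<alpha> lam" if "mdeg \<alpha> = k" for k \<alpha>
    using that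
  proof (induction k arbitrary: \<alpha>)
    case 0
    then show ?case by (simp add: mdeg_0_iff monom_def)
  next
    case (Suc k)
    then obtain i where "\<alpha> i \<noteq> 0" by (metis mdeg_0_iff nat.simps(3))
    then obtain \<beta> where \<beta>: "\<alpha> = inc i \<beta>" by (cases \<alpha> i rule: inc_cases) auto
    then show ?case using Suc step[of i \<beta>] by (simp add: monom_inc)
  qed
  have fe: "f \<alpha> = \<phi> (\<lambda>_. 0) * monom \<alpha> lam / of_real ((b (mdeg \<alpha>))\<^sup>2 * cw \<alpha>)" for \<alpha>
    using \<phi>[of \<alpha>, OF refl] bpos[of "mdeg \<alpha>"] by (simp add: \<phi>_def[of \<alpha>] field_simps)
  have nz: "\<phi> (\<lambda>_. 0) \<noteq> 0" using f(2) fe by force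
  have "summable (\<lambda>k. (cmod (\<phi> (\<lambda>_. 0)))\<^sup>2 * (norm lam ^ (2 * k) / (pw CARD('n) k * (b k)\<^sup>2)))"
    using f(1) unfolding H2_def by (simp add: hom_norm2_eigenvector[OF fe])
  then show "summable (\<lambda>k. norm lam ^ (2 * k) / (pw CARD('n) k * (b k)\<^sup>2))"
    by (rule summable_mult_D) (use nz in simp)
qed

lemma point_series_summable:
  assumes t: "0 \<le> t" "t < r_index b" and m: "m > 0"
  shows "summable (\<lambda>k. t ^ (2 * k) / (pw m k * (b k)\<^sup>2))"
proof -
  obtain \<rho> where r: "t < \<rho>" "\<rho> < r_index b" using dense[OF t(2)] by blast
  have rp: "\<rho> > 0" using r t by simp
  have x: "0 \<le> (t / \<rho>)\<^sup>2" "(t / \<rho>)\<^sup>2 < 1" using r t rp by (auto simp: abs_square_less_1)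
  have "\<forall>\<^sub>F k in sequentially. norm (t ^ (2 * k) / (pw m k * (b k)\<^sup>2)) \<le> ((t / \<rho>)\<^sup>2) ^ k / pw m k"
    using less_r_index[of b C, OF bpos C rp r(2)]
  proof eventually_elim
    case (elim k)
    have "t ^ (2 * k) / (pw m k * (b k)\<^sup>2) \<le> t ^ (2 * k) / (pw m k * (\<rho> ^ k)\<^sup>2)"
      using elim rp pw_pos[of m k] bpos[of k] t by (intro divide_left_mono mult_left_mono power_mono mult_pos_pos) auto
    also have "\<dots> = ((t / \<rho>)\<^sup>2) ^ k / pw m k" by (simp add: power_divide power_mult[symmetric] mult.commute)
    finally show ?case using t pw_pos[of m k] by simp
  qed
  then show ?thesis by (rule summable_comparison_test_ev[OF _ summable_pw[OF x m]])
qed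

lemma point_series_not_summable:
  assumes t: "t > r_index b" and m: "m > 0"
  shows "\<not> summable (\<lambda>k. t ^ (2 * k) / (pw m k * (b k)\<^sup>2))"
proof
  assume "summable (\<lambda>k. t ^ (2 * k) / (pw m k * (b k)\<^sup>2))"
  then have "\<forall>\<^sub>F k in sequentially. t ^ (2 * k) / (pw m k * (b k)\<^sup>2) < 1"
    by (intro order_tendstoD(2)[OF summable_LIMSEQ_zero]) auto
  then have "\<forall>\<^sub>F k in sequentially. \<not> b k < t ^ k"
  proof eventually_elim
    case (elim k)
    show ?case
    proof
      assume "b k < t ^ k"
      then have "pw m k * (b k)\<^sup>2 \<le> 1 * (t ^ k)\<^sup>2"
        using pw_decreasing[OF m, of 0 k] bpos[of k] by (intro mult_mono power_mono) (auto simp: less_imp_le)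
      then show False using elim pw_pos[of m k] bpos[of k] by (simp add: divide_less_eq power_mult[symmetric] mult.commute)
    qed
  qed
  then show False using greater_r_index[of b C, OF bpos C t] by (simp add: frequently_def)
qed

lemma point_spec_adj_ball:
  "(point_spec_adj b :: (complex^'n::finite) set) = ball 0 (r_index b) \<or> (point_spec_adj b :: (complex^'n) set) = cball 0 (r_index b)"
proof -
  let ?P = "\<lambda>t. summable (\<lambda>k. t ^ (2 * k) / (pw CARD('n) k * (b k)\<^sup>2))"
  have lt: "?P t" if "0 \<le> t" "t < r_index b" for t by (rule point_series_summable[OF that]) simp
  have gt: "\<not> ?P t" if "t > r_index b" for t by (rule point_series_not_summable[OF that]) simp
  show ?thesis
  proof (cases "?P (r_index b)")
    case True
    have "?P (norm lam) \<longleftrightarrow> norm lam \<le> r_index b" for lam :: "complex^'n"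
      using lt[of "norm lam"] gt[of "norm lam"] True by (cases "norm lam" "r_index b" rule: linorder_cases) auto
    then show ?thesis by (auto simp: point_spec_adj_iff)
  next
    case False
    have "?P (norm lam) \<longleftrightarrow> norm lam < r_index b" for lam :: "complex^'n"
      using lt[of "norm lam"] gt[of "norm lam"] False by (cases "norm lam" "r_index b" rule: linorder_cases) auto
    then show ?thesis by (auto simp: point_spec_adj_iff)
  qed
qed

section \<open>Assembling the Taylor and essential spectra\<close>

lemma taylor_spectrum_ball: "(taylor_spectrum b :: (complex^'n::{finite,linorder}) set) = cball 0 (R_index b)"
proof -
  have "lam \<in> taylor_spectrum b \<longleftrightarrow> norm lam \<le> R_index b" for lam :: "complex^'n::{finite,linorder}"
  proof
    show "norm lam \<le> R_index b" if "lam \<in> taylor_spectrum b"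
      using that koszul_exact_outside[of b C lam, OF bpos C] by (auto simp: taylor_spectrum_def not_le[symmetric])
  next
    assume R: "norm lam \<le> R_index b"
    show "lam \<in> taylor_spectrum b"
    proof (cases "i_index b \<le> norm lam")
      case True
      from infinite_cohomology_shell[of b C, OF bpos C True R] show ?thesis using taylor_ess_spectrum_subset by blast
    next
      case False
      then have "norm lam < r_index b" using i_index_le_r_index[of b C, OF bpos C] by simp
      then have "koszul_ker b lam CARD('n) \<noteq> koszul_ran b lam CARD('n)"
        using top_form_ker[of b C lam, OF bpos C] top_form_not_ran[of b C lam, OF bpos C] by blast
      then show ?thesis by (auto simp: taylor_spectrum_def)
    qed
  qed
  then show ?thesis by (simp add: set_eq_iff)
qed

lemma taylor_ess_spectrum_shell:
  "(taylor_ess_spectrum b :: (complex^'n::{finite,linorder}) set) = {z. i_index b \<le> norm z \<and> norm z \<le> R_index b}"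
proof -
  have "lam \<notin> taylor_ess_spectrum b" if "R_index b < norm lam" for lam :: "complex^'n::{finite,linorder}"
  proof
    assume "lam \<in> taylor_ess_spectrum b"
    then have "lam \<in> taylor_spectrum b" by (rule subsetD[OF taylor_ess_spectrum_subset])
    with that show False unfolding taylor_spectrum_ball by simp
  qed
  moreover have "lam \<notin> taylor_ess_spectrum b" if i: "norm lam < i_index b" for lam :: "complex^'n::{finite,linorder}"
  proof -
    have "\<exists>F. finite F \<and> F \<subseteq> koszul_ker b lam p \<and>
      (\<forall>\<omega>\<in>koszul_ker b lam p. \<exists>c. (\<lambda>S \<alpha>. \<omega> S \<alpha> - (\<Sum>\<eta>\<in>F. c \<eta> * \<eta> S \<alpha>)) \<in> koszul_ran b lam p)" for p
    proof (cases "p = CARD('n)")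
      case True
      have "\<exists>c. (\<lambda>S \<alpha>. \<omega> S \<alpha> - (\<Sum>\<eta>\<in>{top_form}. c \<eta> * \<eta> S \<alpha>)) \<in> koszul_ran b lam p" if w: "\<omega> \<in> koszul_ker b lam p" for \<omega>
      proof -
        from koszul_inside[of b C, OF bpos C i w] obtain a where
          "(\<lambda>S \<alpha>. \<omega> S \<alpha> - a * top_form S \<alpha>) \<in> koszul_ran b lam p" by blast
        then show ?thesis by (intro exI[of _ "\<lambda>_. a"]) simp
      qed
      then show ?thesis using top_form_ker[of b C lam, OF bpos C] True by (intro exI[of _ "{top_form}"]) simp
    next
      case False
      have "\<omega> \<in> koszul_ran b lam p" if w: "\<omega> \<in> koszul_ker b lam p" for \<omega>
        using koszul_inside[of b C, OF bpos C i w] False by auto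
      then show ?thesis by (intro exI[of _ "{}"]) simp
    qed
    then show ?thesis unfolding taylor_ess_spectrum_def by blast
  qed
  ultimately show ?thesis using infinite_cohomology_shell[of b C, OF bpos C] by (auto simp: not_less) (meson not_le)+
qed

end

theorem theorem3p4:
  fixes b :: "nat \<Rightarrow> real"
  assumes bpos: "\<And>k. b k > 0"
    and bbd: "bdd_above (range (\<lambda>k. b (Suc k) / b k))"
  shows "((\<lambda>j. SUP k. (b (k + j) / b k) powr (1 / real j)) \<longlonglongrightarrow> R_index b)
    \<and> ((\<lambda>j. INF k. (b (k + j) / b k) powr (1 / real j)) \<longlonglongrightarrow> i_index b)
    \<and> (i_index b \<le> r_index b)
    \<and> (r_index b \<le> R_index b)
    \<and> ((taylor_spectrum b :: (complex^'n::{finite,linorder}) set) = cball 0 (R_index b))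
    \<and> ((\<forall>z::complex^'n::{finite,linorder}. z \<in> ball 0 (r_index b) \<longrightarrow> (\<forall>f\<in>H2 b. converges_at f z))
         \<and> (\<forall>\<rho>>r_index b. \<not> (\<forall>z::complex^'n::{finite,linorder}. z \<in> ball 0 \<rho> \<longrightarrow> (\<forall>f\<in>H2 b. converges_at f z))))
    \<and> ((point_spec_adj b :: (complex^'n::{finite,linorder}) set) = ball 0 (r_index b)
         \<or> (point_spec_adj b :: (complex^'n::{finite,linorder}) set) = cball 0 (r_index b))
    \<and> ((approx_point_spec b :: (complex^'n::{finite,linorder}) set) = {z. i_index b \<le> norm z \<and> norm z \<le> R_index b})
    \<and> ((\<lambda>k. b (Suc (Suc k)) / b (Suc k) - b (Suc k) / b k) \<longlonglongrightarrow> 0 \<longrightarrow>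
         (taylor_ess_spectrum b :: (complex^'n::{finite,linorder}) set) =
           {z. real_of_ereal (liminf (\<lambda>k. ereal (b (Suc k) / b k))) \<le> norm z \<and>
               norm z \<le> real_of_ereal (limsup (\<lambda>k. ereal (b (Suc k) / b k)))})"
proof -
  from bbd obtain M where M: "\<And>k. b (Suc k) / b k \<le> M" by (auto simp: bdd_above_def)
  define C where "C = max M 1"
  have C: "C > 0" "b (Suc k) \<le> C * b k" for k
  proof -
    show "C > 0" by (simp add: C_def)
    have "b (Suc k) / b k \<le> C" using M[of k] by (simp add: C_def)
    then show "b (Suc k) \<le> C * b k" using bpos[of k] by (simp add: pos_divide_le_eq)
  qed
  note H = bpos C
  have 2: "\<not> (\<forall>z::complex^'n::{finite,linorder}. z \<in> ball 0 \<rho> \<longrightarrow> (\<forall>f\<in>H2 b. converges_at f z))" if "\<rho> > r_index b" for \<rho>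
    using H2_diverges_outside[of b C \<rho>, OF H that, where 'n='n] by auto
  have 4: "(approx_point_spec b :: (complex^'n::{finite,linorder}) set) = {z. i_index b \<le> norm z \<and> norm z \<le> R_index b}"
    using approx_point_spec_subset[of b C, OF H] approx_point_spec_superset[of b C, OF H] by blast
  have conv: "converges_at f z" if "norm z < r_index b" "f \<in> H2 b" for f and z :: "complex^'n::{finite,linorder}"
    by (rule H2_converges_at[of b C, OF H that(2,1)])
  have 1: "(taylor_spectrum b :: (complex^'n::{finite,linorder}) set) = cball 0 (R_index b)"
    by (rule taylor_spectrum_ball[of b C, OF H])
  have 3: "(point_spec_adj b :: (complex^'n::{finite,linorder}) set) = ball 0 (r_index b)
      \<or> (point_spec_adj b :: (complex^'n::{finite,linorder}) set) = cball 0 (r_index b)"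
    by (rule point_spec_adj_ball[of b C, OF H])
  have 5: "(taylor_ess_spectrum b :: (complex^'n::{finite,linorder}) set) = {z. i_index b \<le> norm z \<and> norm z \<le> R_index b}"
    by (rule taylor_ess_spectrum_shell[of b C, OF H])
  show ?thesis
    unfolding 1 4 5
    using R_index_characterization(1)[of b C, OF H] i_index_characterization(1)[of b C, OF H] i_index_le_r_index[of b C, OF H]
      r_index_le_R_index[of b C, OF H] conv 2 3 i_index_eq_liminf[of b C, OF H] R_index_eq_limsup[of b C, OF H]
    by simp
qed

end
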